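(* Assume that $p$ does not divide $r$. Let $N\in\mathcal{Z}$ be a separable polynomial. (i) The homomorphism of $K$-algebras $$\tau_{N,\mathrm{can}} : \hat{\mathcal{A}}_N \to (\mathcal{A}/N\mathcal{A})[[T]],\qquad X \mapsto \left(\frac{\tau_N^{\mathcal{C}}(Y)}{Y}\right)^{1/r}\cdot X$$ is an isomorphism of $K$-algebras which maps $N$ to $T$ and induces the identity of $\mathcal{A}/N\mathcal{A}$ after quotienting out by $N$ on the source and by $T$ on the target. (ii) $\tau_{N,\mathrm{can}}$ is the unique isomorphism of $K$-algebras $\tau_N : \hat{\mathcal{A}}_N \to (\mathcal{A}/N\mathcal{A})[[T]]$ which maps $N$ to $T$, induces the identity of $\mathcal{A}/N\mathcal{A}$ after quotienting out by $N$ on the source and by $T$ on the target, and satisfies the extra property $\tau_N(X) \in (\mathcal{Z}/N\mathcal{Z})[[T]]\cdot X$.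
   Context: Let $K$ be a field of characteristic $p$ with an automorphism $\theta$ of finite order $r$, and $F = \{a\in K : \theta(a)=a\}$. Let $\mathcal{A} = K[X^{\pm 1};\theta]$ be the ring of skew Laurent polynomials, with multiplication determined by $Xa = \theta(a)X$ for $a\in K$. Put $Y = X^r$, $\mathcal{C} = K[Y^{\pm1}]$ (a commutative subring) and $\mathcal{Z} = F[Y^{\pm 1}]$ (the centre of $\mathcal{A}$). A "$K$-algebra" is a possibly noncommutative ring $B$ with a ring homomorphism $K \to B$ (the image of $K$ need not be central). A polynomial $N\in\mathcal{Z}$ is separable if $N$ and $\frac{dN}{dY}$ generate the unit ideal of $\mathcal{Z}$. Set $\hat{\mathcal{A}}_N = \varprojlim_{m\ge 1} \mathcal{A}/N^m\mathcal{A}$ and $\hat{\mathcal{C}}_N = \varprojlim_{m\ge 1} \mathcal{C}/N^m\mathcal{C}$. In $(\mathcal{A}/N\mathcal{A})[[T]]$ the variable $T$ is central. $\tau_N^{\mathcal{C}} : \hat{\mathcal{C}}_N \to (\mathcal{C}/N\mathcal{C})[[T]]$ denotes the unique isomorphism of $K$-algebras mapping $N$ to $T$ and inducing the identity of $\mathcal{C}/N\mathcal{C}$ after reduction modulo $N$ on the source and modulo $T$ on the target. The element $\tau_N^{\mathcal{C}}(Y)$ lies in $(\mathcal{Z}/N\mathcal{Z})[[T]]$ and is congruent to (the class of) $Y$ modulo $T$, so that $\tau_N^{\mathcal{C}}(Y)/Y \equiv 1 \pmod T$. For a series $1+xT$ with $x \in (\mathcal{Z}/N\mathcal{Z})[[T]]$,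 its $1/r$-th power is $(1+xT)^{1/r} = \sum_{n\ge 0} c_n x^n T^n$ with $c_n = \frac{1}{n!}\cdot\frac1r\left(\frac1r-1\right)\cdots\left(\frac1r-(n-1)\right) \in \mathbb{Z}[\frac1r]$ (reduced modulo $p$ if $p>0$). *)

theory Defs
  imports Complex_Main "HOL-Library.Poly_Mapping" "HOL-Algebra.QuotRing"
begin

section \<open>Finite-order automorphisms of a field\<close>

definition field_automorphism :: "('k::field \<Rightarrow> 'k) \<Rightarrow> bool" where
  "field_automorphism \<theta> \<longleftrightarrow> bij \<theta> \<and> \<theta> 1 = 1 \<and>
     (\<forall>a b. \<theta> (a + b) = \<theta> a + \<theta> b) \<and> (\<forall>a b. \<theta> (a * b) = \<theta> a * \<theta> b)"

definition has_finite_order :: "('k \<Rightarrow> 'k) \<Rightarrow> nat \<Rightarrow> bool" where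
  "has_finite_order \<theta> r \<longleftrightarrow> 0 < r \<and> \<theta> ^^ r = id \<and> (\<forall>m. 0 < m \<and> m < r \<longrightarrow> \<theta> ^^ m \<noteq> id)"

definition fixed_field :: "('k \<Rightarrow> 'k) \<Rightarrow> 'k set" where
  "fixed_field \<theta> = {a. \<theta> a = a}"

definition aut_pow :: "('k \<Rightarrow> 'k) \<Rightarrow> int \<Rightarrow> 'k \<Rightarrow> 'k" where
  "aut_pow \<theta> i = (if 0 \<le> i then \<theta> ^^ nat i else (inv_into UNIV \<theta>) ^^ nat (- i))"


section \<open>Skew Laurent polynomials\<close>

text \<open>
  A finitely supported \<open>f\<close> stands for the sum of the monomials \<open>f\<^sub>i X\<^sup>i\<close>, with coefficients
  written on the left. The rule \<open>X a = \<theta>(a) X\<close> gives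
  \<open>(a X\<^sup>i) (b X\<^sup>j) = a \<theta>\<^sup>i(b) X\<^sup>i\<^sup>+\<^sup>j\<close>. The multiplication of the type \<open>int \<Rightarrow>\<^sub>0 'k\<close> itself is
  the untwisted one and is not used.
\<close>

definition skew_mult ::
    "('k::field \<Rightarrow> 'k) \<Rightarrow> (int \<Rightarrow>\<^sub>0 'k) \<Rightarrow> (int \<Rightarrow>\<^sub>0 'k) \<Rightarrow> (int \<Rightarrow>\<^sub>0 'k)" where
  "skew_mult \<theta> f g =
     (\<Sum>i\<in>Poly_Mapping.keys f. \<Sum>j\<in>Poly_Mapping.keys g.
        Poly_Mapping.single (i + j) (Poly_Mapping.lookup f i * aut_pow \<theta> i (Poly_Mapping.lookup g j)))"

definition skew_laurent :: "('k::field \<Rightarrow> 'k) \<Rightarrow> (int \<Rightarrow>\<^sub>0 'k) ring" where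
  "skew_laurent \<theta> =
     \<lparr>carrier = UNIV, mult = skew_mult \<theta>, one = Poly_Mapping.single 0 1, zero = 0, add = (+)\<rparr>"

abbreviation const_laurent :: "'k::field \<Rightarrow> (int \<Rightarrow>\<^sub>0 'k)" where
  "const_laurent a \<equiv> Poly_Mapping.single 0 a"

abbreviation X_pow :: "int \<Rightarrow> (int \<Rightarrow>\<^sub>0 'k::field)" where
  "X_pow i \<equiv> Poly_Mapping.single i 1"

text \<open>The subrings \<open>K[Y\<^sup>\<plusminus>\<^sup>1]\<close> and \<open>F[Y\<^sup>\<plusminus>\<^sup>1]\<close>, where \<open>Y = X\<^sup>r\<close>.\<close>

definition C_ring :: "('k::field \<Rightarrow> 'k) \<Rightarrow> nat \<Rightarrow> (int \<Rightarrow>\<^sub>0 'k) ring" where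
  "C_ring \<theta> r = skew_laurent \<theta> \<lparr>carrier := {f. \<forall>i\<in>Poly_Mapping.keys f. int r dvd i}\<rparr>"

definition Z_ring :: "('k::field \<Rightarrow> 'k) \<Rightarrow> nat \<Rightarrow> (int \<Rightarrow>\<^sub>0 'k) ring" where
  "Z_ring \<theta> r = skew_laurent \<theta> \<lparr>carrier :=
     {f. \<forall>i\<in>Poly_Mapping.keys f. int r dvd i \<and> Poly_Mapping.lookup f i \<in> fixed_field \<theta>}\<rparr>"

text \<open>The derivative with respect to \<open>Y\<close>: it sends \<open>a Y\<^sup>n = a X\<^sup>r\<^sup>n\<close> to \<open>n a Y\<^sup>n\<^sup>-\<^sup>1\<close>.\<close>

definition deriv_Y :: "nat \<Rightarrow> (int \<Rightarrow>\<^sub>0 'k::field) \<Rightarrow> (int \<Rightarrow>\<^sub>0 'k)" where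
  "deriv_Y r f =
     (\<Sum>i\<in>Poly_Mapping.keys f.
        Poly_Mapping.single (i - int r) (of_int (i div int r) * Poly_Mapping.lookup f i))"

definition separable_Y :: "('k::field \<Rightarrow> 'k) \<Rightarrow> nat \<Rightarrow> (int \<Rightarrow>\<^sub>0 'k) \<Rightarrow> bool" where
  "separable_Y \<theta> r N \<longleftrightarrow>
     genideal (Z_ring \<theta> r) {N, deriv_Y r N} = carrier (Z_ring \<theta> r)"


section \<open>Quotients and completions\<close>

text \<open>
  The ideal \<open>N\<^sup>m D\<close>. It is two-sided whenever \<open>N\<close> is central in \<open>D\<close>, which is the only case
  that occurs.
\<close>

definition pow_ideal :: "('a, 'm) ring_scheme \<Rightarrow> 'a \<Rightarrow> nat \<Rightarrow> 'a set" where
  "pow_ideal D N m = (N [^]\<^bsub>D\<^esub> m) <#\<^bsub>D\<^esub> carrier D"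

definition quot :: "('a, 'm) ring_scheme \<Rightarrow> 'a \<Rightarrow> 'a set ring" where
  "quot D N = D Quot (pow_ideal D N 1)"

definition quot_class :: "('a, 'm) ring_scheme \<Rightarrow> 'a \<Rightarrow> 'a \<Rightarrow> 'a set" where
  "quot_class D N a = pow_ideal D N 1 +>\<^bsub>D\<^esub> a"

text \<open>
  The map to \<open>D Quot J\<close> induced by an inclusion or an identity: a coset \<open>a + I\<close> with
  \<open>I \<subseteq> J\<close> is sent to \<open>a + J\<close>.
\<close>

definition coset_map :: "('a, 'm) ring_scheme \<Rightarrow> 'a set \<Rightarrow> 'a set \<Rightarrow> 'a set" where
  "coset_map D J S = S <+>\<^bsub>D\<^esub> J"

text \<open>The inverse limit of the rings \<open>D / N\<^sup>m D\<close> over \<open>m \<ge> 1\<close>.\<close>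

definition completion :: "('a, 'm) ring_scheme \<Rightarrow> 'a \<Rightarrow> (nat \<Rightarrow> 'a set) ring" where
  "completion D N =
     \<lparr>carrier = {x \<in> (\<Pi>\<^sub>E m\<in>{1..}. carrier (D Quot pow_ideal D N m)).
                   \<forall>m n. 1 \<le> m \<and> m \<le> n \<longrightarrow> coset_map D (pow_ideal D N m) (x n) = x m},
      mult = (\<lambda>x y. \<lambda>m\<in>{1..}. x m \<otimes>\<^bsub>D Quot pow_ideal D N m\<^esub> y m),
      one = (\<lambda>m\<in>{1..}. \<one>\<^bsub>D Quot pow_ideal D N m\<^esub>),
      zero = (\<lambda>m\<in>{1..}. \<zero>\<^bsub>D Quot pow_ideal D N m\<^esub>),
      add = (\<lambda>x y. \<lambda>m\<in>{1..}. x m \<oplus>\<^bsub>D Quot pow_ideal D N m\<^esub> y m)\<rparr>"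

definition to_completion :: "('a, 'm) ring_scheme \<Rightarrow> 'a \<Rightarrow> 'a \<Rightarrow> nat \<Rightarrow> 'a set" where
  "to_completion D N a = (\<lambda>m\<in>{1..}. pow_ideal D N m +>\<^bsub>D\<^esub> a)"


section \<open>Power series in a central variable\<close>

definition series_ring :: "('a, 'm) ring_scheme \<Rightarrow> (nat \<Rightarrow> 'a) ring" where
  "series_ring R =
     \<lparr>carrier = {s. \<forall>n. s n \<in> carrier R},
      mult = (\<lambda>s t n. \<Oplus>\<^bsub>R\<^esub>i\<in>{..n}. s i \<otimes>\<^bsub>R\<^esub> t (n - i)),
      one = (\<lambda>n. if n = 0 then \<one>\<^bsub>R\<^esub> else \<zero>\<^bsub>R\<^esub>),
      zero = (\<lambda>n. \<zero>\<^bsub>R\<^esub>),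
      add = (\<lambda>s t n. s n \<oplus>\<^bsub>R\<^esub> t n)\<rparr>"

definition series_const :: "('a, 'm) ring_scheme \<Rightarrow> 'a \<Rightarrow> nat \<Rightarrow> 'a" where
  "series_const R a = (\<lambda>n. if n = 0 then a else \<zero>\<^bsub>R\<^esub>)"

definition series_T :: "('a, 'm) ring_scheme \<Rightarrow> nat \<Rightarrow> 'a" where
  "series_T R = (\<lambda>n. if n = 1 then \<one>\<^bsub>R\<^esub> else \<zero>\<^bsub>R\<^esub>)"

text \<open>
  The image in a field of a rational number whose reduced denominator is invertible there.
\<close>

definition rat_to_field :: "rat \<Rightarrow> 'k::field" where
  "rat_to_field q = of_int (fst (quotient_of q)) / of_int (snd (quotient_of q))"

text \<open>
  The series \<open>(1 + x T)\<^sup>1\<^sup>/\<^sup>r = \<Sum> c\<^sub>n x\<^sup>n T\<^sup>n\<close> over \<open>R\<close>, where \<open>c\<^sub>n\<close> is the binomial coefficient of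
  \<open>1/r\<close> over \<open>n\<close> and \<open>\<iota>\<close> is the structure map from the field to \<open>R\<close>. Only the terms up to
  \<open>n = k\<close> contribute to the coefficient of \<open>T\<^sup>k\<close>.
\<close>

definition series_root_1p ::
    "('a, 'm) ring_scheme \<Rightarrow> ('k::field \<Rightarrow> 'a) \<Rightarrow> nat \<Rightarrow> (nat \<Rightarrow> 'a) \<Rightarrow> nat \<Rightarrow> 'a" where
  "series_root_1p R \<iota> r x = (\<lambda>k.
     (\<Oplus>\<^bsub>series_ring R\<^esub>n\<in>{..k}.
        series_const R (\<iota> (rat_to_field ((1 / of_nat r) gchoose n)))
          \<otimes>\<^bsub>series_ring R\<^esub> (x [^]\<^bsub>series_ring R\<^esub> n)
          \<otimes>\<^bsub>series_ring R\<^esub> (series_T R [^]\<^bsub>series_ring R\<^esub> n)) k)"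

text \<open>For \<open>u\<close> with constant coefficient \<open>1\<close>, the series \<open>x\<close> with \<open>u = 1 + x T\<close> is the shift of \<open>u\<close>.\<close>

definition series_root ::
    "('a, 'm) ring_scheme \<Rightarrow> ('k::field \<Rightarrow> 'a) \<Rightarrow> nat \<Rightarrow> (nat \<Rightarrow> 'a) \<Rightarrow> nat \<Rightarrow> 'a" where
  "series_root R \<iota> r u = series_root_1p R \<iota> r (\<lambda>n. u (Suc n))"


section \<open>Homomorphisms of algebras over the field\<close>

text \<open>
  An algebra is a ring \<open>B\<close> with a structure map \<open>\<iota>\<close> from the field. Maps are undefined outside
  the carrier of their source, so that they are determined by their values on it.
\<close>

definition alg_hom ::
    "('a, 'm) ring_scheme \<Rightarrow> ('k \<Rightarrow> 'a) \<Rightarrow> ('b, 'n) ring_scheme \<Rightarrow> ('k \<Rightarrow> 'b) \<Rightarrow> ('a \<Rightarrow> 'b) set" where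
  "alg_hom B \<iota> B' \<iota>' =
     {f \<in> ring_hom B B' \<inter> extensional (carrier B). \<forall>a. f (\<iota> a) = \<iota>' a}"

definition alg_iso ::
    "('a, 'm) ring_scheme \<Rightarrow> ('k \<Rightarrow> 'a) \<Rightarrow> ('b, 'n) ring_scheme \<Rightarrow> ('k \<Rightarrow> 'b) \<Rightarrow> ('a \<Rightarrow> 'b) set" where
  "alg_iso B \<iota> B' \<iota>' = {f \<in> alg_hom B \<iota> B' \<iota>'. bij_betw f (carrier B) (carrier B')}"

text \<open>In the following, \<open>D\<close> is the ring of skew Laurent polynomials or one of its subrings.\<close>

definition completion_str ::
    "(int \<Rightarrow>\<^sub>0 'k::field) ring \<Rightarrow> (int \<Rightarrow>\<^sub>0 'k) \<Rightarrow> 'k \<Rightarrow> nat \<Rightarrow> (int \<Rightarrow>\<^sub>0 'k) set" where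
  "completion_str D N a = to_completion D N (const_laurent a)"

definition quot_str ::
    "(int \<Rightarrow>\<^sub>0 'k::field) ring \<Rightarrow> (int \<Rightarrow>\<^sub>0 'k) \<Rightarrow> 'k \<Rightarrow> (int \<Rightarrow>\<^sub>0 'k) set" where
  "quot_str D N a = quot_class D N (const_laurent a)"

definition series_str ::
    "(int \<Rightarrow>\<^sub>0 'k::field) ring \<Rightarrow> (int \<Rightarrow>\<^sub>0 'k) \<Rightarrow> 'k \<Rightarrow> nat \<Rightarrow> (int \<Rightarrow>\<^sub>0 'k) set" where
  "series_str D N a = series_const (quot D N) (quot_str D N a)"

text \<open>
  Reduction modulo \<open>N\<close> on the completion is the projection \<open>x \<mapsto> x 1\<close> to \<open>D / N D\<close>, and reduction
  modulo \<open>T\<close> on power series is the constant coefficient; so the last conjunct says that \<open>\<tau>\<close>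
  induces the identity of \<open>D / N D\<close>.
\<close>

definition normalized_iso ::
    "(int \<Rightarrow>\<^sub>0 'k::field) ring \<Rightarrow> (int \<Rightarrow>\<^sub>0 'k) \<Rightarrow>
     ((nat \<Rightarrow> (int \<Rightarrow>\<^sub>0 'k) set) \<Rightarrow> (nat \<Rightarrow> (int \<Rightarrow>\<^sub>0 'k) set)) \<Rightarrow> bool" where
  "normalized_iso D N \<tau> \<longleftrightarrow>
     \<tau> \<in> alg_iso (completion D N) (completion_str D N) (series_ring (quot D N)) (series_str D N) \<and>
     \<tau> (to_completion D N N) = series_T (quot D N) \<and>
     (\<forall>x\<in>carrier (completion D N). \<tau> x 0 = x 1)"


section \<open>The canonical homomorphism\<close>

definition tau_C ::
    "('k::field \<Rightarrow> 'k) \<Rightarrow> nat \<Rightarrow> (int \<Rightarrow>\<^sub>0 'k) \<Rightarrow>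
     (nat \<Rightarrow> (int \<Rightarrow>\<^sub>0 'k) set) \<Rightarrow> (nat \<Rightarrow> (int \<Rightarrow>\<^sub>0 'k) set)" where
  "tau_C \<theta> r N = (THE \<tau>. normalized_iso (C_ring \<theta> r) N \<tau>)"

text \<open>
  The map from power series over a quotient of a subring of \<open>A\<close> to power series over \<open>A / N A\<close>.
\<close>

definition series_incl ::
    "('k::field \<Rightarrow> 'k) \<Rightarrow> (int \<Rightarrow>\<^sub>0 'k) \<Rightarrow> (nat \<Rightarrow> (int \<Rightarrow>\<^sub>0 'k) set) \<Rightarrow> nat \<Rightarrow> (int \<Rightarrow>\<^sub>0 'k) set" where
  "series_incl \<theta> N s =
     (\<lambda>n. coset_map (skew_laurent \<theta>) (pow_ideal (skew_laurent \<theta>) N 1) (s n))"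

definition series_X :: "('k::field \<Rightarrow> 'k) \<Rightarrow> (int \<Rightarrow>\<^sub>0 'k) \<Rightarrow> nat \<Rightarrow> (int \<Rightarrow>\<^sub>0 'k) set" where
  "series_X \<theta> N =
     series_const (quot (skew_laurent \<theta>) N) (quot_class (skew_laurent \<theta>) N (X_pow 1))"

definition tau_C_Y_over_Y ::
    "('k::field \<Rightarrow> 'k) \<Rightarrow> nat \<Rightarrow> (int \<Rightarrow>\<^sub>0 'k) \<Rightarrow> nat \<Rightarrow> (int \<Rightarrow>\<^sub>0 'k) set" where
  "tau_C_Y_over_Y \<theta> r N =
     series_incl \<theta> N (tau_C \<theta> r N (to_completion (C_ring \<theta> r) N (X_pow (int r))))
       \<otimes>\<^bsub>series_ring (quot (skew_laurent \<theta>) N)\<^esub>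
     series_const (quot (skew_laurent \<theta>) N)
       (quot_class (skew_laurent \<theta>) N (X_pow (- int r)))"

definition X_image ::
    "('k::field \<Rightarrow> 'k) \<Rightarrow> nat \<Rightarrow> (int \<Rightarrow>\<^sub>0 'k) \<Rightarrow> nat \<Rightarrow> (int \<Rightarrow>\<^sub>0 'k) set" where
  "X_image \<theta> r N =
     series_root (quot (skew_laurent \<theta>) N) (quot_str (skew_laurent \<theta>) N) r (tau_C_Y_over_Y \<theta> r N)
       \<otimes>\<^bsub>series_ring (quot (skew_laurent \<theta>) N)\<^esub> series_X \<theta> N"

definition is_hom_with_X_image ::
    "('k::field \<Rightarrow> 'k) \<Rightarrow> nat \<Rightarrow> (int \<Rightarrow>\<^sub>0 'k) \<Rightarrow>
     ((nat \<Rightarrow> (int \<Rightarrow>\<^sub>0 'k) set) \<Rightarrow> (nat \<Rightarrow> (int \<Rightarrow>\<^sub>0 'k) set)) \<Rightarrow> bool" where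
  "is_hom_with_X_image \<theta> r N \<tau> \<longleftrightarrow>
     \<tau> \<in> alg_hom (completion (skew_laurent \<theta>) N) (completion_str (skew_laurent \<theta>) N)
           (series_ring (quot (skew_laurent \<theta>) N)) (series_str (skew_laurent \<theta>) N) \<and>
     \<tau> (to_completion (skew_laurent \<theta>) N (X_pow 1)) = X_image \<theta> r N"

definition tau_can ::
    "('k::field \<Rightarrow> 'k) \<Rightarrow> nat \<Rightarrow> (int \<Rightarrow>\<^sub>0 'k) \<Rightarrow>
     (nat \<Rightarrow> (int \<Rightarrow>\<^sub>0 'k) set) \<Rightarrow> (nat \<Rightarrow> (int \<Rightarrow>\<^sub>0 'k) set)" where
  "tau_can \<theta> r N = (THE \<tau>. is_hom_with_X_image \<theta> r N \<tau>)"

text \<open>The set of all \<open>s X\<close> with \<open>s\<close> a power series over \<open>Z / N Z\<close>.\<close>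

definition Z_series_X ::
    "('k::field \<Rightarrow> 'k) \<Rightarrow> nat \<Rightarrow> (int \<Rightarrow>\<^sub>0 'k) \<Rightarrow> (nat \<Rightarrow> (int \<Rightarrow>\<^sub>0 'k) set) set" where
  "Z_series_X \<theta> r N =
     {series_incl \<theta> N s \<otimes>\<^bsub>series_ring (quot (skew_laurent \<theta>) N)\<^esub> series_X \<theta> N | s.
        s \<in> carrier (series_ring (quot (Z_ring \<theta> r) N))}"

end

theory Submission
  imports
    Defs
    "HOL-Computational_Algebra.Formal_Power_Series"
    "HOL-Computational_Algebra.Polynomial"
begin

text \<open>
  A homomorphism from \<open>D\<close> to power series over \<open>D / N D\<close> that sends \<open>N\<close> to \<open>T\<close> and lifts the
  quotient map extends uniquely to the completion of \<open>D\<close>, and the extension is automatically an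
  isomorphism. For \<open>K[Y\<^sup>\<plusminus>\<^sup>1]\<close> such a homomorphism is a root \<open>V\<close> of \<open>N(V) = T\<close> with \<open>V \<equiv> Y\<close>; separability
  makes \<open>N'(Y)\<close> invertible modulo \<open>N\<close>, so Newton iteration gives exactly one root, and it has
  coefficients in the centre. For the skew ring, \<open>X \<mapsto> s X\<close> with central \<open>s\<close> is such a homomorphism
  iff \<open>s\<^sup>r Y\<close> is this root \<open>V\<close>, and since \<open>r\<close> is invertible, \<open>V/Y\<close> has exactly one \<open>r\<close>-th root that
  is congruent to \<open>1\<close>, namely the binomial series.
\<close>

section \<open>Power series over a ring\<close>

text \<open>Equations in the quotient rings are lifted to representatives. Computations take place
  in \<open>fps\<close> over \<open>int \<Rightarrow>\<^sub>0 'k\<close> with its ordinary untwisted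
  product, which is a commutative domain, and an identity modulo \<open>N\<close> becomes
  divisibility of coefficients by \<open>N\<close>. Two facts justify this. The twisted product
  agrees with the ordinary one when one factor is central or when the left factor lies in
  \<open>K[Y\<^sup>\<plusminus>\<^sup>1]\<close>; the remaining products reduce to constants times
  central series. And if an element of \<open>K[Y\<^sup>\<plusminus>\<^sup>1]\<close> is a multiple
  of \<open>N\<close> in the whole domain, the cofactor can be taken in
  \<open>K[Y\<^sup>\<plusminus>\<^sup>1]\<close>, so congruence modulo \<open>N\<close> means the
  same in the small ring and in the large one. The price is that \<open>V\<close> is a root only
  modulo \<open>N\<close>, as one representative among many.

  The skew ring and \<open>K[Y\<^sup>\<plusminus>\<^sup>1]\<close> are the cases
  \<open>d = 1\<close> and \<open>d = r\<close> of the Laurent polynomials in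
  \<open>X\<^sup>d\<close>, so one argument serves both completions.\<close>

lemma series_ring_simps [simp]:
  "carrier (series_ring R) = {s. \<forall>n. s n \<in> carrier R}"
  "s \<oplus>\<^bsub>series_ring R\<^esub> t = (\<lambda>n. s n \<oplus>\<^bsub>R\<^esub> t n)"
  "\<zero>\<^bsub>series_ring R\<^esub> = (\<lambda>n. \<zero>\<^bsub>R\<^esub>)"
  by (simp_all add: series_ring_def)

lemma series_mult_nth:
  "(s \<otimes>\<^bsub>series_ring R\<^esub> t) n = (\<Oplus>\<^bsub>R\<^esub>i\<in>{..n}. s i \<otimes>\<^bsub>R\<^esub> t (n - i))"
  by (simp add: series_ring_def)

lemma series_one_nth: "\<one>\<^bsub>series_ring R\<^esub> n = (if n = 0 then \<one>\<^bsub>R\<^esub> else \<zero>\<^bsub>R\<^esub>)"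
  by (simp add: series_ring_def)

text \<open>Both sides run over the pairs of indices with sum at most \<open>k\<close>. Keeping the
  bound \<open>k\<close> apart from \<open>n\<close> makes the induction work: raising
  \<open>k\<close> adds one diagonal and leaves the third argument of the old terms alone.
  Associativity of the series product is the case \<open>k = n\<close>.\<close>

lemma (in abelian_monoid) finsum_triangle_swap:
  assumes "\<And>i j k. f i j k \<in> carrier G"
  shows "(\<Oplus>i\<in>{..k::nat}. \<Oplus>j\<in>{..i}. f j (i - j) (n - i)) =
         (\<Oplus>j\<in>{..k}. \<Oplus>i\<in>{..k - j}. f j i (n - j - i))"
proof (induction k)
  case 0
  then show ?case using assms by simp
next
  case (Suc k)
  have "(\<Oplus>j\<in>{..k}. \<Oplus>i\<in>{..Suc k - j}. f j i (n - j - i)) =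
      (\<Oplus>j\<in>{..k}. f j (Suc k - j) (n - Suc k) \<oplus> (\<Oplus>i\<in>{..k - j}. f j i (n - j - i)))"
    by (rule finsum_cong') (use assms in \<open>auto simp: Suc_diff_le\<close>)
  also have "\<dots> = (\<Oplus>j\<in>{..k}. f j (Suc k - j) (n - Suc k)) \<oplus>
      (\<Oplus>j\<in>{..k}. \<Oplus>i\<in>{..k - j}. f j i (n - j - i))"
    by (rule finsum_addf) (use assms in auto)
  finally show ?case
    using assms Suc by (simp add: Pi_def a_assoc)
qed

lemma (in ring) finsum_atMost_delta:
  assumes "a \<in> carrier R" "k \<le> n"
  shows "(\<Oplus>i\<in>{..n::nat}. if i = k then a else \<zero>) = a"
  using add.finprod_singleton_swap[of k "{..n}" "\<lambda>_. a"] assms by simp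

lemma (in ring) series_one_mult:
  assumes "s \<in> carrier (series_ring R)"
  shows "\<one>\<^bsub>series_ring R\<^esub> \<otimes>\<^bsub>series_ring R\<^esub> s = s"
proof
  fix n
  have "(\<one>\<^bsub>series_ring R\<^esub> \<otimes>\<^bsub>series_ring R\<^esub> s) n = (\<Oplus>i\<in>{..n}. if i = 0 then s n else \<zero>)"
    unfolding series_mult_nth series_one_nth by (rule finsum_cong') (use assms in auto)
  then show "(\<one>\<^bsub>series_ring R\<^esub> \<otimes>\<^bsub>series_ring R\<^esub> s) n = s n"
    using assms by (simp add: finsum_atMost_delta)
qed

lemma (in ring) series_mult_one:
  assumes "s \<in> carrier (series_ring R)"
  shows "s \<otimes>\<^bsub>series_ring R\<^esub> \<one>\<^bsub>series_ring R\<^esub> = s"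
proof
  fix n
  have "(s \<otimes>\<^bsub>series_ring R\<^esub> \<one>\<^bsub>series_ring R\<^esub>) n = (\<Oplus>i\<in>{..n}. if i = n then s n else \<zero>)"
    unfolding series_mult_nth series_one_nth by (rule finsum_cong') (use assms in auto)
  then show "(s \<otimes>\<^bsub>series_ring R\<^esub> \<one>\<^bsub>series_ring R\<^esub>) n = s n"
    using assms by (simp add: finsum_atMost_delta)
qed

lemma (in ring) series_mult_closed:
  assumes "s \<in> carrier (series_ring R)" "t \<in> carrier (series_ring R)"
  shows "s \<otimes>\<^bsub>series_ring R\<^esub> t \<in> carrier (series_ring R)"
  using assms by (auto simp: series_mult_nth intro!: finsum_closed)

lemma (in ring) series_mult_assoc:
  assumes "s \<in> carrier (series_ring R)" "t \<in> carrier (series_ring R)" "u \<in> carrier (series_ring R)"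
  shows "s \<otimes>\<^bsub>series_ring R\<^esub> t \<otimes>\<^bsub>series_ring R\<^esub> u = s \<otimes>\<^bsub>series_ring R\<^esub> (t \<otimes>\<^bsub>series_ring R\<^esub> u)"
proof
  fix n
  have carr [simp]: "s i \<in> carrier R" "t i \<in> carrier R" "u i \<in> carrier R" for i
    using assms by auto
  have "(s \<otimes>\<^bsub>series_ring R\<^esub> t \<otimes>\<^bsub>series_ring R\<^esub> u) n =
      (\<Oplus>i\<in>{..n}. \<Oplus>j\<in>{..i}. s j \<otimes> t (i - j) \<otimes> u (n - i))"
    unfolding series_mult_nth
    by (rule finsum_cong') (auto intro!: finsum_ldistr finsum_closed)
  also have "\<dots> = (\<Oplus>j\<in>{..n}. \<Oplus>i\<in>{..n - j}. s j \<otimes> t i \<otimes> u (n - j - i))"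
    by (rule finsum_triangle_swap[where f = "\<lambda>i j k. s i \<otimes> t j \<otimes> u k"]) auto
  also have "\<dots> = (\<Oplus>j\<in>{..n}. s j \<otimes> (\<Oplus>i\<in>{..n - j}. t i \<otimes> u (n - j - i)))"
    by (rule finsum_cong') (auto simp: finsum_rdistr m_assoc Pi_def intro!: finsum_closed finsum_cong')
  finally show "(s \<otimes>\<^bsub>series_ring R\<^esub> t \<otimes>\<^bsub>series_ring R\<^esub> u) n =
      (s \<otimes>\<^bsub>series_ring R\<^esub> (t \<otimes>\<^bsub>series_ring R\<^esub> u)) n"
    unfolding series_mult_nth .
qed

lemma (in ring) ring_series_ring: "ring (series_ring R)"
proof (rule ringI)
  show "abelian_group (series_ring R)"
  proof (rule abelian_groupI)
    fix s assume "s \<in> carrier (series_ring R)"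
    then show "\<exists>t\<in>carrier (series_ring R). t \<oplus>\<^bsub>series_ring R\<^esub> s = \<zero>\<^bsub>series_ring R\<^esub>"
      by (intro bexI[of _ "\<lambda>n. \<ominus> s n"]) (auto simp: l_neg)
  qed (auto simp: a_ac)
  show "Group.monoid (series_ring R)"
    by (rule monoidI)
      (use series_mult_closed series_mult_assoc series_one_mult series_mult_one
        in \<open>auto simp: series_one_nth simp del: series_ring_simps(2-)\<close>)
next
  fix x y z
  assume "x \<in> carrier (series_ring R)" "y \<in> carrier (series_ring R)" "z \<in> carrier (series_ring R)"
  then have [simp]: "x i \<in> carrier R" "y i \<in> carrier R" "z i \<in> carrier R" for i by auto
  show "(x \<oplus>\<^bsub>series_ring R\<^esub> y) \<otimes>\<^bsub>series_ring R\<^esub> z =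
      x \<otimes>\<^bsub>series_ring R\<^esub> z \<oplus>\<^bsub>series_ring R\<^esub> y \<otimes>\<^bsub>series_ring R\<^esub> z"
    by (rule ext) (simp add: series_mult_nth l_distr flip: finsum_addf)
  show "z \<otimes>\<^bsub>series_ring R\<^esub> (x \<oplus>\<^bsub>series_ring R\<^esub> y) =
      z \<otimes>\<^bsub>series_ring R\<^esub> x \<oplus>\<^bsub>series_ring R\<^esub> z \<otimes>\<^bsub>series_ring R\<^esub> y"
    by (rule ext) (simp add: series_mult_nth r_distr flip: finsum_addf)
qed

lemma (in ring) series_T_mult:
  assumes "s \<in> carrier (series_ring R)"
  shows "(series_T R \<otimes>\<^bsub>series_ring R\<^esub> s) n = (if n = 0 then \<zero> else s (n - 1))"
proof -
  have "(series_T R \<otimes>\<^bsub>series_ring R\<^esub> s) n =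
      (\<Oplus>i\<in>{..n}. if i = 1 then (if n = 0 then \<zero> else s (n - 1)) else \<zero>)"
    unfolding series_mult_nth by (rule finsum_cong') (use assms in \<open>auto simp: series_T_def\<close>)
  also have "\<dots> = (if n = 0 then \<zero> else s (n - 1))"
    using assms by (cases "n = 0") (simp_all add: finsum_atMost_delta)
  finally show ?thesis .
qed

section \<open>Completions along a central element\<close>

locale central_element = ring D for D (structure) +
  fixes N
  assumes N_closed [simp]: "N \<in> carrier D"
    and N_central: "a \<in> carrier D \<Longrightarrow> N \<otimes> a = a \<otimes> N"
begin

abbreviation "I \<equiv> pow_ideal D N"
abbreviation "S \<equiv> series_ring (quot D N)"
abbreviation "Dhat \<equiv> completion D N"

lemma pow_ideal_iff: "x \<in> I m \<longleftrightarrow> (\<exists>a\<in>carrier D. x = N [^] m \<otimes> a)"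
  by (auto simp: pow_ideal_def l_coset_def)

lemma N_pow_central:
  assumes "a \<in> carrier D"
  shows "N [^] (m::nat) \<otimes> a = a \<otimes> N [^] m"
proof (induction m)
  case (Suc m)
  have "N [^] Suc m \<otimes> a = N [^] m \<otimes> a \<otimes> N"
    using assms by (simp add: m_assoc N_central)
  then show ?case
    using assms Suc by (simp add: m_assoc)
qed (use assms in simp)

lemma ideal_pow_ideal: "ideal (I m) D"
proof (rule idealI[OF ring_axioms])
  show "subgroup (I m) (add_monoid D)"
  proof (rule add.subgroupI)
    show "I m \<subseteq> carrier D" "I m \<noteq> {}"
      by (auto simp: pow_ideal_def l_coset_def)
  next
    fix a assume "a \<in> I m"
    then obtain b where "b \<in> carrier D" "a = N [^] m \<otimes> b" by (auto simp: pow_ideal_iff)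
    then show "\<ominus> a \<in> I m"
      by (auto simp: pow_ideal_iff r_minus intro!: bexI[of _ "\<ominus> b"])
  next
    fix a a' assume "a \<in> I m" "a' \<in> I m"
    then obtain b b' where "b \<in> carrier D" "a = N [^] m \<otimes> b" "b' \<in> carrier D" "a' = N [^] m \<otimes> b'"
      by (auto simp: pow_ideal_iff)
    then show "a \<oplus> a' \<in> I m"
      by (auto simp: pow_ideal_iff r_distr intro!: bexI[of _ "b \<oplus> b'"])
  qed
next
  fix a x assume "a \<in> I m" and x: "x \<in> carrier D"
  then obtain b where b: "b \<in> carrier D" "a = N [^] m \<otimes> b" by (auto simp: pow_ideal_iff)
  with x show "a \<otimes> x \<in> I m"
    by (auto simp: pow_ideal_iff m_assoc intro!: bexI[of _ "b \<otimes> x"])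
  have "x \<otimes> a = N [^] m \<otimes> (x \<otimes> b)"
    using b x by (metis N_pow_central m_assoc N_closed nat_pow_closed)
  then show "x \<otimes> a \<in> I m"
    using b x by (auto simp: pow_ideal_iff intro!: bexI[of _ "x \<otimes> b"])
qed

lemma pow_ideal_antimono:
  assumes "m \<le> n" shows "I n \<subseteq> I m"
proof
  fix x assume "x \<in> I n"
  then obtain a where a: "a \<in> carrier D" "x = N [^] n \<otimes> a" by (auto simp: pow_ideal_iff)
  have "N [^] n = N [^] m \<otimes> N [^] (n - m)"
    using assms by (simp add: nat_pow_mult)
  with a have "x = N [^] m \<otimes> (N [^] (n - m) \<otimes> a)" by (simp add: m_assoc)
  then show "x \<in> I m"
    using a by (auto simp: pow_ideal_iff intro!: bexI[of _ "N [^] (n - m) \<otimes> a"])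
qed

lemma pow_ideal_subset [simp]: "I m \<subseteq> carrier D"
  by (auto simp: pow_ideal_iff)

text \<open>The explicit witness \<open>c\<close>, in place of membership of the difference in the
  ideal, gives an equation to which a homomorphism can be applied.\<close>

lemma class_eq_iff:
  assumes "a \<in> carrier D" "b \<in> carrier D"
  shows "I m +> a = I m +> b \<longleftrightarrow> (\<exists>c\<in>carrier D. a = b \<oplus> N [^] m \<otimes> c)"
proof -
  interpret ideal "I m" D by (rule ideal_pow_ideal)
  have "I m +> a = I m +> b \<longleftrightarrow> a \<ominus> b \<in> I m"
    using assms by (rule quotient_eq_iff_same_a_r_cos[OF ideal_pow_ideal, symmetric])
  also have "\<dots> \<longleftrightarrow> (\<exists>c\<in>carrier D. a \<ominus> b = N [^] m \<otimes> c)"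
    by (simp add: pow_ideal_iff)
  also have "\<dots> \<longleftrightarrow> (\<exists>c\<in>carrier D. a = b \<oplus> N [^] m \<otimes> c)"
  proof (rule bex_cong[OF refl])
    fix c assume "c \<in> carrier D"
    then show "a \<ominus> b = N [^] m \<otimes> c \<longleftrightarrow> a = b \<oplus> N [^] m \<otimes> c"
      using assms
      by (metis a_comm add.inv_solve_right' minus_eq m_closed N_closed nat_pow_closed)
  qed
  finally show ?thesis .
qed

lemma class_in_carrier [simp]: "a \<in> carrier D \<Longrightarrow> I m +> a \<in> carrier (D Quot I m)"
  by (simp add: FactRing_def a_rcosetsI)

lemma carrier_Quot_iff:
  "c \<in> carrier (D Quot I m) \<longleftrightarrow> (\<exists>a\<in>carrier D. c = I m +> a)"
  by (auto simp: FactRing_def A_RCOSETS_def')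

lemma class_add:
  assumes "a \<in> carrier D" "b \<in> carrier D"
  shows "(I m +> a) \<oplus>\<^bsub>D Quot I m\<^esub> (I m +> b) = I m +> (a \<oplus> b)"
  using ideal.rcos_ring_hom[OF ideal_pow_ideal, of m] assms by (simp add: ring_hom_def)

lemma class_mult:
  assumes "a \<in> carrier D" "b \<in> carrier D"
  shows "(I m +> a) \<otimes>\<^bsub>D Quot I m\<^esub> (I m +> b) = I m +> (a \<otimes> b)"
  using ideal.rcos_ring_hom[OF ideal_pow_ideal, of m] assms by (simp add: ring_hom_def)

lemma class_one: "I m +> \<one> = \<one>\<^bsub>D Quot I m\<^esub>"
  by (simp add: FactRing_def)

lemma coset_map_class:
  assumes "a \<in> carrier D" "m \<le> n"
  shows "coset_map D (I m) (I n +> a) = I m +> a"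
proof (intro equalityI subsetI)
  fix x assume "x \<in> coset_map D (I m) (I n +> a)"
  then obtain b c where bc: "b \<in> I n" "c \<in> I m" "x = b \<oplus> a \<oplus> c"
    by (auto simp: coset_map_def set_add_def' a_r_coset_def')
  then have "b \<in> I m" using pow_ideal_antimono[OF assms(2)] by auto
  then have "b \<oplus> c \<in> I m" "b \<in> carrier D" "c \<in> carrier D"
    using bc subsetD[OF pow_ideal_subset] ideal_pow_ideal
    by (auto intro: additive_subgroup.a_closed[OF ideal.axioms(1)])
  moreover have "x = b \<oplus> c \<oplus> a"
    using bc assms(1) \<open>b \<in> carrier D\<close> \<open>c \<in> carrier D\<close> by (simp add: a_ac)
  ultimately show "x \<in> I m +> a" by (auto simp: a_r_coset_def')
next
  fix x assume "x \<in> I m +> a"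
  then obtain c where c: "c \<in> I m" "x = c \<oplus> a" by (auto simp: a_r_coset_def')
  moreover have "\<zero> \<in> I n"
    using ideal_pow_ideal by (intro additive_subgroup.zero_closed[OF ideal.axioms(1)])
  moreover have "c \<in> carrier D" using c pow_ideal_subset by blast
  then have "x = \<zero> \<oplus> a \<oplus> c" using c assms(1) by (simp add: a_comm)
  ultimately show "x \<in> coset_map D (I m) (I n +> a)"
    unfolding coset_map_def set_add_def' a_r_coset_def' by blast
qed

lemma completion_simps:
  "x \<otimes>\<^bsub>Dhat\<^esub> y = (\<lambda>m\<in>{1..}. x m \<otimes>\<^bsub>D Quot I m\<^esub> y m)"
  "x \<oplus>\<^bsub>Dhat\<^esub> y = (\<lambda>m\<in>{1..}. x m \<oplus>\<^bsub>D Quot I m\<^esub> y m)"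
  "\<one>\<^bsub>Dhat\<^esub> = (\<lambda>m\<in>{1..}. \<one>\<^bsub>D Quot I m\<^esub>)"
  by (simp_all add: completion_def)

text \<open>By compatibility, a representative at level \<open>m\<close> represents all lower levels
  as well. Finitely many levels can thus be handled with one element of \<open>D\<close>.\<close>

lemma completionE:
  assumes "x \<in> carrier Dhat" "1 \<le> m"
  obtains a where "a \<in> carrier D" "\<And>k. \<lbrakk>1 \<le> k; k \<le> m\<rbrakk> \<Longrightarrow> x k = I k +> a"
proof -
  from assms have "x m \<in> carrier (D Quot I m)" by (auto simp: completion_def PiE_def Pi_def)
  then obtain a where a: "a \<in> carrier D" "x m = I m +> a" by (auto simp: carrier_Quot_iff)
  have "x k = I k +> a" if "1 \<le> k" "k \<le> m" for k
  proof -
    have "x k = coset_map D (I k) (x m)" using assms that by (simp add: completion_def)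
    then show ?thesis using a that coset_map_class by simp
  qed
  with a show thesis by (intro that) auto
qed

lemma completion_nth:
  assumes "x \<in> carrier Dhat" "1 \<le> m"
  obtains a where "a \<in> carrier D" "x m = I m +> a"
  by (rule completionE[OF assms]) (use assms(2) that in simp)

lemma completionI:
  assumes "x \<in> extensional {1..}"
    and "\<And>m. 1 \<le> m \<Longrightarrow> \<exists>a\<in>carrier D. \<forall>k. 1 \<le> k \<and> k \<le> m \<longrightarrow> x k = I k +> a"
  shows "x \<in> carrier Dhat"
proof -
  have "x m \<in> carrier (D Quot I m)" if "1 \<le> m" for m
    using assms(2)[OF that] that by auto
  moreover have "coset_map D (I m) (x n) = x m" if "1 \<le> m" "m \<le> n" for m n
    using assms(2)[of n] that by (auto simp: coset_map_class)
  ultimately show ?thesis using assms(1) by (auto simp: completion_def PiE_def)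
qed

lemma to_completion_nth: "1 \<le> m \<Longrightarrow> to_completion D N a m = I m +> a"
  by (simp add: to_completion_def)

lemma to_completion_closed [simp]: "a \<in> carrier D \<Longrightarrow> to_completion D N a \<in> carrier Dhat"
  by (rule completionI) (auto simp: to_completion_def)

lemma to_completion_hom: "to_completion D N \<in> ring_hom D Dhat"
proof (rule ring_hom_memI)
  fix a b assume "a \<in> carrier D" "b \<in> carrier D"
  then show "to_completion D N (a \<otimes> b) = to_completion D N a \<otimes>\<^bsub>Dhat\<^esub> to_completion D N b"
    "to_completion D N (a \<oplus> b) = to_completion D N a \<oplus>\<^bsub>Dhat\<^esub> to_completion D N b"
    by (auto simp: completion_simps to_completion_def class_mult class_add intro!: restrict_ext)
qed (simp_all add: completion_simps class_one, simp add: to_completion_def class_one)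

lemma completion_add_closed:
  assumes "x \<in> carrier Dhat" "y \<in> carrier Dhat"
  shows "x \<oplus>\<^bsub>Dhat\<^esub> y \<in> carrier Dhat"
proof (rule completionI)
  fix m :: nat assume "1 \<le> m"
  obtain a where a: "a \<in> carrier D" "\<And>k. \<lbrakk>1 \<le> k; k \<le> m\<rbrakk> \<Longrightarrow> x k = I k +> a"
    using completionE[OF assms(1) \<open>1 \<le> m\<close>] by blast
  obtain b where b: "b \<in> carrier D" "\<And>k. \<lbrakk>1 \<le> k; k \<le> m\<rbrakk> \<Longrightarrow> y k = I k +> b"
    using completionE[OF assms(2) \<open>1 \<le> m\<close>] by blast
  from a b show "\<exists>a\<in>carrier D. \<forall>k. 1 \<le> k \<and> k \<le> m \<longrightarrow> (x \<oplus>\<^bsub>Dhat\<^esub> y) k = I k +> a"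
    by (intro bexI[of _ "a \<oplus> b"]) (auto simp: completion_simps class_add)
qed (simp add: completion_simps)

lemma completion_mult_closed:
  assumes "x \<in> carrier Dhat" "y \<in> carrier Dhat"
  shows "x \<otimes>\<^bsub>Dhat\<^esub> y \<in> carrier Dhat"
proof (rule completionI)
  fix m :: nat assume "1 \<le> m"
  obtain a where a: "a \<in> carrier D" "\<And>k. \<lbrakk>1 \<le> k; k \<le> m\<rbrakk> \<Longrightarrow> x k = I k +> a"
    using completionE[OF assms(1) \<open>1 \<le> m\<close>] by blast
  obtain b where b: "b \<in> carrier D" "\<And>k. \<lbrakk>1 \<le> k; k \<le> m\<rbrakk> \<Longrightarrow> y k = I k +> b"
    using completionE[OF assms(2) \<open>1 \<le> m\<close>] by blast
  from a b show "\<exists>a\<in>carrier D. \<forall>k. 1 \<le> k \<and> k \<le> m \<longrightarrow> (x \<otimes>\<^bsub>Dhat\<^esub> y) k = I k +> a"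
    by (intro bexI[of _ "a \<otimes> b"]) (auto simp: completion_simps class_mult)
qed (simp add: completion_simps)

lemma ring_quot: "ring (quot D N)"
  unfolding quot_def using ideal_pow_ideal by (rule ideal.quotient_is_ring)

lemma ring_S: "ring S"
  using ring_quot by (rule ring.ring_series_ring)

lemma quot_class_hom: "quot_class D N \<in> ring_hom D (quot D N)"
  unfolding quot_def quot_class_def using ideal.rcos_ring_hom[OF ideal_pow_ideal] by simp

lemma carrier_quot_iff: "c \<in> carrier (quot D N) \<longleftrightarrow> (\<exists>a\<in>carrier D. c = quot_class D N a)"
  by (simp add: quot_def quot_class_def carrier_Quot_iff)

end

text \<open>
  A homomorphism into the power series ring that sends \<open>N\<close> to \<open>T\<close> and lifts the quotient map
  sends \<open>N\<^sup>m D\<close> exactly to the series of order at least \<open>m\<close>. Hence it extends uniquely to the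
  completion, no continuity being needed, and the extension is bijective.
\<close>

locale series_lift = central_element +
  fixes \<phi>
  assumes \<phi>_hom: "\<phi> \<in> ring_hom D S"
    and \<phi>_N: "\<phi> N = series_T (quot D N)"
    and \<phi>_0: "a \<in> carrier D \<Longrightarrow> \<phi> a 0 = quot_class D N a"
begin

text \<open>As \<open>N\<close> goes to \<open>T\<close>, multiplication by a power of
  \<open>N\<close> turns into a shift of the coefficients.\<close>

lemma hom_T_pow_mult:
  assumes "h \<in> ring_hom D S" "h N = series_T (quot D N)" "a \<in> carrier D"
  shows "h (N [^] m \<otimes> a) k = (if k < m then \<zero>\<^bsub>quot D N\<^esub> else h a (k - m))"
proof (induction m arbitrary: k)
  case 0
  then show ?case using assms by simp
next
  case (Suc m)
  have closed: "N [^] m \<otimes> a \<in> carrier D" using assms by simp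
  have "N [^] Suc m \<otimes> a = N \<otimes> (N [^] m \<otimes> a)"
    using assms by (simp only: nat_pow_Suc2 N_closed m_assoc nat_pow_closed)
  then have "h (N [^] Suc m \<otimes> a) = series_T (quot D N) \<otimes>\<^bsub>S\<^esub> h (N [^] m \<otimes> a)"
    using assms closed by (metis N_closed ring_hom_mult)
  then show ?case
    using Suc ring.series_T_mult[OF ring_quot ring_hom_closed[OF assms(1) closed], of k] by auto
qed

lemma \<phi>_closed [simp]: "a \<in> carrier D \<Longrightarrow> \<phi> a k \<in> carrier (quot D N)"
  using ring_hom_closed[OF \<phi>_hom] by simp

lemma \<phi>_add: "a \<in> carrier D \<Longrightarrow> b \<in> carrier D \<Longrightarrow> \<phi> (a \<oplus> b) k = \<phi> a k \<oplus>\<^bsub>quot D N\<^esub> \<phi> b k"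
  using ring_hom_add[OF \<phi>_hom] by simp

lemma \<phi>_class_cong:
  assumes "a \<in> carrier D" "b \<in> carrier D" "I m +> a = I m +> b" "k < m"
  shows "\<phi> a k = \<phi> b k"
proof -
  interpret quot: ring "quot D N" by (rule ring_quot)
  obtain c where c: "c \<in> carrier D" "a = b \<oplus> N [^] m \<otimes> c"
    using assms class_eq_iff by auto
  then show ?thesis
    using assms by (simp add: \<phi>_add hom_T_pow_mult[OF \<phi>_hom \<phi>_N])
qed

text \<open>If \<open>a\<close> and \<open>b\<close> differ by \<open>N^m c\<close>, their
  coefficients of index \<open>m\<close> differ by \<open>\<phi> c 0\<close>, the class of
  \<open>c\<close>. Equality there puts \<open>c\<close> into \<open>N D\<close>, which gains one
  more power of \<open>N\<close>.\<close>

lemma \<phi>_class_cancel: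
  assumes "a \<in> carrier D" "b \<in> carrier D" "\<And>k. k < m \<Longrightarrow> \<phi> a k = \<phi> b k"
  shows "I m +> a = I m +> b"
  using assms(3)
proof (induction m)
  case 0
  have "\<exists>c\<in>carrier D. a = b \<oplus> N [^] (0::nat) \<otimes> c"
    using assms by (intro bexI[of _ "a \<ominus> b"]) (simp_all add: minus_eq a_lcomm[of b a] r_neg)
  then show ?case using assms class_eq_iff by blast
next
  case (Suc m)
  interpret quot: ring "quot D N" by (rule ring_quot)
  from Suc obtain c where c: "c \<in> carrier D" "a = b \<oplus> N [^] m \<otimes> c"
    using assms class_eq_iff by force
  have "\<phi> b m = \<phi> b m \<oplus>\<^bsub>quot D N\<^esub> \<phi> c 0"
    using Suc.prems[of m] c assms by (simp add: \<phi>_add hom_T_pow_mult[OF \<phi>_hom \<phi>_N])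
  then have "quot_class D N c = quot_class D N \<zero>"
    using c assms \<phi>_0[of c] \<phi>_closed[OF c(1), of 0] quot.add.l_cancel_one'[of "\<phi> b m" "\<phi> c 0"]
      ring_hom_zero[OF quot_class_hom ring_axioms ring_quot] by simp
  then obtain d where d: "d \<in> carrier D" "c = \<zero> \<oplus> N [^] (1::nat) \<otimes> d"
    using c class_eq_iff[OF c(1) zero_closed] by (auto simp: quot_class_def)
  have "a = b \<oplus> N [^] Suc m \<otimes> d"
    using c d by (simp add: m_assoc)
  then show ?case using d(1) assms class_eq_iff by blast
qed

lemma \<phi>_approx:
  assumes "s \<in> carrier S"
  shows "\<exists>a\<in>carrier D. \<forall>k<m. \<phi> a k = s k"
proof (induction m)
  case (Suc m)
  interpret quot: ring "quot D N" by (rule ring_quot)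
  from Suc obtain a where a: "a \<in> carrier D" "\<And>k. k < m \<Longrightarrow> \<phi> a k = s k" by auto
  have sm: "s m \<in> carrier (quot D N)" using assms by simp
  then obtain b where b: "b \<in> carrier D" "s m \<ominus>\<^bsub>quot D N\<^esub> \<phi> a m = quot_class D N b"
    using a carrier_quot_iff by (meson \<phi>_closed quot.minus_closed)
  \<comment> \<open>Here \<open>b\<close> lifts the error in the coefficient of index
    \<open>m\<close>. Adding \<open>N^m b\<close> corrects that coefficient and does not touch the
    earlier ones.\<close>
  have "\<phi> (a \<oplus> N [^] m \<otimes> b) k = s k" if "k < Suc m" for k
  proof (cases "k = m")
    case True
    have "\<phi> (a \<oplus> N [^] m \<otimes> b) k = \<phi> a m \<oplus>\<^bsub>quot D N\<^esub> (s m \<ominus>\<^bsub>quot D N\<^esub> \<phi> a m)"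
      using True a b \<phi>_0[of b] by (simp add: \<phi>_add hom_T_pow_mult[OF \<phi>_hom \<phi>_N])
    also have "\<dots> = s m"
      using a sm by (simp add: quot.minus_eq quot.a_lcomm[of "\<phi> a m" "s m"] quot.r_neg)
    finally show ?thesis using True by simp
  next
    case False
    with that a b assms show ?thesis by (simp add: \<phi>_add hom_T_pow_mult[OF \<phi>_hom \<phi>_N])
  qed
  then show ?case using a b by (intro bexI[of _ "a \<oplus> N [^] m \<otimes> b"]) auto
qed auto

text \<open>The coefficient of index \<open>k\<close> depends only on the class modulo
  \<open>N^(k+1)\<close>, hence the level \<open>Suc k\<close>. Any representative will do, also one
  at a higher level; this is \<open>ext_nth\<close>.\<close>

definition ext where
  "ext = (\<lambda>x\<in>carrier Dhat. \<lambda>k. \<phi> (SOME a. a \<in> carrier D \<and> x (Suc k) = I (Suc k) +> a) k)"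

lemma ext_nth:
  assumes "x \<in> carrier Dhat" "a \<in> carrier D" "x m = I m +> a" "k < m"
  shows "ext x k = \<phi> a k"
proof -
  define b where "b = (SOME b. b \<in> carrier D \<and> x (Suc k) = I (Suc k) +> b)"
  have m: "1 \<le> m" using assms(4) by simp
  obtain c where c: "c \<in> carrier D" "\<And>k. \<lbrakk>1 \<le> k; k \<le> m\<rbrakk> \<Longrightarrow> x k = I k +> c"
    using completionE[OF assms(1) m] by blast
  then have "\<exists>b. b \<in> carrier D \<and> x (Suc k) = I (Suc k) +> b" using assms by auto
  then have "b \<in> carrier D \<and> x (Suc k) = I (Suc k) +> b"
    unfolding b_def by (rule someI_ex)
  then have b: "b \<in> carrier D" "x (Suc k) = I (Suc k) +> b" by auto
  have "\<phi> b k = \<phi> c k"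
    using b c assms by (intro \<phi>_class_cong[of b c "Suc k"]) auto
  moreover have "\<phi> a k = \<phi> c k"
    using c assms by (intro \<phi>_class_cong[of a c m]) auto
  ultimately show ?thesis using assms(1) by (simp add: ext_def b_def)
qed

lemma ext_to_completion:
  assumes "a \<in> carrier D"
  shows "ext (to_completion D N a) = \<phi> a"
proof
  fix k show "ext (to_completion D N a) k = \<phi> a k"
    using assms by (intro ext_nth[of _ _ "Suc k"]) (auto simp: to_completion_nth)
qed

lemma ext_hom: "ext \<in> ring_hom Dhat S"
proof (rule ring_hom_memI)
  fix x assume x: "x \<in> carrier Dhat"
  have "ext x k \<in> carrier (quot D N)" for k
  proof -
    obtain a where "a \<in> carrier D" "x (Suc k) = I (Suc k) +> a"
      using completion_nth[OF x, of "Suc k"] by auto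
    then show ?thesis using ext_nth[OF x, of a "Suc k" k] by simp
  qed
  then show "ext x \<in> carrier S" by simp
  fix y assume y: "y \<in> carrier Dhat"
  show "ext (x \<oplus>\<^bsub>Dhat\<^esub> y) = ext x \<oplus>\<^bsub>S\<^esub> ext y"
  proof
    fix k
    have k: "1 \<le> Suc k" by simp
    obtain a where a: "a \<in> carrier D" "x (Suc k) = I (Suc k) +> a"
      by (rule completion_nth[OF x k])
    obtain b where b: "b \<in> carrier D" "y (Suc k) = I (Suc k) +> b"
      by (rule completion_nth[OF y k])
    note ab = a(1) b(1) a(2) b(2)
    then have "(x \<oplus>\<^bsub>Dhat\<^esub> y) (Suc k) = I (Suc k) +> (a \<oplus> b)"
      by (simp add: completion_simps class_add)
    then have "ext (x \<oplus>\<^bsub>Dhat\<^esub> y) k = \<phi> (a \<oplus> b) k"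
      using ab x y by (intro ext_nth[of _ _ "Suc k"]) (auto intro: completion_add_closed)
    moreover have "ext x k = \<phi> a k" "ext y k = \<phi> b k"
      using ext_nth[OF x ab(1,3)] ext_nth[OF y ab(2,4)] by simp_all
    ultimately show "ext (x \<oplus>\<^bsub>Dhat\<^esub> y) k = (ext x \<oplus>\<^bsub>S\<^esub> ext y) k"
      using ab by (simp add: \<phi>_add)
  qed
  show "ext (x \<otimes>\<^bsub>Dhat\<^esub> y) = ext x \<otimes>\<^bsub>S\<^esub> ext y"
  proof
    fix k
    interpret quot: ring "quot D N" by (rule ring_quot)
    have k: "1 \<le> Suc k" by simp
    obtain a where a: "a \<in> carrier D" "x (Suc k) = I (Suc k) +> a"
      by (rule completion_nth[OF x k])
    obtain b where b: "b \<in> carrier D" "y (Suc k) = I (Suc k) +> b"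
      by (rule completion_nth[OF y k])
    note ab = a(1) b(1) a(2) b(2)
    then have "(x \<otimes>\<^bsub>Dhat\<^esub> y) (Suc k) = I (Suc k) +> (a \<otimes> b)"
      by (simp add: completion_simps class_mult)
    then have "ext (x \<otimes>\<^bsub>Dhat\<^esub> y) k = \<phi> (a \<otimes> b) k"
      using ab x y by (intro ext_nth[of _ _ "Suc k"]) (auto intro: completion_mult_closed)
    also have "\<dots> = (\<phi> a \<otimes>\<^bsub>S\<^esub> \<phi> b) k"
      using ab by (simp add: ring_hom_mult[OF \<phi>_hom])
    \<comment> \<open>Representatives modulo \<open>N^(k+1)\<close> give all coefficients of index
      at most \<open>k\<close>, which are the only ones in this convolution.\<close>
    also have "\<dots> = (ext x \<otimes>\<^bsub>S\<^esub> ext y) k"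
      unfolding series_mult_nth
    proof (rule quot.finsum_cong')
      fix i assume i: "i \<in> {..k}"
      then have "ext x i = \<phi> a i" "ext y (k - i) = \<phi> b (k - i)"
        using ext_nth[OF x ab(1,3)] ext_nth[OF y ab(2,4)] by simp_all
      then show "\<phi> a i \<otimes>\<^bsub>quot D N\<^esub> \<phi> b (k - i) = ext x i \<otimes>\<^bsub>quot D N\<^esub> ext y (k - i)"
        by simp
    next
      show "(\<lambda>i. ext x i \<otimes>\<^bsub>quot D N\<^esub> ext y (k - i)) \<in> {..k} \<rightarrow> carrier (quot D N)"
        using ext_nth[OF x ab(1,3)] ext_nth[OF y ab(2,4)] ab(1,2)
        by (auto simp: less_Suc_eq_le)
    qed auto
    finally show "ext (x \<otimes>\<^bsub>Dhat\<^esub> y) k = (ext x \<otimes>\<^bsub>S\<^esub> ext y) k" .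
  qed
next
  show "ext \<one>\<^bsub>Dhat\<^esub> = \<one>\<^bsub>S\<^esub>"
    using ext_to_completion[of \<one>] ring_hom_one[OF \<phi>_hom] ring_hom_one[OF to_completion_hom]
    by simp
qed

lemma ext_bij: "bij_betw ext (carrier Dhat) (carrier S)"
proof (rule bij_betwI')
  fix x y assume x: "x \<in> carrier Dhat" and y: "y \<in> carrier Dhat"
  show "ext x = ext y \<longleftrightarrow> x = y"
  proof
    assume eq: "ext x = ext y"
    show "x = y"
    proof
      fix m
      show "x m = y m"
      proof (cases "1 \<le> m")
        case True
        obtain a where a: "a \<in> carrier D" "x m = I m +> a"
          by (rule completion_nth[OF x True])
        obtain b where b: "b \<in> carrier D" "y m = I m +> b"
          by (rule completion_nth[OF y True])
        note ab = a(1) b(1) a(2) b(2)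
        then have "\<phi> a k = \<phi> b k" if "k < m" for k
          using ext_nth[OF x ab(1,3) that] ext_nth[OF y ab(2,4) that] eq by simp
        then show ?thesis using \<phi>_class_cancel[OF ab(1,2)] ab(3,4) by simp
      next
        case False
        then show ?thesis
          using x y by (auto simp: completion_def PiE_def extensional_def)
      qed
    qed
  qed simp
next
  fix x assume "x \<in> carrier Dhat"
  then show "ext x \<in> carrier S" using ring_hom_closed[OF ext_hom] by blast
next
  fix s assume s: "s \<in> carrier S"
  have "\<forall>m. \<exists>a. a \<in> carrier D \<and> (\<forall>k<m. \<phi> a k = s k)"
    using \<phi>_approx[OF s] by blast
  then obtain a where a: "\<And>m. a m \<in> carrier D" "\<And>m k. k < m \<Longrightarrow> \<phi> (a m) k = s k"
    by metis
  define x where "x = (\<lambda>m\<in>{1..}. I m +> a m)"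
  \<comment> \<open>Both approximations have the first \<open>k\<close> coefficients of
    \<open>s\<close>, so they agree modulo \<open>N^k\<close>. This is the compatibility that makes
    \<open>x\<close> a point of the inverse limit.\<close>
  have cls: "I k +> a k = I k +> a m" if "k \<le> m" for k m
    using a that by (intro \<phi>_class_cancel) auto
  have x: "x \<in> carrier Dhat"
  proof (rule completionI)
    fix m :: nat
    show "\<exists>b\<in>carrier D. \<forall>k. 1 \<le> k \<and> k \<le> m \<longrightarrow> x k = I k +> b"
      using a cls by (intro bexI[of _ "a m"]) (auto simp: x_def)
  qed (simp add: x_def)
  moreover have "ext x = s"
  proof
    fix k show "ext x k = s k"
      using x a by (subst ext_nth[of x "a (Suc k)" "Suc k"]) (auto simp: x_def)
  qed
  ultimately show "\<exists>x\<in>carrier Dhat. s = ext x" by blast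
qed

text \<open>Every \<open>x\<close> has the form \<open>a + N^m y\<close> with \<open>a\<close> in
  \<open>D\<close> and \<open>y\<close> in the completion. A homomorphism that extends
  \<open>\<phi>\<close> sends \<open>N^m y\<close> to a multiple of \<open>T^m\<close>, so the
  coefficients of the image below \<open>m\<close> are those of \<open>\<phi> a\<close>. The element
  \<open>y\<close> is not constructed in the inverse limit but obtained from the bijectivity of
  \<open>ext\<close>.\<close>

lemma ext_unique:
  assumes "\<tau> \<in> ring_hom Dhat S" "\<tau> \<in> extensional (carrier Dhat)"
    and \<tau>: "\<And>a. a \<in> carrier D \<Longrightarrow> \<tau> (to_completion D N a) = \<phi> a"
  shows "\<tau> = ext"
proof (rule extensionalityI[OF assms(2)])
  interpret quot: ring "quot D N" by (rule ring_quot)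
  show "ext \<in> extensional (carrier Dhat)" by (simp add: ext_def)
  fix x assume x: "x \<in> carrier Dhat"
  \<comment> \<open>Stated for a variable \<open>\<sigma>\<close>, since it is applied to
    \<open>ext\<close> in order to identify \<open>y\<close>, and then to
    \<open>\<tau>\<close>.\<close>
  have split: "\<sigma> (to_completion D N a \<oplus>\<^bsub>Dhat\<^esub> to_completion D N (N [^] m) \<otimes>\<^bsub>Dhat\<^esub> y) k =
      \<phi> a k \<oplus>\<^bsub>quot D N\<^esub> (if k < m then \<zero>\<^bsub>quot D N\<^esub> else \<sigma> y (k - m))"
    if \<sigma>: "\<sigma> \<in> ring_hom Dhat S" "\<And>a. a \<in> carrier D \<Longrightarrow> \<sigma> (to_completion D N a) = \<phi> a"
      and a: "a \<in> carrier D" and y: "y \<in> carrier Dhat" for \<sigma> a m y k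
  proof -
    interpret S: ring S by (rule ring_S)
    have \<phi>_pow: "\<phi> (N [^] m) = series_T (quot D N) [^]\<^bsub>S\<^esub> m" for m :: nat
    proof (induction m)
      case (Suc m)
      then show ?case using ring_hom_mult[OF \<phi>_hom, of "N [^] m" N] \<phi>_N by simp
    qed (simp add: ring_hom_one[OF \<phi>_hom])
    have T: "series_T (quot D N) \<in> carrier S"
      by (auto simp: series_T_def)
    have shift: "(series_T (quot D N) [^]\<^bsub>S\<^esub> m \<otimes>\<^bsub>S\<^esub> s) k =
        (if k < m then \<zero>\<^bsub>quot D N\<^esub> else s (k - m))" if s: "s \<in> carrier S" for s m k
    proof (induction m arbitrary: k)
      case 0
      then show ?case using s by (simp add: S.l_one del: series_ring_simps)
    next
      case (Suc m)
      have "series_T (quot D N) [^]\<^bsub>S\<^esub> Suc m \<otimes>\<^bsub>S\<^esub> s =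
          series_T (quot D N) \<otimes>\<^bsub>S\<^esub> (series_T (quot D N) [^]\<^bsub>S\<^esub> m \<otimes>\<^bsub>S\<^esub> s)"
        using T s by (simp only: S.nat_pow_Suc2 S.m_assoc S.nat_pow_closed)
      moreover have "series_T (quot D N) [^]\<^bsub>S\<^esub> m \<otimes>\<^bsub>S\<^esub> s \<in> carrier S"
        using T s by (simp only: S.m_closed S.nat_pow_closed)
      ultimately show ?case using Suc by (simp add: quot.series_T_mult del: series_ring_simps) auto
    qed
    have "\<sigma> (to_completion D N a \<oplus>\<^bsub>Dhat\<^esub> to_completion D N (N [^] m) \<otimes>\<^bsub>Dhat\<^esub> y) =
        \<phi> a \<oplus>\<^bsub>S\<^esub> \<phi> (N [^] m) \<otimes>\<^bsub>S\<^esub> \<sigma> y"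
      using a y \<sigma>(2) ring_hom_add[OF \<sigma>(1)] ring_hom_mult[OF \<sigma>(1)]
      by (simp add: completion_mult_closed del: series_ring_simps)
    then show ?thesis
      using shift[OF ring_hom_closed[OF \<sigma>(1) y]] by (simp add: \<phi>_pow)
  qed
  show "\<tau> x = ext x"
  proof
    fix k
    define m where "m = Suc k"
    obtain a where a: "a \<in> carrier D" "x m = I m +> a"
      using completion_nth[OF x, of m] by (auto simp: m_def)
    \<comment> \<open>The series \<open>ext x\<close> and \<open>\<phi> a\<close> agree below
      \<open>m\<close>, and \<open>t\<close> is their difference divided by \<open>T^m\<close>. Its
      preimage under \<open>ext\<close> is the required \<open>y\<close>.\<close>
    define t where "t = (\<lambda>i. ext x (i + m) \<ominus>\<^bsub>quot D N\<^esub> \<phi> a (i + m))"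
    have ext_x: "ext x i \<in> carrier (quot D N)" for i
      using ring_hom_closed[OF ext_hom x] by simp
    then have "t \<in> carrier S" using a by (auto simp: t_def)
    then have "t \<in> ext ` carrier Dhat"
      unfolding bij_betw_imp_surj_on[OF ext_bij] .
    then obtain y where y: "y \<in> carrier Dhat" "ext y = t" by auto
    define x' where "x' = to_completion D N a \<oplus>\<^bsub>Dhat\<^esub> to_completion D N (N [^] m) \<otimes>\<^bsub>Dhat\<^esub> y"
    have x': "x' \<in> carrier Dhat"
      using a y by (simp add: x'_def completion_add_closed completion_mult_closed)
    have "ext x' i = ext x i" for i
    proof (cases "i < m")
      case True
      then have "ext x i = \<phi> a i" using ext_nth[OF x a] by simp
      then show ?thesis
        using True a y split[OF ext_hom ext_to_completion] by (simp add: x'_def)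
    next
      case False
      have "ext x' i = \<phi> a i \<oplus>\<^bsub>quot D N\<^esub> (ext x i \<ominus>\<^bsub>quot D N\<^esub> \<phi> a i)"
        using False a y split[OF ext_hom ext_to_completion] by (simp add: x'_def t_def)
      also have "\<dots> = ext x i"
        using a ext_x by (simp add: quot.minus_eq quot.a_lcomm[of "\<phi> a i" "ext x i"] quot.r_neg)
      finally show ?thesis .
    qed
    then have "ext x' = ext x" ..
    then have "x' = x"
      using x' x by (rule inj_onD[OF bij_betw_imp_inj_on[OF ext_bij]])
    then have "\<tau> x k = \<phi> a k"
      using split[OF assms(1) \<tau> a(1) y(1), of m k] a unfolding x'_def by (simp add: m_def)
    then show "\<tau> x k = ext x k" using ext_nth[OF x a] by (simp add: m_def)
  qed
qed

lemma ext_nth_0: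
  assumes "x \<in> carrier Dhat"
  shows "ext x 0 = x 1"
proof -
  obtain a where "a \<in> carrier D" "x 1 = I 1 +> a"
    using completion_nth[OF assms, of 1] by auto
  then show ?thesis using ext_nth[OF assms, of a 1 0] \<phi>_0 by (simp add: quot_class_def)
qed

end

section \<open>Newton iteration modulo a principal ideal\<close>

text \<open>Subrings are sets inside a fixed type, so that one Newton iteration both finds a root
  and shows where its coefficients lie. The cases used are the centre and the rationals whose
  denominator is invertible in the field.\<close>

definition is_subring :: "'a::comm_ring_1 set \<Rightarrow> bool" where
  "is_subring Q \<longleftrightarrow> 1 \<in> Q \<and> (\<forall>a\<in>Q. \<forall>b\<in>Q. a - b \<in> Q \<and> a * b \<in> Q)"

definition fps_over :: "'a set \<Rightarrow> 'a fps set" where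
  "fps_over Q = {s. \<forall>n. fps_nth s n \<in> Q}"

lemma fps_over_UNIV [simp]: "fps_over UNIV = UNIV"
  by (simp add: fps_over_def)

context
  fixes Q :: "'a::comm_ring_1 set"
  assumes Q: "is_subring Q"
begin

lemma subring_1: "1 \<in> Q" and subring_diff: "a \<in> Q \<Longrightarrow> b \<in> Q \<Longrightarrow> a - b \<in> Q"
  and subring_mult: "a \<in> Q \<Longrightarrow> b \<in> Q \<Longrightarrow> a * b \<in> Q"
  using Q by (auto simp: is_subring_def)

lemma subring_0: "0 \<in> Q"
  using subring_diff[of 1 1] subring_1 by simp

lemma subring_uminus: "a \<in> Q \<Longrightarrow> - a \<in> Q"
  using subring_diff[of 0 a] subring_0 by simp

lemma subring_add: "a \<in> Q \<Longrightarrow> b \<in> Q \<Longrightarrow> a + b \<in> Q"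
  using subring_diff[of a "- b"] subring_uminus by simp

lemma subring_sum: "(\<And>i. i \<in> A \<Longrightarrow> f i \<in> Q) \<Longrightarrow> sum f A \<in> Q"
  by (induction A rule: infinite_finite_induct) (auto simp: subring_0 subring_add)

lemma subring_power: "a \<in> Q \<Longrightarrow> a ^ n \<in> Q"
  by (induction n) (auto simp: subring_1 subring_mult)

lemma subring_poly: "(\<And>i. coeff p i \<in> Q) \<Longrightarrow> x \<in> Q \<Longrightarrow> poly p x \<in> Q"
  unfolding poly_altdef by (intro subring_sum subring_mult subring_power)

lemma is_subring_fps_over: "is_subring (fps_over Q)"
  by (auto simp: is_subring_def fps_over_def fps_mult_nth subring_0 subring_1
      intro!: subring_sum subring_mult subring_diff)

lemma fps_const_in_fps_over: "a \<in> Q \<Longrightarrow> fps_const a \<in> fps_over Q"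
  by (simp add: fps_over_def subring_0)

lemma fps_X_in_fps_over: "fps_X \<in> fps_over Q"
  by (simp add: fps_over_def fps_X_def subring_0 subring_1)

text \<open>The coefficients obey a recursion that starts with \<open>y\<close> and uses ring
  operations only.\<close>

lemma fps_right_inverse_in_fps_over:
  assumes "s \<in> fps_over Q" "y \<in> Q"
  shows "fps_right_inverse s y \<in> fps_over Q"
proof -
  have "fps_nth (fps_right_inverse s y) n \<in> Q" for n
  proof (induction n rule: less_induct)
    case (less n)
    show ?case
      by (cases n) (use assms less in \<open>auto simp: fps_over_def
          intro!: subring_uminus subring_add subring_mult subring_sum\<close>)
  qed
  then show ?thesis by (simp add: fps_over_def)
qed

end

text \<open>Membership in the ideal generated by \<open>N\<close> and \<open>T^m\<close>. For
  \<open>N = 0\<close> this is divisibility by \<open>T^m\<close>.\<close>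

definition vanishing :: "'a::comm_ring_1 \<Rightarrow> nat \<Rightarrow> 'a fps \<Rightarrow> bool" where
  "vanishing N m s \<longleftrightarrow> (\<forall>k<m. N dvd fps_nth s k)"

lemma vanishing_add: "vanishing N m s \<Longrightarrow> vanishing N m t \<Longrightarrow> vanishing N m (s + t)"
  and vanishing_diff: "vanishing N m s \<Longrightarrow> vanishing N m t \<Longrightarrow> vanishing N m (s - t)"
  and vanishing_uminus: "vanishing N m s \<Longrightarrow> vanishing N m (- s)"
  by (auto simp: vanishing_def)

lemma vanishing_mult_right: "vanishing N m s \<Longrightarrow> vanishing N m (s * t)"
  by (auto simp: vanishing_def fps_mult_nth intro!: dvd_sum dvd_mult2)

lemma vanishing_mult_left: "vanishing N m s \<Longrightarrow> vanishing N m (t * s)"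
  using vanishing_mult_right[of N m s t] by (simp add: mult.commute)

lemma vanishing_antimono: "vanishing N m s \<Longrightarrow> k \<le> m \<Longrightarrow> vanishing N k s"
  by (auto simp: vanishing_def)

text \<open>In a coefficient of index at most \<open>m\<close> of the product, the term with
  \<open>i = 0\<close> is divisible because of \<open>s\<close>, and all others because their factor
  from \<open>t\<close> has index below \<open>m\<close>. This gain of one order drives every Newton
  argument below.\<close>

lemma vanishing_mult_Suc:
  assumes "vanishing N 1 s" "vanishing N m t"
  shows "vanishing N (Suc m) (s * t)"
  unfolding vanishing_def fps_mult_nth
proof (intro allI impI dvd_sum)
  fix k i assume "k < Suc m" "i \<in> {0..k}"
  then show "N dvd fps_nth s i * fps_nth t (k - i)"
    using assms by (cases "i = 0") (auto simp: vanishing_def intro: dvd_mult dvd_mult2)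
qed

lemma poly_taylor_2:
  fixes p :: "'a::idom poly"
  obtains R where "poly p x = poly p y + (x - y) * (poly (pderiv p) y + (x - y) * R)"
proof -
  have "\<exists>R. poly p x = poly p y + (x - y) * (poly (pderiv p) y + (x - y) * R)"
  proof (induction p)
    case (pCons c p)
    then obtain R where R: "poly p x = poly p y + (x - y) * (poly (pderiv p) y + (x - y) * R)" by blast
    show ?case
      \<comment> \<open>From \<open>x * p(x)\<close>: write \<open>x = y + (x - y)\<close> in front
        of the derivative at \<open>y\<close> and collect the terms of second order. No division by
        2 occurs, so the expansion is valid in every characteristic.\<close>
      by (rule exI[of _ "poly (pderiv p) y + x * R"]) (simp add: R pderiv_pCons algebra_simps)
  qed simp
  then show thesis using that by blast
qed

lemma vanishing_poly_diff:
  fixes p :: "'a::idom fps poly"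
  assumes "vanishing N m (x - y)"
  shows "vanishing N m (poly p x - poly p y)"
proof -
  obtain R where "poly p x = poly p y + (x - y) * (poly (pderiv p) y + (x - y) * R)"
    by (rule poly_taylor_2)
  then have "poly p x - poly p y = (x - y) * (poly (pderiv p) y + (x - y) * R)" by simp
  then show ?thesis using assms by (metis vanishing_mult_right)
qed

text \<open>Taylor expansion at \<open>W\<close>, multiplied by \<open>u\<close>, expresses
  \<open>V - W\<close> through its square and its product with \<open>u h'(W) - 1\<close>, up to
  values of \<open>h\<close> that vanish. Both products vanish to one order more than
  \<open>V - W\<close> is known to.\<close>

lemma newton_root_unique:
  fixes h :: "'a::idom fps poly"
  assumes "\<And>m. vanishing N m (poly h V)" "\<And>m. vanishing N m (poly h W)"
    and "vanishing N 1 (V - W)"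
    and u: "vanishing N 1 (u * poly (pderiv h) W - 1)"
  shows "vanishing N m (V - W)"
proof (induction m)
  case 0
  then show ?case by (simp add: vanishing_def)
next
  case (Suc m)
  obtain R where R: "poly h V = poly h W + (V - W) * (poly (pderiv h) W + (V - W) * R)"
    by (rule poly_taylor_2)
  have "V - W = u * (poly h V - poly h W) - u * R * ((V - W) * (V - W))
      - (u * poly (pderiv h) W - 1) * (V - W)"
    unfolding R by (simp add: algebra_simps)
  moreover have "vanishing N (Suc m) ((V - W) * (V - W))"
    using assms(3) Suc by (rule vanishing_mult_Suc)
  moreover have "vanishing N (Suc m) ((u * poly (pderiv h) W - 1) * (V - W))"
    using u Suc by (rule vanishing_mult_Suc)
  ultimately show ?case
    using assms(1,2) by (metis vanishing_diff vanishing_mult_left)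
qed

text \<open>The multiplier \<open>u\<close>, an inverse of the derivative at \<open>V0\<close> to
  first order, stays fixed during the iteration. Convergence is then only linear, but nothing has to
  be inverted again and all iterates remain over \<open>Q\<close>.\<close>

lemma newton_root_exists:
  fixes h :: "'a::idom fps poly"
  assumes Q: "is_subring Q"
    and h: "\<And>i. coeff h i \<in> fps_over Q" "vanishing N 1 (poly h V0)" "V0 \<in> fps_over Q"
    and u: "u \<in> fps_over Q" "vanishing N 1 (u * poly (pderiv h) V0 - 1)"
  obtains V where "V \<in> fps_over Q" "fps_nth V 0 = fps_nth V0 0" "\<And>m. vanishing N m (poly h V)"
proof -
  define d where "d = poly (pderiv h) V0"
  note QF = is_subring_fps_over[OF Q]
  define I where "I k = ((\<lambda>V. V - u * poly h V) ^^ k) V0" for k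
  have I_0: "I 0 = V0" and I_Suc: "I (Suc k) = I k - u * poly h (I k)" for k
    by (simp_all add: I_def)
  have I_Q: "I k \<in> fps_over Q" for k
    by (induction k) (use h u in \<open>auto simp: I_0 I_Suc
        intro!: subring_diff[OF QF] subring_mult[OF QF] subring_poly[OF QF]\<close>)
  have step: "vanishing N 1 (I k - V0) \<and> vanishing N (Suc k) (I (Suc k) - I k)" for k
  proof (induction k)
    case 0
    have "I (Suc 0) - I 0 = - (u * poly h V0)" by (simp add: I_0 I_Suc)
    moreover have "vanishing N (Suc 0) (u * poly h V0)"
      using h(2) by (auto intro: vanishing_mult_left)
    ultimately have "vanishing N (Suc 0) (I (Suc 0) - I 0)" by (metis vanishing_uminus)
    then show ?case by (simp add: I_0 vanishing_def)
  next
    case (Suc k)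
    define D where "D = I (Suc k) - I k"
    have D: "vanishing N (Suc k) D" "vanishing N 1 D"
      using Suc by (auto simp: D_def elim: vanishing_antimono)
    have "I (Suc k) - V0 = (I k - V0) + D" by (simp add: D_def)
    with Suc D have 1: "vanishing N 1 (I (Suc k) - V0)" by (metis vanishing_add)
    obtain R where R: "poly h (I (Suc k)) = poly h (I k) + D * (poly (pderiv h) (I k) + D * R)"
      unfolding D_def by (rule poly_taylor_2)
    have "I (Suc (Suc k)) - I (Suc k) = D - u * (poly h (I (Suc k)) - poly h (I k))"
      by (simp add: I_Suc D_def algebra_simps)
    \<comment> \<open>Each summand of the factor in front of \<open>D\<close> vanishes to first
      order, so the new increment vanishes to one order more than \<open>D\<close>.\<close>
    also have "\<dots> = - ((u * d - 1) + u * (poly (pderiv h) (I k) - d) + D * (u * R)) * D"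
      unfolding R by (simp add: algebra_simps)
    finally have eq: "I (Suc (Suc k)) - I (Suc k) = \<dots>" .
    have "vanishing N 1 (poly (pderiv h) (I k) - d)"
      unfolding d_def using Suc by (intro vanishing_poly_diff) auto
    then have "vanishing N 1 (- ((u * d - 1) + u * (poly (pderiv h) (I k) - d) + D * (u * R)))"
      using u(2) D(2) unfolding d_def
      by (intro vanishing_uminus vanishing_add vanishing_mult_left[of _ _ "_ - _"]
          vanishing_mult_right[of _ _ D])
    then have "vanishing N (Suc (Suc k)) (I (Suc (Suc k)) - I (Suc k))"
      unfolding eq using D(1) by (rule vanishing_mult_Suc)
    with 1 show ?case by simp
  qed
  \<comment> \<open>From the iterate \<open>I n\<close> on, the coefficient of index
    \<open>n\<close> is constant modulo \<open>N\<close>. The iterates need not stabilise in the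
    ring itself, so the diagonal picks one representative of each limit.\<close>
  define V where "V = Abs_fps (\<lambda>n. fps_nth (I n) n)"
  have "N dvd fps_nth (I (n + j)) n - fps_nth (I n) n" for n j
  proof (induction j)
    case (Suc j)
    have "N dvd fps_nth (I (Suc (n + j)) - I (n + j)) n"
      using step[of "n + j"] unfolding vanishing_def by auto
    then have "N dvd (fps_nth (I (Suc (n + j))) n - fps_nth (I (n + j)) n)
        + (fps_nth (I (n + j)) n - fps_nth (I n) n)"
      using Suc by (intro dvd_add) auto
    then show ?case by (simp add: algebra_simps)
  qed simp
  from this[of _ "_ - _"] have V_I: "vanishing N (Suc k) (I k - V)" for k
    unfolding vanishing_def V_def by (auto simp: less_Suc_eq_le) (metis le_add_diff_inverse)
  show thesis
  proof (rule that)
    show "V \<in> fps_over Q" using I_Q by (simp add: V_def fps_over_def)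
    show "fps_nth V 0 = fps_nth V0 0" by (simp add: V_def I_0)
    fix m
    have "poly h V = d * (u * poly h (I m)) - (u * d - 1) * poly h (I m) - (poly h (I m) - poly h V)"
      by (simp add: algebra_simps)
    moreover have uh: "vanishing N (Suc m) (u * poly h (I m))"
      using step[of m] I_Suc[of m] vanishing_uminus[of N "Suc m" "I (Suc m) - I m"] by simp
    moreover have "vanishing N (Suc m) ((u * d - 1) * poly h (I m))"
    proof -
      \<comment> \<open>The increments control only \<open>u * poly h (I m)\<close>. To remove
        \<open>u\<close>, the value of \<open>h\<close> is written as \<open>d\<close> times the
        controlled term minus \<open>u * d - 1\<close> times the value itself; as
        \<open>u * d - 1\<close> vanishes to first order, each pass gains one order.\<close>
      have 1: "vanishing N k (poly h (I m))" if "k \<le> Suc m" for k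
        using that
      proof (induction k)
        case (Suc k)
        then have "vanishing N (Suc k) ((u * d - 1) * poly h (I m))"
          using u(2) by (intro vanishing_mult_Suc) (auto simp: d_def)
        moreover have "vanishing N (Suc k) (u * poly h (I m))"
          using uh Suc.prems by (rule vanishing_antimono)
        moreover have "poly h (I m) = d * (u * poly h (I m)) - (u * d - 1) * poly h (I m)"
          by (simp add: algebra_simps)
        ultimately show ?case by (metis vanishing_diff vanishing_mult_left)
      qed (simp add: vanishing_def)
      then show ?thesis by (auto intro: vanishing_mult_left)
    qed
    moreover have "vanishing N (Suc m) (poly h (I m) - poly h V)"
      using V_I by (rule vanishing_poly_diff)
    ultimately have "vanishing N (Suc m) (poly h V)"
      by (metis vanishing_diff vanishing_mult_left)
    then show "vanishing N m (poly h V)" by (rule vanishing_antimono) simp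
  qed
qed

section \<open>Skew Laurent polynomials\<close>

abbreviation (input) "single \<equiv> Poly_Mapping.single"
abbreviation (input) "keys \<equiv> Poly_Mapping.keys"
abbreviation (input) "lookup \<equiv> Poly_Mapping.lookup"

lemma sum_single_lookup:
  assumes "finite I" "keys f \<subseteq> I"
  shows "(\<Sum>i\<in>I. single i (lookup f i)) = f"
proof (rule poly_mapping_eqI)
  fix k
  have "lookup (\<Sum>i\<in>I. single i (lookup f i)) k = (\<Sum>i\<in>I. if i = k then lookup f k else 0)"
    by (auto simp: lookup_sum lookup_single when_def intro!: sum.cong)
  also have "\<dots> = lookup f k"
    using assms by (auto simp: in_keys_iff)
  finally show "lookup (\<Sum>i\<in>I. single i (lookup f i)) k = lookup f k" .
qed

text \<open>Only monomials that occur in \<open>f\<close> have to be checked, so conditions on the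
  exponents and coefficients of \<open>f\<close> remain available.\<close>

lemma poly_mapping_additive_induct [case_names zero add single]:
  fixes f :: "'a \<Rightarrow>\<^sub>0 'b::comm_monoid_add"
  assumes "P 0" "\<And>f g. P f \<Longrightarrow> P g \<Longrightarrow> P (f + g)"
    and "\<And>i. i \<in> keys f \<Longrightarrow> P (single i (lookup f i))"
  shows "P f"
proof -
  have "P (\<Sum>i\<in>I. single i (lookup f i))" if "finite I" "I \<subseteq> keys f" for I
    using that by (induction I rule: finite_induct) (use assms in auto)
  from this[of "keys f"] show ?thesis by (simp add: sum_single_lookup)
qed

text \<open>The Laurent polynomials in \<open>X\<^sup>d\<close>.\<close>

definition lattice_supp :: "nat \<Rightarrow> (int \<Rightarrow>\<^sub>0 'k::zero) set" where
  "lattice_supp d = {f. \<forall>i\<in>keys f. int d dvd i}"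

lemma lattice_supp_iff: "f \<in> lattice_supp d \<longleftrightarrow> (\<forall>i. lookup f i \<noteq> 0 \<longrightarrow> int d dvd i)"
  by (auto simp: lattice_supp_def in_keys_iff)

lemma lattice_supp_antimono: "d dvd e \<Longrightarrow> lattice_supp e \<subseteq> lattice_supp d"
  by (auto simp: lattice_supp_def) (meson dvd_trans int_dvd_int_iff)

lemma lattice_supp_1 [simp]: "lattice_supp (Suc 0) = UNIV"
  by (simp add: lattice_supp_def)

lemma mult_eq_sum_single:
  fixes f g :: "int \<Rightarrow>\<^sub>0 'k::comm_ring_1"
  shows "f * g = (\<Sum>i\<in>keys f. \<Sum>j\<in>keys g. single (i + j) (lookup f i * lookup g j))"
proof -
  have "f * g = (\<Sum>i\<in>keys f. single i (lookup f i)) * (\<Sum>j\<in>keys g. single j (lookup g j))"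
    by (simp add: sum_single_lookup)
  then show ?thesis by (simp add: sum_product mult_single)
qed

lemma add_closed_sum:
  assumes "0 \<in> Q" "\<And>a b. a \<in> Q \<Longrightarrow> b \<in> Q \<Longrightarrow> a + b \<in> Q" "\<And>i. i \<in> A \<Longrightarrow> f i \<in> Q"
  shows "sum f A \<in> Q"
  using assms(3) by (induction A rule: infinite_finite_induct) (use assms(1,2) in auto)

lemma lattice_supp_sum:
  fixes f :: "'b \<Rightarrow> int \<Rightarrow>\<^sub>0 'k::comm_ring_1"
  assumes "\<And>i. i \<in> A \<Longrightarrow> f i \<in> lattice_supp d"
  shows "sum f A \<in> lattice_supp d"
proof (rule add_closed_sum)
  fix a b :: "int \<Rightarrow>\<^sub>0 'k" assume "a \<in> lattice_supp d" "b \<in> lattice_supp d"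
  then show "a + b \<in> lattice_supp d"
    using keys_add[of a b] by (auto simp: lattice_supp_def)
qed (use assms in \<open>auto simp: lattice_supp_iff\<close>)

lemma is_subring_lattice_supp: "is_subring (lattice_supp d :: (int \<Rightarrow>\<^sub>0 'k::comm_ring_1) set)"
proof -
  have "f * g \<in> lattice_supp d"
    if "f \<in> lattice_supp d" "g \<in> lattice_supp d" for f g :: "int \<Rightarrow>\<^sub>0 'k"
    unfolding mult_eq_sum_single
    using that by (intro lattice_supp_sum) (auto simp: lattice_supp_def)
  moreover have "f - g \<in> lattice_supp d"
    if "f \<in> lattice_supp d" "g \<in> lattice_supp d" for f g :: "int \<Rightarrow>\<^sub>0 'k"
    using that by (auto simp: lattice_supp_iff lookup_minus) (metis diff_self)
  moreover have "1 \<in> lattice_supp d"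
    by (simp add: lattice_supp_def)
  ultimately show ?thesis by (simp add: is_subring_def)
qed

text \<open>Split a cofactor \<open>g\<close> into the part \<open>g1\<close> with exponents in the
  lattice and the rest \<open>g2\<close>. The exponents of \<open>N * g2\<close> avoid the lattice,
  but \<open>N * g2 = f - N * g1\<close> is supported on it, so the product is zero and
  \<open>g1\<close> is a cofactor too.\<close>

lemma lattice_supp_dvd:
  fixes N f :: "int \<Rightarrow>\<^sub>0 'k::comm_ring_1"
  assumes "N \<in> lattice_supp d" "f \<in> lattice_supp d" "N dvd f"
  obtains g where "g \<in> lattice_supp d" "f = N * g"
proof -
  obtain g where g: "f = N * g" using assms(3) by auto
  define g1 where "g1 = (\<Sum>i\<in>{i \<in> keys g. int d dvd i}. single i (lookup g i))"
  define g2 where "g2 = (\<Sum>i\<in>{i \<in> keys g. \<not> int d dvd i}. single i (lookup g i))"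
  have "g = (\<Sum>i\<in>keys g. single i (lookup g i))" by (simp add: sum_single_lookup)
  also have "\<dots> = g1 + g2"
    unfolding g1_def g2_def
    by (subst sum.union_disjoint[symmetric]) (auto intro!: sum.cong)
  finally have g12: "g = g1 + g2" .
  have g1: "g1 \<in> lattice_supp d"
    unfolding g1_def by (intro lattice_supp_sum) (auto simp: lattice_supp_def)
  have "lookup g2 i = 0" if "int d dvd i" for i
    using that by (auto simp: g2_def lookup_sum lookup_single when_def intro!: sum.neutral)
  then have g2: "\<not> int d dvd i" if "i \<in> keys g2" for i using that by (auto simp: in_keys_iff)
  have off: "lookup (N * g2) i = 0" if "int d dvd i" for i
    unfolding mult_eq_sum_single lookup_sum lookup_single
  proof (intro sum.neutral ballI)
    fix j k assume "j \<in> keys N" "k \<in> keys g2"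
    then have "int d dvd j" "\<not> int d dvd k" using assms(1) g2 by (auto simp: lattice_supp_def)
    then have "j + k \<noteq> i" using that by (metis dvd_add_right_iff)
    then show "(lookup N j * lookup g2 k when j + k = i) = 0" by simp
  qed
  have "N * g2 = f - N * g1" by (simp add: g g12 algebra_simps)
  also have "\<dots> \<in> lattice_supp d"
    using assms g1 is_subring_lattice_supp[of d] by (auto simp: is_subring_def)
  finally have "N * g2 = 0"
    using off by (intro poly_mapping_eqI) (auto simp: lattice_supp_iff)
  then show thesis using that[OF g1] by (simp add: g g12 algebra_simps)
qed

section \<open>Twisted multiplication and its compatibility with the centre\<close>

locale skew_laurent_setting =
  fixes \<theta> :: "'k::field \<Rightarrow> 'k" and r :: nat
  assumes aut: "field_automorphism \<theta>"
    and ord: "has_finite_order \<theta> r"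
begin

lemma r_pos: "0 < r"
  using ord by (simp add: has_finite_order_def)

lemma \<theta>_hom:
  "\<theta> (a + b) = \<theta> a + \<theta> b" "\<theta> (a * b) = \<theta> a * \<theta> b" "\<theta> 1 = 1" "\<theta> 0 = 0"
  using aut add_left_imp_eq[of "\<theta> 0" "\<theta> 0" 0] unfolding field_automorphism_def
  by (metis add.right_neutral)+

lemma \<theta>_pow_hom:
  "(\<theta> ^^ n) (a + b) = (\<theta> ^^ n) a + (\<theta> ^^ n) b" "(\<theta> ^^ n) (a * b) = (\<theta> ^^ n) a * (\<theta> ^^ n) b"
  "(\<theta> ^^ n) 1 = 1" "(\<theta> ^^ n) 0 = 0"
  by (induction n) (simp_all add: \<theta>_hom)

lemma \<theta>_pow_mod: "\<theta> ^^ (n mod r) = \<theta> ^^ n"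
  using ord by (intro ext funpow_mod_eq) (simp add: has_finite_order_def)

text \<open>Reducing exponents modulo the order turns iterates of the inverse into iterates of
  \<open>\<theta>\<close> itself, so the laws for negative exponents need no separate proof.\<close>

lemma aut_pow_eq: "aut_pow \<theta> i = \<theta> ^^ nat (i mod int r)"
proof (cases "0 \<le> i")
  case True
  then show ?thesis by (simp add: aut_pow_def nat_mod_distrib \<theta>_pow_mod)
next
  case False
  define n where "n = nat (- i)"
  define k where "k = nat (i mod int r)"
  have "int ((n + k) mod r) = 0"
    using False r_pos by (simp add: n_def k_def zmod_int mod_simps)
  then have "\<theta> ^^ n \<circ> \<theta> ^^ k = id"
    using \<theta>_pow_mod[of "n + k"] by (simp flip: funpow_add)
  moreover have "bij (\<theta> ^^ n)" using aut by (simp add: field_automorphism_def bij_betw_funpow)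
  ultimately have "\<theta> ^^ k = inv_into UNIV (\<theta> ^^ n)"
    by (metis bij_is_inj comp_assoc comp_id id_comp inv_o_cancel)
  also have "\<dots> = inv_into UNIV \<theta> ^^ n"
    using aut by (simp add: field_automorphism_def inv_fn)
  finally show ?thesis using False by (simp add: aut_pow_def n_def k_def)
qed

lemma aut_pow_hom:
  "aut_pow \<theta> i (a + b) = aut_pow \<theta> i a + aut_pow \<theta> i b"
  "aut_pow \<theta> i (a * b) = aut_pow \<theta> i a * aut_pow \<theta> i b"
  "aut_pow \<theta> i 1 = 1" "aut_pow \<theta> i 0 = 0"
  by (simp_all add: aut_pow_eq \<theta>_pow_hom)

lemma aut_pow_add: "aut_pow \<theta> (i + j) a = aut_pow \<theta> i (aut_pow \<theta> j a)"
proof -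
  have "nat ((i + j) mod int r) = (nat (i mod int r) + nat (j mod int r)) mod r"
    using r_pos by (simp add: nat_mod_distrib[symmetric] nat_add_distrib[symmetric] mod_simps
        flip: nat_int_add) (simp add: nat_mod_as_int mod_simps)
  then show ?thesis by (simp add: aut_pow_eq \<theta>_pow_mod funpow_add)
qed

lemma aut_pow_dvd: "int r dvd i \<Longrightarrow> aut_pow \<theta> i a = a"
  by (auto simp: aut_pow_eq)

lemma aut_pow_0 [simp]: "aut_pow \<theta> 0 a = a"
  by (simp add: aut_pow_dvd)

lemma aut_pow_fixed: "a \<in> fixed_field \<theta> \<Longrightarrow> aut_pow \<theta> i a = a"
proof -
  assume "a \<in> fixed_field \<theta>"
  then have "(\<theta> ^^ n) a = a" for n by (induction n) (auto simp: fixed_field_def)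
  then show ?thesis by (simp add: aut_pow_eq)
qed

lemma skew_mult_eq_sum:
  assumes "finite I" "keys f \<subseteq> I" "finite J" "keys g \<subseteq> J"
  shows "skew_mult \<theta> f g =
    (\<Sum>i\<in>I. \<Sum>j\<in>J. single (i + j) (lookup f i * aut_pow \<theta> i (lookup g j)))"
proof -
  have "(\<Sum>i\<in>I. \<Sum>j\<in>J. single (i + j) (lookup f i * aut_pow \<theta> i (lookup g j))) =
      (\<Sum>i\<in>keys f. \<Sum>j\<in>J. single (i + j) (lookup f i * aut_pow \<theta> i (lookup g j)))"
    using assms by (intro sum.mono_neutral_right) (auto simp: in_keys_iff)
  also have "\<dots> = (\<Sum>i\<in>keys f. \<Sum>j\<in>keys g. single (i + j) (lookup f i * aut_pow \<theta> i (lookup g j)))"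
    using assms by (intro sum.cong sum.mono_neutral_right) (auto simp: in_keys_iff aut_pow_hom)
  finally show ?thesis by (simp add: skew_mult_def)
qed

lemma skew_mult_single: "skew_mult \<theta> (single i a) (single j b) = single (i + j) (a * aut_pow \<theta> i b)"
  by (subst skew_mult_eq_sum[of "{i}" _ "{j}"]) auto

lemma skew_mult_add_left: "skew_mult \<theta> (f + g) h = skew_mult \<theta> f h + skew_mult \<theta> g h"
  unfolding skew_mult_eq_sum[of "keys f \<union> keys g" "f + g" "keys h" h, OF _ keys_add, simplified]
    skew_mult_eq_sum[of "keys f \<union> keys g" f "keys h" h, simplified]
    skew_mult_eq_sum[of "keys f \<union> keys g" g "keys h" h, simplified]
  by (simp add: lookup_add distrib_right single_add sum.distrib)

lemma skew_mult_add_right: "skew_mult \<theta> h (f + g) = skew_mult \<theta> h f + skew_mult \<theta> h g"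
  unfolding skew_mult_eq_sum[of "keys h" h "keys f \<union> keys g" "f + g", OF _ _ _ keys_add, simplified]
    skew_mult_eq_sum[of "keys h" h "keys f \<union> keys g" f, simplified]
    skew_mult_eq_sum[of "keys h" h "keys f \<union> keys g" g, simplified]
  by (simp add: lookup_add aut_pow_hom distrib_left single_add sum.distrib)

lemma skew_mult_0 [simp]: "skew_mult \<theta> 0 f = 0" "skew_mult \<theta> f 0 = 0"
  by (simp_all add: skew_mult_def)

lemma skew_mult_assoc: "skew_mult \<theta> (skew_mult \<theta> f g) h = skew_mult \<theta> f (skew_mult \<theta> g h)"
proof (induction f rule: poly_mapping_additive_induct)
  case (single i)
  show ?case
  proof (induction g rule: poly_mapping_additive_induct)
    case (single j)
    show ?case
      by (induction h rule: poly_mapping_additive_induct)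
        (simp_all add: skew_mult_add_right skew_mult_single aut_pow_hom aut_pow_add algebra_simps)
  qed (simp_all add: skew_mult_add_left skew_mult_add_right)
qed (simp_all add: skew_mult_add_left)

lemma skew_mult_1: "skew_mult \<theta> (single 0 1) f = f" "skew_mult \<theta> f (single 0 1) = f"
  by (induction f rule: poly_mapping_additive_induct)
    (simp_all add: skew_mult_add_left skew_mult_add_right skew_mult_single aut_pow_hom del: single_one)

definition Z where "Z = {f. \<forall>i\<in>keys f. int r dvd i \<and> lookup f i \<in> fixed_field \<theta>}"

lemma Z_ring_eq: "Z_ring \<theta> r = skew_laurent \<theta> \<lparr>carrier := Z\<rparr>"
  by (simp add: Z_ring_def Z_def)

lemma carrier_Z_ring [simp]: "carrier (Z_ring \<theta> r) = Z"
  by (simp add: Z_ring_eq)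

lemma Z_subset_lattice_supp: "d dvd r \<Longrightarrow> Z \<subseteq> lattice_supp d"
  using lattice_supp_antimono[of d r] by (auto simp: Z_def lattice_supp_def)

text \<open>In a left factor, the exponents of \<open>z\<close> increase the power of
  \<open>\<theta>\<close> that acts on \<open>g\<close>. They are multiples of \<open>r\<close>, so
  the action does not change.\<close>

lemma skew_mult_Z_left:
  assumes z: "z \<in> Z"
  shows "skew_mult \<theta> (f * z) g = skew_mult \<theta> f g * z"
proof (induction f rule: poly_mapping_additive_induct)
  case (single i)
  show ?case
  proof (induction g rule: poly_mapping_additive_induct)
    case (single j)
    show ?case
    proof (induction z rule: poly_mapping_additive_induct)
      case (single k)
      then have "int r dvd k" using z by (auto simp: Z_def)
      then show ?case
        by (simp add: mult_single skew_mult_single aut_pow_add aut_pow_dvd algebra_simps)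
    qed (simp_all add: skew_mult_add_left distrib_left)
  qed (simp_all add: skew_mult_add_right distrib_right)
qed (simp_all add: skew_mult_add_left distrib_right)

text \<open>In a right factor, powers of \<open>\<theta>\<close> act on the coefficients of
  \<open>z\<close>, which are fixed.\<close>

lemma skew_mult_Z_right:
  assumes z: "z \<in> Z"
  shows "skew_mult \<theta> f (g * z) = skew_mult \<theta> f g * z"
proof (induction f rule: poly_mapping_additive_induct)
  case (single i)
  show ?case
  proof (induction g rule: poly_mapping_additive_induct)
    case (single j)
    show ?case
    proof (induction z rule: poly_mapping_additive_induct)
      case (single k)
      then have "lookup z k \<in> fixed_field \<theta>" using z by (auto simp: Z_def)
      then show ?case
        by (simp add: mult_single skew_mult_single aut_pow_hom aut_pow_fixed algebra_simps)
    qed (simp_all add: skew_mult_add_right distrib_left)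
  qed (simp_all add: skew_mult_add_right distrib_right)
qed (simp_all add: skew_mult_add_left distrib_right)

lemma skew_mult_eq_mult_right: "z \<in> Z \<Longrightarrow> skew_mult \<theta> f z = f * z"
  using skew_mult_Z_right[of z f 1] skew_mult_1(2)[of f] by simp

lemma skew_mult_eq_mult_left: "z \<in> Z \<Longrightarrow> skew_mult \<theta> z f = z * f"
  using skew_mult_Z_left[of z 1 f] skew_mult_1(1)[of f] by (simp add: mult.commute)

lemma skew_mult_eq_mult: "f \<in> lattice_supp r \<Longrightarrow> skew_mult \<theta> f g = f * g"
  unfolding skew_mult_def mult_eq_sum_single
  by (intro sum.cong refl) (simp add: lattice_supp_def aut_pow_dvd)

text \<open>The common form of the skew ring (\<open>d = 1\<close>) and of
  \<open>K[Y\<^sup>\<plusminus>\<^sup>1]\<close> (\<open>d = r\<close>).\<close>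

definition L :: "nat \<Rightarrow> (int \<Rightarrow>\<^sub>0 'k) ring" where
  "L d = skew_laurent \<theta> \<lparr>carrier := lattice_supp d\<rparr>"

lemma L_1: "L (Suc 0) = skew_laurent \<theta>"
  by (simp add: L_def skew_laurent_def)

lemma L_r: "L r = C_ring \<theta> r"
  by (simp add: L_def C_ring_def lattice_supp_def)

lemma L_simps [simp]:
  "carrier (L d) = lattice_supp d" "f \<otimes>\<^bsub>L d\<^esub> g = skew_mult \<theta> f g" "f \<oplus>\<^bsub>L d\<^esub> g = f + g"
  "\<one>\<^bsub>L d\<^esub> = 1" "\<zero>\<^bsub>L d\<^esub> = 0"
  by (simp_all add: L_def skew_laurent_def)

lemma single_in_lattice_supp: "int d dvd i \<Longrightarrow> single i a \<in> lattice_supp d"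
  by (simp add: lattice_supp_def)

lemma ring_skew_laurent_carrier:
  assumes "1 \<in> A" "\<And>f g. f \<in> A \<Longrightarrow> g \<in> A \<Longrightarrow> f - g \<in> A"
    and "\<And>f g. f \<in> A \<Longrightarrow> g \<in> A \<Longrightarrow> skew_mult \<theta> f g \<in> A"
  shows "ring (skew_laurent \<theta> \<lparr>carrier := A\<rparr>)"
proof -
  have 0: "0 \<in> A" using assms(2)[OF assms(1,1)] by simp
  have uminus: "- f \<in> A" if "f \<in> A" for f using assms(2)[OF 0 that] by simp
  have add: "f + g \<in> A" if "f \<in> A" "g \<in> A" for f g
    using assms(2)[OF that(1) uminus[OF that(2)]] by simp
  show ?thesis
  proof (rule ringI)
    show "abelian_group (skew_laurent \<theta> \<lparr>carrier := A\<rparr>)"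
    proof (rule abelian_groupI)
      fix f assume "f \<in> carrier (skew_laurent \<theta> \<lparr>carrier := A\<rparr>)"
      then show "\<exists>g\<in>carrier (skew_laurent \<theta> \<lparr>carrier := A\<rparr>).
          g \<oplus>\<^bsub>skew_laurent \<theta> \<lparr>carrier := A\<rparr>\<^esub> f = \<zero>\<^bsub>skew_laurent \<theta> \<lparr>carrier := A\<rparr>\<^esub>"
        by (intro bexI[of _ "- f"]) (auto simp: skew_laurent_def uminus)
    qed (auto simp: skew_laurent_def 0 add algebra_simps)
    show "Group.monoid (skew_laurent \<theta> \<lparr>carrier := A\<rparr>)"
      by (rule monoidI)
        (use assms in \<open>auto simp: skew_laurent_def skew_mult_assoc skew_mult_1 simp flip: single_one\<close>)
  qed (auto simp: skew_laurent_def skew_mult_add_left skew_mult_add_right)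
qed

lemma skew_mult_in_lattice_supp:
  assumes "f \<in> lattice_supp d" "g \<in> lattice_supp d"
  shows "skew_mult \<theta> f g \<in> lattice_supp d"
  unfolding skew_mult_def
  using assms by (intro lattice_supp_sum single_in_lattice_supp) (auto simp: lattice_supp_def)

lemma ring_L: "ring (L d)"
  unfolding L_def
  using is_subring_lattice_supp[of d]
  by (intro ring_skew_laurent_carrier skew_mult_in_lattice_supp) (auto simp: is_subring_def)

lemma fixed_field_closed:
  assumes "a \<in> fixed_field \<theta>" "b \<in> fixed_field \<theta>"
  shows "a + b \<in> fixed_field \<theta>" "a - b \<in> fixed_field \<theta>" "a * b \<in> fixed_field \<theta>"
proof -
  show "a + b \<in> fixed_field \<theta>" "a * b \<in> fixed_field \<theta>"
    using assms by (auto simp: fixed_field_def \<theta>_hom)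
  have "\<theta> (a - b) + \<theta> b = \<theta> a" using \<theta>_hom(1)[of "a - b" b] by simp
  then show "a - b \<in> fixed_field \<theta>"
    using assms by (simp add: fixed_field_def) (metis add_diff_cancel_right')
qed

lemma of_int_fixed: "of_int n \<in> fixed_field \<theta>"
proof (induction n)
  case (nonneg n)
  then show ?case by (induction n) (auto simp: fixed_field_def \<theta>_hom)
next
  case (neg n)
  have "of_nat m \<in> fixed_field \<theta>" for m
    by (induction m) (auto simp: fixed_field_def \<theta>_hom)
  from fixed_field_closed(2)[OF this[of 0] this[of "Suc n"]] show ?case by simp
qed

lemma Z_iff: "f \<in> Z \<longleftrightarrow> f \<in> lattice_supp r \<and> (\<forall>i. lookup f i \<in> fixed_field \<theta>)"
proof -
  have "0 \<in> fixed_field \<theta>" by (simp add: fixed_field_def \<theta>_hom)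
  then have "(\<forall>i. lookup f i \<in> fixed_field \<theta>) \<longleftrightarrow> (\<forall>i\<in>keys f. lookup f i \<in> fixed_field \<theta>)"
    by (metis in_keys_iff)
  then show ?thesis by (auto simp: Z_def lattice_supp_def)
qed

lemma Z_sum: "(\<And>i. i \<in> A \<Longrightarrow> f i \<in> Z) \<Longrightarrow> sum f A \<in> Z"
proof (rule add_closed_sum)
  fix a b assume "a \<in> Z" "b \<in> Z"
  then show "a + b \<in> Z"
    by (simp add: Z_iff lookup_add fixed_field_closed subring_add[OF is_subring_lattice_supp])
qed (simp_all add: Z_iff fixed_field_def \<theta>_hom subring_0[OF is_subring_lattice_supp])

lemma single_in_Z: "int r dvd i \<Longrightarrow> a \<in> fixed_field \<theta> \<Longrightarrow> single i a \<in> Z"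
  by (auto simp: Z_def)

lemma is_subring_Z: "is_subring Z"
proof -
  have "f * g \<in> Z" if "f \<in> Z" "g \<in> Z" for f g
    unfolding mult_eq_sum_single using that
    by (intro Z_sum single_in_Z) (auto simp: Z_def fixed_field_closed)
  moreover have "f - g \<in> Z" if "f \<in> Z" "g \<in> Z" for f g
    using that by (simp add: Z_iff lookup_minus fixed_field_closed subring_diff[OF is_subring_lattice_supp])
  moreover have "1 \<in> Z"
    using of_int_fixed[of 1] by (simp add: single_in_Z flip: single_one)
  ultimately show ?thesis by (simp add: is_subring_def)
qed

lemma ring_Z: "ring (Z_ring \<theta> r)"
  unfolding Z_ring_eq using is_subring_Z
  by (intro ring_skew_laurent_carrier) (auto simp: skew_mult_eq_mult_right is_subring_def)

lemma Z_simps: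
  "z \<in> Z \<Longrightarrow> f \<otimes>\<^bsub>Z_ring \<theta> r\<^esub> z = f * z" "f \<oplus>\<^bsub>Z_ring \<theta> r\<^esub> g = f + g"
  "\<one>\<^bsub>Z_ring \<theta> r\<^esub> = 1" "\<zero>\<^bsub>Z_ring \<theta> r\<^esub> = 0"
  by (simp_all add: Z_ring_eq skew_laurent_def skew_mult_eq_mult_right)

lemma cring_Z: "cring (Z_ring \<theta> r)"
proof -
  interpret ring "Z_ring \<theta> r" by (rule ring_Z)
  show ?thesis
    by (intro cring.intro ring_axioms comm_monoid.intro monoid_axioms comm_monoid_axioms.intro)
      (simp add: Z_simps mult.commute)
qed

lemma deriv_Y_in_Z: "N \<in> Z \<Longrightarrow> deriv_Y r N \<in> Z"
  unfolding deriv_Y_def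
  by (intro Z_sum single_in_Z fixed_field_closed of_int_fixed) (auto simp: Z_def)

text \<open>The sum of the two principal ideals is an ideal that contains both generators, hence the
  generated ideal, hence \<open>1\<close>. Its elements have the form required of the
  coefficients.\<close>

lemma separable_bezout:
  assumes "N \<in> Z" "separable_Y \<theta> r N"
  obtains a b where "a \<in> Z" "b \<in> Z" "a * N + b * deriv_Y r N = 1"
proof -
  interpret cring "Z_ring \<theta> r" by (rule cring_Z)
  let ?J = "PIdl\<^bsub>Z_ring \<theta> r\<^esub> N <+>\<^bsub>Z_ring \<theta> r\<^esub> PIdl\<^bsub>Z_ring \<theta> r\<^esub> (deriv_Y r N)"
  have D: "deriv_Y r N \<in> Z" using assms(1) by (rule deriv_Y_in_Z)
  have id: "ideal (PIdl\<^bsub>Z_ring \<theta> r\<^esub> N) (Z_ring \<theta> r)" "ideal (PIdl\<^bsub>Z_ring \<theta> r\<^esub> (deriv_Y r N)) (Z_ring \<theta> r)"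
    using assms(1) D by (auto intro: cgenideal_ideal)
  have J: "ideal ?J (Z_ring \<theta> r)"
    using id by (rule add_ideals)
  have "N = N \<oplus>\<^bsub>Z_ring \<theta> r\<^esub> \<zero>\<^bsub>Z_ring \<theta> r\<^esub>" "deriv_Y r N = \<zero>\<^bsub>Z_ring \<theta> r\<^esub> \<oplus>\<^bsub>Z_ring \<theta> r\<^esub> deriv_Y r N"
    using assms(1) D by simp_all
  then have "{N, deriv_Y r N} \<subseteq> ?J"
    using cgenideal_self[of N] cgenideal_self[of "deriv_Y r N"] assms(1) D
      additive_subgroup.zero_closed[OF ideal.axioms(1)[OF id(1)]]
      additive_subgroup.zero_closed[OF ideal.axioms(1)[OF id(2)]]
    unfolding set_add_def' carrier_Z_ring by blast
  then have "\<one>\<^bsub>Z_ring \<theta> r\<^esub> \<in> ?J"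
    using genideal_minimal[OF J] assms(2) one_closed unfolding separable_Y_def by blast
  then obtain a b where ab: "a \<in> Z" "b \<in> Z"
      "1 = a \<otimes>\<^bsub>Z_ring \<theta> r\<^esub> N \<oplus>\<^bsub>Z_ring \<theta> r\<^esub> b \<otimes>\<^bsub>Z_ring \<theta> r\<^esub> deriv_Y r N"
    unfolding set_add_def' cgenideal_def by (auto simp: Z_simps(3))
  then show thesis using assms(1) D by (intro that) (simp_all add: Z_simps)
qed

end

section \<open>The binomial series of exponent \<open>1/r\<close>\<close>

text \<open>The localization of the integers at the characteristic of the field; all of the
  rationals in characteristic 0. The fraction need not be reduced, which makes closure under ring
  operations immediate.\<close>

definition integral_at :: "'k::field itself \<Rightarrow> rat set" where
  "integral_at _ = {of_int a / of_int b | a b. (of_int b :: 'k) \<noteq> 0}"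

lemma integral_atE:
  assumes "q \<in> integral_at TYPE('k::field)"
  obtains a b where "q = of_int a / of_int b" "(of_int b :: 'k) \<noteq> 0" "b \<noteq> 0"
proof -
  from assms obtain a b where "q = of_int a / of_int b" "(of_int b :: 'k) \<noteq> 0"
    by (auto simp: integral_at_def)
  moreover from this have "b \<noteq> 0" by auto
  ultimately show thesis by (rule that)
qed

text \<open>The definition uses the reduced fraction. Its denominator divides \<open>b\<close>, so
  it is nonzero in the field, and cross-multiplication carries over.\<close>

lemma rat_to_field_frac:
  assumes "(of_int b :: 'k::field) \<noteq> 0"
  shows "(rat_to_field (of_int a / of_int b) :: 'k) = of_int a / of_int b"
proof -
  have b: "b \<noteq> 0" using assms by auto
  obtain m n where mn: "quotient_of (of_int a / of_int b) = (m, n)" by fastforce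
  have n: "n > 0" "coprime m n"
    using mn quotient_of_denom_pos quotient_of_coprime by blast+
  have "(of_int a / of_int b :: rat) = of_int m / of_int n"
    using quotient_of_div[OF mn] .
  then have "(of_int (a * n) :: rat) = of_int (m * b)"
    using b n by (simp add: field_simps)
  then have eq: "a * n = m * b" by (simp only: of_int_eq_iff)
  then have "n dvd m * b" by (metis dvd_triv_right)
  then have "n dvd b" using n by (simp add: coprime_commute coprime_dvd_mult_right_iff)
  then have "(of_int n :: 'k) \<noteq> 0" using assms by auto
  moreover have "(of_int a * of_int n :: 'k) = of_int m * of_int b"
    using eq by (metis of_int_mult)
  ultimately show ?thesis
    using assms mn by (simp add: rat_to_field_def field_simps)
qed

lemma integral_at_hom:
  fixes x y :: rat
  assumes "x \<in> integral_at TYPE('k::field)" "y \<in> integral_at TYPE('k)"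
  shows "x - y \<in> integral_at TYPE('k)" "x * y \<in> integral_at TYPE('k)" "x + y \<in> integral_at TYPE('k)"
    "(rat_to_field (x + y) :: 'k) = rat_to_field x + rat_to_field y"
    "(rat_to_field (x * y) :: 'k) = rat_to_field x * rat_to_field y"
proof -
  obtain a b where x: "x = of_int a / of_int b" "(of_int b :: 'k) \<noteq> 0" "b \<noteq> 0"
    using assms(1) by (rule integral_atE)
  obtain c d where y: "y = of_int c / of_int d" "(of_int d :: 'k) \<noteq> 0" "d \<noteq> 0"
    using assms(2) by (rule integral_atE)
  have bd: "(of_int (b * d) :: 'k) \<noteq> 0" using x y by simp
  have minus: "x - y = of_int (a * d - c * b) / of_int (b * d)"
    and plus: "x + y = of_int (a * d + c * b) / of_int (b * d)"
    and times: "x * y = of_int (a * c) / of_int (b * d)"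
    using x(3) y(3) unfolding x(1) y(1) by (simp_all add: field_simps)
  from bd show "x - y \<in> integral_at TYPE('k)" "x * y \<in> integral_at TYPE('k)" "x + y \<in> integral_at TYPE('k)"
    unfolding integral_at_def minus plus times by blast+
  have rx: "(rat_to_field x :: 'k) = of_int a / of_int b"
    by (simp only: x(1) rat_to_field_frac[OF x(2)])
  have ry: "(rat_to_field y :: 'k) = of_int c / of_int d"
    by (simp only: y(1) rat_to_field_frac[OF y(2)])
  have "(rat_to_field (x + y) :: 'k) = of_int (a * d + c * b) / of_int (b * d)"
    by (simp only: plus rat_to_field_frac[OF bd])
  then show "(rat_to_field (x + y) :: 'k) = rat_to_field x + rat_to_field y"
    using x(2) y(2) by (simp add: rx ry field_simps)
  have "(rat_to_field (x * y) :: 'k) = of_int (a * c) / of_int (b * d)"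
    by (simp only: times rat_to_field_frac[OF bd])
  then show "(rat_to_field (x * y) :: 'k) = rat_to_field x * rat_to_field y"
    by (simp add: rx ry)
qed

lemma rat_to_field_of_int: "(rat_to_field (of_int a) :: 'k::field) = of_int a"
  using rat_to_field_frac[where 'k = 'k, of 1 a] by simp

lemma is_subring_integral_at: "is_subring (integral_at TYPE('k::field))"
proof -
  have "(1::rat) = of_int 1 / of_int 1" "(of_int 1 :: 'k) \<noteq> 0" by simp_all
  then have "1 \<in> integral_at TYPE('k)" unfolding integral_at_def by blast
  then show ?thesis by (simp add: is_subring_def integral_at_hom)
qed

text \<open>
  The binomial series is the unique solution of \<open>s\<^sup>r = 1 + T\<close> with constant coefficient \<open>1\<close>.
  Newton iteration over the subring of rationals with denominator invertible in the field
  yields such a solution, so the coefficients lie in that subring.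
\<close>

lemma gbinomial_integral_at:
  assumes "(of_nat r :: 'k::field) \<noteq> 0"
  shows "(1 / of_nat r) gchoose n \<in> integral_at TYPE('k)"
proof -
  let ?Q = "integral_at TYPE('k)"
  note Q = is_subring_integral_at[where 'k = 'k]
  note QF = is_subring_fps_over[OF Q]
  have r: "r > 0" using assms by (cases r) auto
  define h :: "rat fps poly" where "h = monom 1 r - [:1 + fps_X:]"
  define u :: "rat fps" where "u = fps_const (1 / of_nat r)"
  define B :: "rat fps" where "B = fps_binomial (1 / of_nat r)"
  have h: "poly h s = s ^ r - (1 + fps_X)" for s by (simp add: h_def poly_monom)
  have h': "poly (pderiv h) s = of_nat r * s ^ (r - 1)" for s
    by (simp add: h_def pderiv_diff pderiv_monom poly_monom)
  have u1: "u * poly (pderiv h) 1 = 1"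
  proof -
    have "u * of_nat r = fps_const (1 / of_nat r * of_nat r)"
      by (simp only: u_def fps_of_nat[symmetric] fps_const_mult)
    then show ?thesis using r by (simp add: h')
  qed
  have "(1 / of_nat r :: rat) = of_int 1 / of_int (int r)" "(of_int (int r) :: 'k) \<noteq> 0"
    using assms by simp_all
  then have "1 / of_nat r \<in> ?Q" unfolding integral_at_def by blast
  then have u: "u \<in> fps_over ?Q" unfolding u_def by (rule fps_const_in_fps_over[OF Q])
  have "coeff h i \<in> fps_over ?Q" for i
    using subring_1[OF QF] subring_0[OF QF] fps_X_in_fps_over[OF Q]
    by (auto simp: h_def coeff_pCons split: nat.splits intro!: subring_diff[OF QF] subring_add[OF QF] subring_uminus[OF QF])
  \<comment> \<open>With modulus \<open>0\<close> the Newton lemmas concern ordinary power series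
    over the rationals.\<close>
  moreover have "vanishing 0 1 (poly h 1)" by (simp add: h vanishing_def)
  moreover have "vanishing 0 1 (u * poly (pderiv h) 1 - 1)" by (simp add: u1 vanishing_def)
  ultimately obtain V where V: "V \<in> fps_over ?Q" "fps_nth V 0 = 1" "\<And>m. vanishing 0 m (poly h V)"
    using newton_root_exists[OF Q, of h 0 1 u] u subring_1[OF QF] by auto
  have B: "B ^ r = 1 + fps_X"
    using r by (simp add: B_def fps_binomial_power fps_binomial_1)
  have "fps_nth (poly (pderiv h) B) 0 = of_nat r"
    by (simp add: h' B_def fps_power_zeroth_eq_one fps_of_nat[symmetric])
  then have "vanishing 0 1 (u * poly (pderiv h) B - 1)"
    using r by (simp add: vanishing_def u_def)
  moreover have "vanishing 0 m (poly h B)" for m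
    by (simp add: h B vanishing_def)
  moreover have "fps_nth B 0 = 1" by (simp add: B_def)
  then have "vanishing 0 1 (V - B)" by (simp add: V(2) vanishing_def)
  ultimately have "vanishing 0 (Suc n) (V - B)"
    using V(3) newton_root_unique by blast
  then have "fps_nth V n = fps_nth B n"
    by (simp add: vanishing_def)
  moreover have "fps_nth V n \<in> ?Q" using V(1) by (simp add: fps_over_def)
  ultimately show ?thesis by (simp add: B_def)
qed

text \<open>The hypotheses on \<open>f\<close> are relative to \<open>Q\<close> because
  \<open>rat_to_field\<close> is a homomorphism only on \<open>integral_at\<close>.\<close>

lemma fps_map_power:
  fixes f :: "'a::comm_ring_1 \<Rightarrow> 'b::comm_ring_1"
  assumes Q: "is_subring Q" and s: "s \<in> fps_over Q"
    and f: "f 1 = 1" "\<And>a b. a \<in> Q \<Longrightarrow> b \<in> Q \<Longrightarrow> f (a + b) = f a + f b"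
      "\<And>a b. a \<in> Q \<Longrightarrow> b \<in> Q \<Longrightarrow> f (a * b) = f a * f b"
  shows "Abs_fps (\<lambda>n. f (fps_nth s n)) ^ m = Abs_fps (\<lambda>n. f (fps_nth (s ^ m) n))"
proof -
  have f0: "f 0 = 0" using f(2)[of 0 0] subring_0[OF Q] by simp
  have f_sum: "f (sum g A) = (\<Sum>i\<in>A. f (g i))" if "\<And>i. i \<in> A \<Longrightarrow> g i \<in> Q" for A :: "nat set" and g
    using that by (induction A rule: infinite_finite_induct) (simp_all add: f0 f subring_sum[OF Q])
  show ?thesis
  proof (induction m)
    case 0
    then show ?case by (simp add: fps_eq_iff f f0)
  next
    case (Suc m)
    have "s ^ m \<in> fps_over Q" using is_subring_fps_over[OF Q] s by (rule subring_power)
    then show ?case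
      using s by (simp add: Suc fps_eq_iff fps_mult_nth f_sum f fps_over_def subring_mult[OF Q])
  qed
qed

text \<open>The identity holds for the rational binomial series with variable \<open>T\<close>. It
  is carried to the ring coefficient by coefficient, and then \<open>x T\<close> is substituted for
  \<open>T\<close>.\<close>

lemma fps_root_power:
  fixes x :: "'a::idom fps"
  assumes r: "(of_nat r :: 'k::field) \<noteq> 0"
    and \<iota>: "\<iota> 1 = (1 :: 'a)" "\<And>a b. \<iota> (a + b) = \<iota> a + \<iota> b" "\<And>a b. \<iota> (a * b :: 'k) = \<iota> a * \<iota> b"
  defines "c \<equiv> Abs_fps (\<lambda>n. \<iota> (rat_to_field ((1 / of_nat r) gchoose n)))"
  shows "(c oo (x * fps_X)) ^ r = 1 + x * fps_X"
proof -
  have r0: "r > 0" using r by (cases r) auto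
  let ?f = "\<lambda>q. \<iota> (rat_to_field q)"
  have \<iota>0: "\<iota> 0 = 0"
    using \<iota>(2)[of 0 0] by (metis add.right_neutral add_left_imp_eq)
  have B: "fps_binomial (1 / of_nat r) \<in> fps_over (integral_at TYPE('k))"
    using gbinomial_integral_at[OF r] by (simp add: fps_over_def)
  have rtf: "(rat_to_field 0 :: 'k) = 0" "(rat_to_field 1 :: 'k) = 1"
    using rat_to_field_of_int[of 0] rat_to_field_of_int[of 1] by simp_all
  have "c = Abs_fps (\<lambda>n. ?f (fps_nth (fps_binomial (1 / of_nat r)) n))"
    by (simp add: c_def)
  then have "c ^ r = Abs_fps (\<lambda>n. ?f (fps_nth (fps_binomial (1 / of_nat r) ^ r) n))"
    using fps_map_power[OF is_subring_integral_at B, where f = ?f and m = r]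
    by (simp add: \<iota> integral_at_hom rtf)
  also have "\<dots> = 1 + fps_X"
    using r0 by (simp add: fps_binomial_power fps_binomial_1 fps_eq_iff fps_X_def rtf \<iota> \<iota>0)
  finally have "c ^ r = 1 + fps_X" .
  then show ?thesis
    by (simp add: fps_compose_power fps_compose_add_distrib)
qed

section \<open>Power series over the quotients\<close>

text \<open>The product of \<open>series_ring\<close> on representatives, before reduction modulo
  \<open>N\<close>.\<close>

definition skew_fps ::
    "('k::field \<Rightarrow> 'k) \<Rightarrow> (int \<Rightarrow>\<^sub>0 'k) fps \<Rightarrow> (int \<Rightarrow>\<^sub>0 'k) fps \<Rightarrow> (int \<Rightarrow>\<^sub>0 'k) fps" where
  "skew_fps \<theta> s t = Abs_fps (\<lambda>n. \<Sum>i\<le>n. skew_mult \<theta> (fps_nth s i) (fps_nth t (n - i)))"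

lemma fps_over_mono: "Q \<subseteq> Q' \<Longrightarrow> fps_over Q \<subseteq> fps_over Q'"
  by (auto simp: fps_over_def)

context skew_laurent_setting
begin

lemma skew_fps_add:
  "skew_fps \<theta> (s + t) u = skew_fps \<theta> s u + skew_fps \<theta> t u"
  "skew_fps \<theta> u (s + t) = skew_fps \<theta> u s + skew_fps \<theta> u t"
  by (simp_all add: skew_fps_def fps_eq_iff skew_mult_add_left skew_mult_add_right sum.distrib)

lemma skew_fps_0 [simp]: "skew_fps \<theta> 0 s = 0" "skew_fps \<theta> s 0 = 0"
  by (simp_all add: skew_fps_def fps_eq_iff)

lemma skew_fps_eq_mult_right: "t \<in> fps_over Z \<Longrightarrow> skew_fps \<theta> s t = s * t"
  by (simp add: skew_fps_def fps_eq_iff fps_mult_nth fps_over_def skew_mult_eq_mult_right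
      atMost_atLeast0)

lemma skew_fps_eq_mult_left: "s \<in> fps_over (lattice_supp r) \<Longrightarrow> skew_fps \<theta> s t = s * t"
  by (simp add: skew_fps_def fps_eq_iff fps_mult_nth fps_over_def skew_mult_eq_mult
      atMost_atLeast0)

lemma skew_fps_const:
  assumes "z \<in> fps_over Z" "w \<in> fps_over Z"
  shows "skew_fps \<theta> (fps_const a * z) (fps_const b * w) = fps_const (skew_mult \<theta> a b) * (z * w)"
proof (rule fps_ext)
  fix n
  have [simp]: "fps_nth z i \<in> Z" "fps_nth w i \<in> Z" for i
    using assms by (auto simp: fps_over_def)
  have "fps_nth (skew_fps \<theta> (fps_const a * z) (fps_const b * w)) n =
      (\<Sum>i\<le>n. skew_mult \<theta> a b * (fps_nth z i * fps_nth w (n - i)))"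
    by (simp add: skew_fps_def skew_mult_Z_left skew_mult_Z_right mult_ac)
  also have "\<dots> = skew_mult \<theta> a b * fps_nth (z * w) n"
    by (simp add: fps_mult_nth sum_distrib_left atMost_atLeast0)
  finally show "fps_nth (skew_fps \<theta> (fps_const a * z) (fps_const b * w)) n =
      fps_nth (fps_const (skew_mult \<theta> a b) * (z * w)) n"
    by simp
qed

end

locale central_level = skew_laurent_setting \<theta> r for \<theta> :: "'k::field \<Rightarrow> 'k" and r +
  fixes N :: "int \<Rightarrow>\<^sub>0 'k" and d :: nat
  assumes N_Z: "N \<in> Z" and d_dvd: "d dvd r"
begin

lemma Z_subset: "Z \<subseteq> lattice_supp d"
  using d_dvd by (rule Z_subset_lattice_supp)

lemma lattice_supp_r_subset: "lattice_supp r \<subseteq> (lattice_supp d :: (int \<Rightarrow>\<^sub>0 'k) set)"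
  using d_dvd by (rule lattice_supp_antimono)

sublocale D: central_element "L d" N
proof (rule central_element.intro[OF ring_L], unfold_locales)
  show "N \<in> carrier (L d)" using N_Z Z_subset by auto
qed (simp add: skew_mult_eq_mult_left[OF N_Z] skew_mult_eq_mult_right[OF N_Z] mult.commute)

sublocale R: ring "quot (L d) N"
  by (rule D.ring_quot)

sublocale PS: ring "series_ring (quot (L d) N)"
  by (rule D.ring_S)

abbreviation "R \<equiv> quot (L d) N"
abbreviation "PS \<equiv> series_ring (quot (L d) N)"
abbreviation "cls \<equiv> quot_class (L d) N"

definition proj where "proj s = (\<lambda>n. cls (fps_nth s n))"

text \<open>The classes are formed inside \<open>L d\<close>, while divisibility is meant in the
  whole domain; \<open>lattice_supp_dvd\<close> closes the gap. The criterion does not mention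
  \<open>d\<close>, so it is the same at every level.\<close>

lemma cls_eq_iff:
  assumes "a \<in> lattice_supp d" "b \<in> lattice_supp d"
  shows "cls a = cls b \<longleftrightarrow> N dvd a - b"
proof -
  have pow: "N [^]\<^bsub>L d\<^esub> (1::nat) = N"
    using D.nat_pow_Suc[of N 0] D.nat_pow_0[of N] by (simp add: skew_mult_eq_mult_right[OF N_Z])
  have "cls a = cls b \<longleftrightarrow> (\<exists>c\<in>lattice_supp d. a = b + N * c)"
    using D.class_eq_iff[of a b 1] assms unfolding pow
    by (simp add: quot_class_def skew_mult_eq_mult_left[OF N_Z])
  also have "\<dots> \<longleftrightarrow> N dvd a - b"
  proof
    assume "N dvd a - b"
    moreover have "N \<in> lattice_supp d" "a - b \<in> lattice_supp d"
      using N_Z Z_subset assms subring_diff[OF is_subring_lattice_supp] by blast+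
    ultimately obtain c where "c \<in> lattice_supp d" "a - b = N * c"
      by (metis lattice_supp_dvd)
    then show "\<exists>c\<in>lattice_supp d. a = b + N * c" by (auto simp: algebra_simps)
  qed (auto simp: algebra_simps)
  finally show ?thesis .
qed

lemma cls_hom:
  "a \<in> lattice_supp d \<Longrightarrow> cls a \<in> carrier R"
  "a \<in> lattice_supp d \<Longrightarrow> b \<in> lattice_supp d \<Longrightarrow> cls a \<oplus>\<^bsub>R\<^esub> cls b = cls (a + b)"
  "a \<in> lattice_supp d \<Longrightarrow> b \<in> lattice_supp d \<Longrightarrow> cls a \<otimes>\<^bsub>R\<^esub> cls b = cls (skew_mult \<theta> a b)"
  "\<one>\<^bsub>R\<^esub> = cls 1" "\<zero>\<^bsub>R\<^esub> = cls 0"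
  using ring_hom_closed[OF D.quot_class_hom] ring_hom_add[OF D.quot_class_hom]
    ring_hom_mult[OF D.quot_class_hom] ring_hom_one[OF D.quot_class_hom]
    ring_hom_zero[OF D.quot_class_hom ring_L D.ring_quot]
  by simp_all

lemma cls_sum:
  assumes "\<And>i. f i \<in> lattice_supp d"
  shows "(\<Oplus>\<^bsub>R\<^esub>i\<in>{..n::nat}. cls (f i)) = cls (\<Sum>i\<le>n. f i)"
proof (induction n)
  case (Suc n)
  then show ?case
    using assms lattice_supp_sum[of "{..n}" f d] by (simp add: cls_hom R.finsum_Suc Pi_def add.commute)
qed (use assms in \<open>simp add: cls_hom subring_0[OF is_subring_lattice_supp]\<close>)

lemma proj_nth: "proj s n = cls (fps_nth s n)"
  by (simp add: proj_def)

lemma proj_closed: "s \<in> fps_over (lattice_supp d) \<Longrightarrow> proj s \<in> carrier PS"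
  by (simp add: proj_def fps_over_def cls_hom)

lemma proj_surj:
  assumes "t \<in> carrier PS"
  obtains s where "s \<in> fps_over (lattice_supp d)" "t = proj s"
proof -
  have "\<forall>n. \<exists>a. a \<in> lattice_supp d \<and> t n = cls a"
    using assms D.carrier_quot_iff by (auto simp: Bex_def)
  then obtain f where "\<And>n. f n \<in> lattice_supp d" "\<And>n. t n = cls (f n)" by metis
  then show thesis
    by (intro that[of "Abs_fps f"]) (auto simp: fps_over_def proj_def)
qed

lemma proj_eq_iff:
  assumes "s \<in> fps_over (lattice_supp d)" "t \<in> fps_over (lattice_supp d)"
  shows "proj s = proj t \<longleftrightarrow> (\<forall>m. vanishing N m (s - t))"
proof -
  have "proj s = proj t \<longleftrightarrow> (\<forall>n. cls (fps_nth s n) = cls (fps_nth t n))"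
    by (simp add: proj_def fun_eq_iff)
  also have "\<dots> \<longleftrightarrow> (\<forall>n. N dvd fps_nth s n - fps_nth t n)"
    using assms by (simp add: cls_eq_iff fps_over_def)
  also have "\<dots> \<longleftrightarrow> (\<forall>m. vanishing N m (s - t))"
    by (auto simp: vanishing_def)
  finally show ?thesis .
qed

lemma proj_add:
  assumes "s \<in> fps_over (lattice_supp d)" "t \<in> fps_over (lattice_supp d)"
  shows "proj s \<oplus>\<^bsub>PS\<^esub> proj t = proj (s + t)"
  using assms by (simp add: proj_def fps_over_def cls_hom)

lemma proj_skew:
  assumes "s \<in> fps_over (lattice_supp d)" "t \<in> fps_over (lattice_supp d)"
  shows "proj s \<otimes>\<^bsub>PS\<^esub> proj t = proj (skew_fps \<theta> s t)"
proof
  fix n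
  have st: "fps_nth s i \<in> lattice_supp d" "fps_nth t i \<in> lattice_supp d" for i
    using assms by (auto simp: fps_over_def)
  then show "(proj s \<otimes>\<^bsub>PS\<^esub> proj t) n = proj (skew_fps \<theta> s t) n"
    by (simp add: series_mult_nth proj_nth cls_hom cls_sum skew_mult_in_lattice_supp skew_fps_def)
qed

lemma proj_mult_right:
  assumes "s \<in> fps_over (lattice_supp d)" "t \<in> fps_over Z"
  shows "proj s \<otimes>\<^bsub>PS\<^esub> proj t = proj (s * t)"
  using assms fps_over_mono[OF Z_subset] proj_skew[of s t] by (auto simp: skew_fps_eq_mult_right)

lemma proj_mult_left:
  assumes "s \<in> fps_over (lattice_supp r)" "t \<in> fps_over (lattice_supp d)"
  shows "proj s \<otimes>\<^bsub>PS\<^esub> proj t = proj (s * t)"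
  using assms fps_over_mono[OF lattice_supp_r_subset] proj_skew[of s t]
  by (auto simp: skew_fps_eq_mult_left)

lemma proj_const: "proj (fps_const a) = series_const R (cls a)"
  by (rule ext) (simp add: proj_def series_const_def cls_hom)

lemma proj_1: "proj 1 = \<one>\<^bsub>PS\<^esub>"
  by (rule ext) (simp add: proj_def series_one_nth cls_hom)

lemma proj_X: "proj fps_X = series_T R"
  by (rule ext) (simp add: proj_def series_T_def cls_hom fps_X_def)

lemma proj_power:
  assumes "s \<in> fps_over Z"
  shows "proj s [^]\<^bsub>PS\<^esub> (n::nat) = proj (s ^ n)"
proof (induction n)
  case (Suc n)
  have "s ^ n \<in> fps_over (lattice_supp d)"
    using subring_power[OF is_subring_fps_over[OF is_subring_Z] assms] fps_over_mono[OF Z_subset]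
    by blast
  then show ?case
    using assms by (simp add: Suc proj_mult_right mult.commute)
qed (simp add: proj_1)

lemma proj_sum:
  assumes "\<And>i. f i \<in> fps_over (lattice_supp d)"
  shows "(\<Oplus>\<^bsub>PS\<^esub>i\<in>{..n::nat}. proj (f i)) = proj (\<Sum>i\<le>n. f i)"
proof (induction n)
  case (Suc n)
  have sum: "(\<Sum>i\<le>n. f i) \<in> fps_over (lattice_supp d)"
    using assms by (intro subring_sum[OF is_subring_fps_over[OF is_subring_lattice_supp]])
  have "(\<Oplus>\<^bsub>PS\<^esub>i\<in>{..Suc n}. proj (f i)) = proj (f (Suc n)) \<oplus>\<^bsub>PS\<^esub> (\<Oplus>\<^bsub>PS\<^esub>i\<in>{..n}. proj (f i))"
    using assms by (intro PS.finsum_Suc) (auto simp del: series_ring_simps intro: proj_closed)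
  also have "\<dots> = proj (f (Suc n) + (\<Sum>i\<le>n. f i))"
    unfolding Suc using assms sum by (intro proj_add)
  finally show ?case by (simp add: add.commute)
qed (use assms in \<open>simp del: series_ring_simps add: proj_closed\<close>)

text \<open>In the coefficient of \<open>T^k\<close>, both the composition and the definition of the
  root keep only the terms with \<open>n \<le> k\<close>. All factors are central, so their twisted
  products are ordinary ones.\<close>

lemma series_root_proj:
  fixes x :: "(int \<Rightarrow>\<^sub>0 'k) fps"
  assumes x: "x \<in> fps_over Z"
    and c: "\<And>n. single 0 (rat_to_field ((1 / of_nat r) gchoose n)) \<in> Z"
  shows "series_root_1p R (quot_str (L d) N) r (proj x) =
    proj (Abs_fps (\<lambda>n. single 0 (rat_to_field ((1 / of_nat r) gchoose n))) oo (x * fps_X))"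
proof
  fix k
  let ?c = "\<lambda>n. single 0 (rat_to_field ((1 / of_nat r) gchoose n)) :: int \<Rightarrow>\<^sub>0 'k"
  note QZ = is_subring_fps_over[OF is_subring_Z]
  note sub = subsetD[OF fps_over_mono[OF Z_subset]]
  have cZ: "fps_const (?c n) \<in> fps_over Z" for n
    using c is_subring_Z by (intro fps_const_in_fps_over)
  have xZ: "x ^ n \<in> fps_over Z" "fps_X ^ n \<in> fps_over Z" for n
    using x fps_X_in_fps_over[OF is_subring_Z] subring_power[OF QZ] by blast+
  have mem: "fps_const (?c n) * x ^ n * fps_X ^ n \<in> fps_over (lattice_supp d)" for n
    using cZ xZ by (intro sub subring_mult[OF QZ])
  have summand: "series_const R (quot_str (L d) N (rat_to_field ((1 / of_nat r) gchoose n)))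
      \<otimes>\<^bsub>PS\<^esub> (proj x [^]\<^bsub>PS\<^esub> n) \<otimes>\<^bsub>PS\<^esub> (series_T R [^]\<^bsub>PS\<^esub> n) =
      proj (fps_const (?c n) * x ^ n * fps_X ^ n)" for n
  proof -
    have "series_const R (quot_str (L d) N (rat_to_field ((1 / of_nat r) gchoose n)))
      \<otimes>\<^bsub>PS\<^esub> (proj x [^]\<^bsub>PS\<^esub> n) \<otimes>\<^bsub>PS\<^esub> (series_T R [^]\<^bsub>PS\<^esub> n) =
      proj (fps_const (?c n)) \<otimes>\<^bsub>PS\<^esub> proj (x ^ n) \<otimes>\<^bsub>PS\<^esub> proj (fps_X ^ n)"
      using x fps_X_in_fps_over[OF is_subring_Z]
      by (simp add: quot_str_def proj_const proj_power flip: proj_X)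
    also have "\<dots> = proj (fps_const (?c n) * x ^ n) \<otimes>\<^bsub>PS\<^esub> proj (fps_X ^ n)"
      using cZ xZ sub by (subst proj_mult_right) auto
    also have "\<dots> = proj (fps_const (?c n) * x ^ n * fps_X ^ n)"
      using cZ xZ by (intro proj_mult_right sub subring_mult[OF QZ])
    finally show ?thesis .
  qed
  have "series_root_1p R (quot_str (L d) N) r (proj x) k =
      (\<Oplus>\<^bsub>PS\<^esub>n\<in>{..k}. proj (fps_const (?c n) * x ^ n * fps_X ^ n)) k"
    unfolding series_root_1p_def summand ..
  also have "\<dots> = cls (fps_nth (\<Sum>n\<le>k. fps_const (?c n) * x ^ n * fps_X ^ n) k)"
    using mem by (simp add: proj_sum proj_nth)
  also have "fps_nth (\<Sum>n\<le>k. fps_const (?c n) * x ^ n * fps_X ^ n) k =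
      fps_nth (Abs_fps ?c oo (x * fps_X)) k"
    by (simp add: fps_compose_nth fps_sum_nth power_mult_distrib mult.assoc atMost_atLeast0)
  finally show "series_root_1p R (quot_str (L d) N) r (proj x) k = proj (Abs_fps ?c oo (x * fps_X)) k"
    by (simp only: proj_nth[of "_ oo _"])
qed

end

section \<open>Substituting \<open>S X\<close> for \<open>X\<close>\<close>

text \<open>Integer powers of a unit \<open>u\<close> of a ring, with its inverse \<open>v\<close>
  supplied as an argument.\<close>

definition zpow :: "'a::comm_ring_1 \<Rightarrow> 'a \<Rightarrow> int \<Rightarrow> 'a" where
  "zpow u v i = (if 0 \<le> i then u ^ nat i else v ^ nat (- i))"

text \<open>Exponents written as differences of naturals avoid case distinctions on signs; addition
  of exponents becomes a calculation in a commutative ring.\<close>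

lemma zpow_diff:
  assumes "u * v = 1"
  shows "zpow u v (int m - int n) = u ^ m * v ^ n"
proof -
  have *: "u ^ k * v ^ k = 1" for k
    using assms by (simp flip: power_mult_distrib)
  show ?thesis
  proof (cases "n \<le> m")
    case True
    then have "u ^ m = u ^ (m - n) * u ^ n" by (simp flip: power_add)
    then show ?thesis using True * by (simp add: zpow_def nat_diff_distrib mult.assoc)
  next
    case False
    then have "v ^ n = v ^ m * v ^ (n - m)" by (simp flip: power_add)
    then show ?thesis using False * by (simp add: zpow_def nat_diff_distrib flip: mult.assoc)
  qed
qed

lemma int_diff_cases: obtains m n where "(i::int) = int m - int n"
  by (rule that[of "nat i" "nat (- i)"]) simp

lemma zpow_add:
  assumes "u * v = 1"
  shows "zpow u v (i + j) = zpow u v i * zpow u v j"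
proof -
  obtain m n where i: "i = int m - int n" by (rule int_diff_cases)
  obtain k l where j: "j = int k - int l" by (rule int_diff_cases)
  have "i + j = int (m + k) - int (n + l)" by (simp add: i j)
  then have "zpow u v (i + j) = u ^ (m + k) * v ^ (n + l)"
    by (simp only: zpow_diff[OF assms])
  then show ?thesis by (simp add: i j zpow_diff[OF assms] power_add algebra_simps)
qed

locale substitution = skew_laurent_setting \<theta> r for \<theta> :: "'k::field \<Rightarrow> 'k" and r +
  fixes S S' :: "(int \<Rightarrow>\<^sub>0 'k) fps"
  assumes S: "S \<in> fps_over Z" "S' \<in> fps_over Z" "S * S' = 1" "fps_nth S 0 = 1"
begin

text \<open>The substitution of \<open>S X\<close> for \<open>X\<close>. Since \<open>S\<close> is
  central, the power of \<open>S X\<close> with exponent \<open>i\<close> is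
  \<open>S\<^sup>i X\<^sup>i\<close>, where \<open>S'\<close> accounts for negative
  exponents.\<close>

definition \<Phi> where
  "\<Phi> f = (\<Sum>i\<in>keys f. fps_const (single i (lookup f i)) * zpow S S' i)"

lemma zpow_in_Z: "zpow S S' i \<in> fps_over Z"
  using S subring_power[OF is_subring_fps_over[OF is_subring_Z]] by (simp add: zpow_def)

lemma zpow_nth_0: "fps_nth (zpow S S' i) 0 = 1"
proof -
  have "fps_nth (S * S') 0 = 1" using S by simp
  then have "fps_nth S' 0 = 1" using S(4) by (simp add: fps_mult_nth)
  then show ?thesis using S by (simp add: zpow_def fps_power_zeroth_eq_one)
qed

lemma \<Phi>_eq_sum:
  assumes "finite I" "keys f \<subseteq> I"
  shows "\<Phi> f = (\<Sum>i\<in>I. fps_const (single i (lookup f i)) * zpow S S' i)"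
  unfolding \<Phi>_def using assms by (intro sum.mono_neutral_left) (auto simp: in_keys_iff)

lemma \<Phi>_single: "\<Phi> (single i a) = fps_const (single i a) * zpow S S' i"
  by (subst \<Phi>_eq_sum[of "{i}"]) auto

lemma \<Phi>_0 [simp]: "\<Phi> 0 = 0"
  by (simp add: \<Phi>_def)

lemma \<Phi>_add: "\<Phi> (f + g) = \<Phi> f + \<Phi> g"
  unfolding \<Phi>_eq_sum[of "keys f \<union> keys g" "f + g", OF _ keys_add, simplified]
    \<Phi>_eq_sum[of "keys f \<union> keys g" f, simplified] \<Phi>_eq_sum[of "keys f \<union> keys g" g, simplified]
  by (simp add: lookup_add single_add distrib_right sum.distrib flip: fps_const_add)

lemma \<Phi>_1: "\<Phi> 1 = 1"
  using \<Phi>_single[of 0 1] by (simp add: zpow_def)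

lemma \<Phi>_mult: "\<Phi> (skew_mult \<theta> f g) = skew_fps \<theta> (\<Phi> f) (\<Phi> g)"
proof (induction f rule: poly_mapping_additive_induct)
  case (single i)
  show ?case
  proof (induction g rule: poly_mapping_additive_induct)
    case (single j)
    show ?case
      by (simp add: skew_mult_single \<Phi>_single skew_fps_const zpow_in_Z zpow_add[OF S(3)])
  qed (simp_all add: skew_mult_add_right skew_fps_add \<Phi>_add)
qed (simp_all add: skew_mult_add_left skew_fps_add \<Phi>_add)

lemma \<Phi>_nth_0: "fps_nth (\<Phi> f) 0 = f"
  by (simp add: \<Phi>_def fps_sum_nth zpow_nth_0 sum_single_lookup)

lemma \<Phi>_in_lattice_supp:
  assumes "f \<in> lattice_supp d" "d dvd r"
  shows "\<Phi> f \<in> fps_over (lattice_supp d)"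
proof -
  note Q = is_subring_lattice_supp[where d = d and 'k = 'k]
  have "zpow S S' i \<in> fps_over (lattice_supp d)" for i
    using zpow_in_Z fps_over_mono[OF Z_subset_lattice_supp[OF assms(2)]] by blast
  then show ?thesis
    unfolding \<Phi>_def using assms(1)
    by (intro subring_sum[OF is_subring_fps_over[OF Q]] subring_mult[OF is_subring_fps_over[OF Q]]
        fps_const_in_fps_over[OF Q] single_in_lattice_supp) (auto simp: lattice_supp_def)
qed

end

section \<open>The root of \<open>N(V) = T\<close>\<close>

lemma single_power:
  fixes a :: "'k::comm_ring_1"
  shows "single (i::int) a ^ n = single (int n * i) (a ^ n)"
  by (induction n) (simp_all add: mult_single algebra_simps)

lemma of_int_mult_single:
  fixes a :: "'k::comm_ring_1"
  shows "of_int n * single (i::int) a = single i (of_int n * a)"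
  by (simp add: mult_single flip: single_of_int)

lemma pderiv_sum:
  fixes p :: "'b \<Rightarrow> 'a::idom poly"
  shows "pderiv (sum p A) = (\<Sum>i\<in>A. pderiv (p i))"
  by (induction A rule: infinite_finite_induct) (simp_all add: pderiv_add)

locale separable_setting = skew_laurent_setting \<theta> r for \<theta> :: "'k::field \<Rightarrow> 'k" and r +
  fixes N :: "int \<Rightarrow>\<^sub>0 'k"
  assumes N: "N \<in> Z" "separable_Y \<theta> r N" and char: "\<not> CHAR('k) dvd r"
begin

abbreviation "Y \<equiv> single (int r) 1 :: int \<Rightarrow>\<^sub>0 'k"
abbreviation "Y' \<equiv> single (- int r) 1 :: int \<Rightarrow>\<^sub>0 'k"

lemma Y_in_Z: "Y \<in> Z" "Y' \<in> Z"
  using of_int_fixed[of 1] by (auto intro: single_in_Z)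

lemma Y_inverse: "Y' * Y = 1" "Y * Y' = 1"
  by (simp_all add: mult_single)

lemma of_nat_r: "(of_nat r :: 'k) \<noteq> 0"
  using char by (simp add: of_nat_eq_0_iff_char_dvd)

text \<open>
  Multiplying the Laurent polynomial \<open>N\<close> by \<open>Y\<^sup>M\<close> clears the negative exponents, so that
  \<open>N(V) = T\<close> becomes a polynomial equation.
\<close>

definition M :: nat where "M = (\<Sum>i\<in>keys N. nat (- (i div int r)))"

text \<open>The exponent of \<open>Y\<close> in the product of \<open>Y\<^sup>M\<close> with the
  monomial of \<open>N\<close> at \<open>i\<close>.\<close>

definition e :: "int \<Rightarrow> nat" where "e i = nat (i div int r + int M)"

text \<open>The value at a unit \<open>W\<close> is \<open>W\<^sup>M (N(W) - T)\<close>.\<close>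

definition h :: "(int \<Rightarrow>\<^sub>0 'k) fps poly" where
  "h = (\<Sum>i\<in>keys N. monom (fps_const (single 0 (lookup N i))) (e i)) - monom fps_X M"

lemma int_e:
  assumes "i \<in> keys N" shows "int (e i) = i div int r + int M"
proof -
  have "nat (- (i div int r)) \<le> M"
    unfolding M_def using assms by (intro member_le_sum) auto
  then show ?thesis by (simp add: e_def)
qed

lemma dvd_keys: "i \<in> keys N \<Longrightarrow> int r dvd i"
  using N by (simp add: Z_def)

lemma poly_h: "poly h W = (\<Sum>i\<in>keys N. fps_const (single 0 (lookup N i)) * W ^ e i) - fps_X * W ^ M"
  by (simp add: h_def poly_sum poly_monom)

lemma single_Y_power:
  assumes "i \<in> keys N"
  shows "single 0 a * Y ^ e i = single i a * Y ^ M"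
proof -
  have "int (e i) * int r = i + int M * int r"
    using dvd_keys[OF assms] by (simp add: int_e[OF assms] distrib_right)
  then show ?thesis by (simp add: single_power mult_single)
qed

lemma N_Y_power: "N * Y ^ M = (\<Sum>i\<in>keys N. single 0 (lookup N i) * Y ^ e i)"
proof -
  have "N * Y ^ M = (\<Sum>i\<in>keys N. single i (lookup N i)) * Y ^ M"
    by (simp add: sum_single_lookup)
  then show ?thesis by (simp add: sum_distrib_right single_Y_power)
qed

lemma fps_const_in_Z: "a \<in> Z \<Longrightarrow> fps_const a \<in> fps_over Z"
  using is_subring_Z by (rule fps_const_in_fps_over)

lemmas QZ = is_subring_fps_over[OF is_subring_Z]

lemma single_0_lookup_in_Z: "single 0 (lookup N i) \<in> Z"
  using N(1) by (intro single_in_Z) (simp_all add: Z_iff)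

lemma coeff_h: "coeff h i \<in> fps_over Z"
  unfolding h_def coeff_diff coeff_sum coeff_monom
  using fps_X_in_fps_over[OF is_subring_Z] fps_const_in_Z[OF single_0_lookup_in_Z] subring_0[OF QZ]
  by (intro subring_diff[OF QZ] subring_sum[OF QZ]) auto

text \<open>The product rule for \<open>Y d/dY\<close> on \<open>Y\<^sup>M N\<close>, with the
  factor \<open>Y\<^sup>M\<close> cancelled.\<close>

lemma Y_deriv_N:
  "Y * deriv_Y r N + of_nat M * N = (\<Sum>i\<in>keys N. of_nat (e i) * single i (lookup N i))"
proof -
  have "Y * deriv_Y r N = (\<Sum>i\<in>keys N. of_int (i div int r) * single i (lookup N i))"
    by (simp add: deriv_Y_def sum_distrib_left mult_single of_int_mult_single)
  moreover have "of_nat M * N = (\<Sum>i\<in>keys N. of_nat M * single i (lookup N i))"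
    by (simp add: sum_single_lookup flip: sum_distrib_left)
  moreover have "(of_nat (e i) :: int \<Rightarrow>\<^sub>0 'k) = of_int (i div int r) + of_nat M" if "i \<in> keys N" for i
    using int_e[OF that] by (metis of_int_add of_int_of_nat_eq)
  ultimately show ?thesis by (simp add: distrib_right sum.distrib)
qed

text \<open>Modulo \<open>T\<close> this is the derivative of \<open>Y\<^sup>M N\<close>; the term
  of \<open>h\<close> with \<open>T\<close> does not contribute. Modulo \<open>N\<close> only
  \<open>Y\<^sup>M N'\<close> is left.\<close>

lemma poly_h'_nth_0:
  assumes "fps_nth W 0 = Y"
  shows "fps_nth (poly (pderiv h) W) 0 = Y ^ M * deriv_Y r N + Y' * Y ^ M * of_nat M * N"
proof -
  let ?h' = "fps_nth (poly (pderiv h) W) 0"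
  have "?h' = (\<Sum>i\<in>keys N. of_nat (e i) * single 0 (lookup N i) * Y ^ (e i - 1))"
    by (simp add: h_def pderiv_diff pderiv_sum pderiv_monom poly_sum poly_monom fps_sum_nth
        fps_power_zeroth assms mult.assoc flip: fps_of_nat)
  \<comment> \<open>The factor \<open>Y\<close> undoes the truncated subtraction in the exponent;
    for \<open>e i = 0\<close> the integer coefficient is zero.\<close>
  then have "Y * ?h' = (\<Sum>i\<in>keys N. of_nat (e i) * single 0 (lookup N i) * (Y * Y ^ (e i - 1)))"
    by (simp add: sum_distrib_left mult_ac)
  also have "\<dots> = (\<Sum>i\<in>keys N. of_nat (e i) * (single 0 (lookup N i) * Y ^ e i))"
  proof (intro sum.cong refl)
    fix i show "of_nat (e i) * single 0 (lookup N i) * (Y * Y ^ (e i - 1)) =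
        of_nat (e i) * (single 0 (lookup N i) * Y ^ e i)"
      by (cases "e i") (simp_all add: mult.assoc)
  qed
  also have "\<dots> = (Y * deriv_Y r N + of_nat M * N) * Y ^ M"
    unfolding Y_deriv_N by (simp add: single_Y_power sum_distrib_right mult.assoc)
  finally have "Y' * (Y * ?h') = Y' * ((Y * deriv_Y r N + of_nat M * N) * Y ^ M)" by simp
  then have "Y' * Y * ?h' = Y' * Y * (Y ^ M * deriv_Y r N) + Y' * Y ^ M * of_nat M * N"
    by (simp only: distrib_left distrib_right mult_ac)
  then show ?thesis by (simp only: Y_inverse mult_1)
qed

text \<open>If \<open>a N + b N' = 1\<close>, then \<open>b\<close> inverts \<open>N'\<close> modulo
  \<open>N\<close>, so \<open>b Y\<^sup>-\<^sup>M\<close> inverts \<open>Y\<^sup>M N'\<close>. Only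
  the constant coefficient of \<open>W\<close> enters, hence one \<open>u\<close> serves all
  \<open>W\<close>.\<close>

lemma poly_h'_unit:
  obtains u where "u \<in> fps_over Z"
    "\<And>W. fps_nth W 0 = Y \<Longrightarrow> vanishing N 1 (u * poly (pderiv h) W - 1)"
proof -
  obtain a b where ab: "a \<in> Z" "b \<in> Z" "a * N + b * deriv_Y r N = 1"
    using N by (rule separable_bezout)
  have YM: "Y' ^ M * Y ^ M = 1"
    by (simp add: Y_inverse flip: power_mult_distrib)
  have "vanishing N 1 (fps_const (b * Y' ^ M) * poly (pderiv h) W - 1)" if "fps_nth W 0 = Y" for W
  proof -
    have "b * Y' ^ M * (Y ^ M * deriv_Y r N + Y' * Y ^ M * of_nat M * N) - 1 =
        (Y' ^ M * Y ^ M) * (b * deriv_Y r N + N * (b * Y' * of_nat M)) - 1"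
      by (simp only: distrib_left mult_ac)
    also have "\<dots> = b * deriv_Y r N - 1 + N * (b * Y' * of_nat M)"
      by (simp add: YM)
    also have "b * deriv_Y r N - 1 = - (a * N)"
      using ab(3) by (simp add: algebra_simps)
    also have "- (a * N) + N * (b * Y' * of_nat M) = N * (b * Y' * of_nat M - a)"
      by (simp add: algebra_simps)
    finally show ?thesis
      by (simp add: vanishing_def poly_h'_nth_0[OF that])
  qed
  moreover have "fps_const (b * Y' ^ M) \<in> fps_over Z"
    using ab Y_in_Z by (intro fps_const_in_Z subring_mult[OF is_subring_Z] subring_power[OF is_subring_Z])
  ultimately show thesis by (rule that[rotated])
qed

lemma root_exists:
  obtains V where "V \<in> fps_over Z" "fps_nth V 0 = Y" "\<And>m. vanishing N m (poly h V)"
proof -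
  obtain u where u: "u \<in> fps_over Z"
      "\<And>W. fps_nth W 0 = Y \<Longrightarrow> vanishing N 1 (u * poly (pderiv h) W - 1)"
    using poly_h'_unit by blast
  have "fps_nth (poly h (fps_const Y)) 0 = N * Y ^ M"
    by (simp add: poly_h fps_sum_nth fps_power_zeroth N_Y_power)
  then have "vanishing N 1 (poly h (fps_const Y))" by (simp add: vanishing_def)
  then show thesis
    using newton_root_exists[OF is_subring_Z, of h N "fps_const Y" u] coeff_h u
      fps_const_in_Z[OF Y_in_Z(1)] that by auto
qed

end

section \<open>The \<open>r\<close>-th root \<open>S\<close> of \<open>V/Y\<close> and its
  substitution\<close>

locale canonical_root = separable_setting \<theta> r N
  for \<theta> :: "'k::field \<Rightarrow> 'k" and r and N :: "int \<Rightarrow>\<^sub>0 'k" +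
  fixes V :: "(int \<Rightarrow>\<^sub>0 'k) fps"
  assumes V: "V \<in> fps_over Z" "fps_nth V 0 = Y" "\<And>m. vanishing N m (poly h V)"
begin

lemma root_unique:
  assumes "\<And>m. vanishing N m (poly h W)" "N dvd fps_nth W 0 - Y"
  shows "vanishing N m (W - V)"
proof -
  obtain u where "\<And>W. fps_nth W 0 = Y \<Longrightarrow> vanishing N 1 (u * poly (pderiv h) W - 1)"
    using poly_h'_unit by blast
  then have "vanishing N 1 (u * poly (pderiv h) V - 1)" using V(2) .
  moreover have "vanishing N 1 (W - V)" using assms(2) by (simp add: vanishing_def V(2))
  ultimately show ?thesis using assms(1) V(3) newton_root_unique by blast
qed

definition x where "x = fps_shift 1 (fps_const Y' * V)"

definition c :: "nat \<Rightarrow> (int \<Rightarrow>\<^sub>0 'k)" where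
  "c = (\<lambda>n. single 0 (rat_to_field ((1 / of_nat r) gchoose n)))"

definition S where "S = Abs_fps c oo (x * fps_X)"

definition S' where "S' = fps_right_inverse S 1"

lemma x_in_Z: "x \<in> fps_over Z"
  using subring_mult[OF QZ fps_const_in_Z[OF Y_in_Z(2)] V(1)] by (simp add: x_def fps_over_def)

lemma x_eq: "1 + x * fps_X = fps_const Y' * V"
proof (rule fps_ext)
  fix n show "fps_nth (1 + x * fps_X) n = fps_nth (fps_const Y' * V) n"
    by (cases n) (simp_all add: x_def V(2) Y_inverse)
qed

text \<open>Quotients of integers lie in the prime field, which is fixed by every
  automorphism.\<close>

lemma c_in_Z: "c n \<in> Z"
proof -
  have "of_int a / of_int b \<in> fixed_field \<theta>" for a b :: int
  proof (cases "of_int b = (0 :: 'k)")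
    case False
    have "\<theta> (of_int a / of_int b) * \<theta> (of_int b) = \<theta> (of_int a)"
      using False by (simp flip: \<theta>_hom(2))
    then show ?thesis
      using False of_int_fixed[of a] of_int_fixed[of b] by (simp add: fixed_field_def field_simps)
  qed (simp add: fixed_field_def \<theta>_hom)
  then show ?thesis unfolding c_def rat_to_field_def by (simp add: single_in_Z)
qed

lemma S_in_Z: "S \<in> fps_over Z"
proof -
  have "(x * fps_X) ^ i \<in> fps_over Z" for i
    using x_in_Z fps_X_in_fps_over[OF is_subring_Z] subring_mult[OF QZ] subring_power[OF QZ] by blast
  then show ?thesis
    using c_in_Z by (auto simp: S_def fps_over_def fps_compose_nth
        intro!: subring_sum[OF is_subring_Z] subring_mult[OF is_subring_Z])
qed

lemma S_nth_0: "fps_nth S 0 = 1"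
  using rat_to_field_of_int[where 'k = 'k, of 1] by (simp add: S_def c_def)

text \<open>An exact identity of representatives, not just one modulo \<open>N\<close>.\<close>

lemma S_power: "S ^ r = fps_const Y' * V"
  unfolding S_def c_def x_eq[symmetric] using of_nat_r
  by (rule fps_root_power) (simp_all add: single_add mult_single)

lemma S_S': "S * S' = 1"
  unfolding S'_def by (rule fps_right_inverse) (simp add: S_nth_0)

lemma S'_in_Z: "S' \<in> fps_over Z"
  unfolding S'_def using is_subring_Z S_in_Z subring_1[OF is_subring_Z]
  by (rule fps_right_inverse_in_fps_over)

sublocale substitution \<theta> r S S'
  by unfold_locales (fact S_in_Z S'_in_Z S_S' S_nth_0)+

lemma V_eq: "V = fps_const Y * S ^ r"
  by (simp only: S_power mult.assoc[symmetric] fps_const_mult Y_inverse fps_const_1_eq_1 mult_1)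

text \<open>The substitution sends \<open>Y\<close> to \<open>S\<^sup>r Y = V\<close>, so
  \<open>\<Phi> N\<close> is \<open>N(V)\<close>, and \<open>V\<^sup>M (\<Phi> N - T)\<close> is the
  value of \<open>h\<close> at \<open>V\<close>. As \<open>V\<close> is a unit with inverse
  \<open>V'\<close>, the factor \<open>V\<^sup>M\<close> can be removed.\<close>

lemma \<Phi>_N: "vanishing N m (\<Phi> N - fps_X)"
proof -
  define V' where "V' = fps_const Y' * S' ^ r"
  have "V * V' = (fps_const Y * S ^ r) * (fps_const Y' * S' ^ r)"
    by (simp only: V_eq[symmetric] V'_def)
  also have "\<dots> = fps_const Y * fps_const Y' * (S * S') ^ r"
    by (simp only: power_mult_distrib mult_ac)
  finally have VV': "V * V' = 1" by (simp add: S_S' Y_inverse)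
  have *: "fps_const (single i a) * zpow S S' i * V ^ M = fps_const (single 0 a) * V ^ e i"
    if i: "i \<in> keys N" for i a
  proof -
    obtain j where j: "i = int r * j" using dvd_keys[OF i] by auto
    obtain m n where mn: "j = int m - int n" by (rule int_diff_cases)
    have "i = int (r * m) - int (r * n)" by (simp add: j mn algebra_simps)
    then have "zpow S S' i = S ^ (r * m) * S' ^ (r * n)" by (simp only: zpow_diff[OF S_S'])
    moreover have "single i a = single 0 a * Y ^ m * Y' ^ n"
      by (simp add: single_power mult_single j mn algebra_simps)
    moreover have "V ^ m = fps_const (Y ^ m) * S ^ (r * m)"
      using arg_cong[OF V_eq, of "\<lambda>v. v ^ m"] by (simp only: power_mult power_mult_distrib fps_const_power)
    moreover have "V' ^ n = fps_const (Y' ^ n) * S' ^ (r * n)"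
      by (simp only: V'_def power_mult power_mult_distrib fps_const_power)
    ultimately have "fps_const (single i a) * zpow S S' i = fps_const (single 0 a) * (V ^ m * V' ^ n)"
      by (simp only: fps_const_mult[symmetric] mult_ac)
    also have "V ^ m * V' ^ n = zpow V V' j"
      by (simp add: mn zpow_diff[OF VV'])
    finally have "fps_const (single i a) * zpow S S' i * V ^ M =
        fps_const (single 0 a) * (zpow V V' j * zpow V V' (int M))"
      by (simp add: zpow_def[of V V' "int M"] mult.assoc)
    also have "zpow V V' j * zpow V V' (int M) = zpow V V' (int (e i))"
    proof -
      have "int (e i) = j + int M" using int_e[OF i] r_pos by (simp add: j)
      then show ?thesis by (simp only: zpow_add[OF VV'])
    qed
    finally show ?thesis by (simp add: zpow_def)
  qed
  have "\<Phi> N * V ^ M - fps_X * V ^ M = poly h V"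
    by (simp add: \<Phi>_def poly_h sum_distrib_right *)
  then have "V' ^ M * poly h V = (\<Phi> N - fps_X) * (V * V') ^ M"
    by (simp add: power_mult_distrib algebra_simps flip: \<open>_ = poly h V\<close>)
  then show ?thesis
    using V(3)[of m] vanishing_mult_left by (metis VV' mult.right_neutral power_one)
qed

end

section \<open>Homomorphisms out of skew Laurent polynomials\<close>

context skew_laurent_setting
begin

text \<open>The constants, \<open>X\<^sup>d\<close> and its inverse generate the ring. Inverses in
  \<open>B\<close> are unique, so the value at \<open>X\<^sup>d\<close> also determines the values
  at negative powers.\<close>

lemma hom_eqI:
  assumes B: "ring B" and d: "0 < d"
    and f: "f \<in> ring_hom (L d) B" and g: "g \<in> ring_hom (L d) B"
    and const: "\<And>a. f (single 0 a) = g (single 0 a)"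
    and X: "f (single (int d) 1) = g (single (int d) 1)"
    and a: "a \<in> lattice_supp d"
  shows "f a = g a"
proof -
  interpret B: ring B by fact
  let ?X = "\<lambda>j. single (int d * j) 1 :: int \<Rightarrow>\<^sub>0 'k"
  note sl = single_in_lattice_supp
  have mult: "F (skew_mult \<theta> u v) = F u \<otimes>\<^bsub>B\<^esub> F v"
    if "F \<in> ring_hom (L d) B" "u \<in> lattice_supp d" "v \<in> lattice_supp d" for F u v
    using ring_hom_mult[OF that(1)] that by simp
  have closed: "F u \<in> carrier B" if "F \<in> ring_hom (L d) B" "u \<in> lattice_supp d" for F u
    using ring_hom_closed[OF that(1)] that by simp
  have X_add: "F (?X (i + j)) = F (?X i) \<otimes>\<^bsub>B\<^esub> F (?X j)" if "F \<in> ring_hom (L d) B" for F i j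
    using mult[OF that sl[of d "int d * i"] sl[of d "int d * j"], of 1 1]
    by (simp add: skew_mult_single aut_pow_hom distrib_left)
  have X_0: "F (?X 0) = \<one>\<^bsub>B\<^esub>" if "F \<in> ring_hom (L d) B" for F
    using ring_hom_one[OF that] by simp
  have pos: "f (?X (int n)) = g (?X (int n))" for n
  proof (induction n)
    case (Suc n)
    have "int (Suc n) = int n + 1" by simp
    then show ?case using Suc X by (simp only: X_add[OF f] X_add[OF g] mult_1_right)
  qed (simp only: of_nat_0 X_0[OF f] X_0[OF g])
  have XX: "f (?X j) = g (?X j)" for j
  proof (cases "0 \<le> j")
    case True
    then show ?thesis using pos[of "nat j"] by simp
  next
    case False
    then have eq: "f (?X (- j)) = g (?X (- j))" using pos[of "nat (- j)"] by simp
    have cl: "F (?X k) \<in> carrier B" if "F \<in> ring_hom (L d) B" for F k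
      using closed[OF that sl[of d "int d * k" 1]] by simp
    \<comment> \<open>A left inverse and a right inverse of the common value at the positive power
      coincide.\<close>
    have "f (?X j) = f (?X j) \<otimes>\<^bsub>B\<^esub> (g (?X (- j)) \<otimes>\<^bsub>B\<^esub> g (?X j))"
      using cl[OF f, of j] X_add[OF g, of "- j" j] X_0[OF g] by simp
    also have "\<dots> = f (?X j) \<otimes>\<^bsub>B\<^esub> f (?X (- j)) \<otimes>\<^bsub>B\<^esub> g (?X j)"
      unfolding eq using B.m_assoc[OF cl[OF f, of j] cl[OF g, of "- j"] cl[OF g, of j]] by simp
    also have "\<dots> = g (?X j)"
      using cl[OF g, of j] X_add[OF f, of j "- j"] X_0[OF f] by simp
    finally show ?thesis .
  qed
  have mono: "f (single i b) = g (single i b)" if "int d dvd i" for i b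
  proof -
    obtain j where j: "i = int d * j" using \<open>int d dvd i\<close> by (rule dvdE)
    have "single i b = skew_mult \<theta> (single 0 b) (?X j)"
      by (simp add: skew_mult_single j)
    then show ?thesis
      using mult[OF f sl[of d 0] sl[of d "int d * j"], of b 1]
        mult[OF g sl[of d 0] sl[of d "int d * j"], of b 1] const XX
      by simp
  qed
  have "f (\<Sum>i\<in>I. single i (lookup a i)) = g (\<Sum>i\<in>I. single i (lookup a i))"
    if "finite I" "I \<subseteq> keys a" for I
    using that
  proof (induction I rule: finite_induct)
    case empty
    then show ?case
      using ring_hom_zero[OF f ring_L B] ring_hom_zero[OF g ring_L B] by simp
  next
    case (insert i I)
    then have "int d dvd j" if "j \<in> insert i I" for j
      using a that by (auto simp: lattice_supp_def)
    then have "single i (lookup a i) \<in> lattice_supp d" "(\<Sum>i\<in>I. single i (lookup a i)) \<in> lattice_supp d"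
      "f (single i (lookup a i)) = g (single i (lookup a i))"
      by (auto intro!: sl lattice_supp_sum mono)
    then show ?case
      using insert ring_hom_add[OF f] ring_hom_add[OF g] by simp
  qed
  from this[of "keys a"] show ?thesis by (simp add: sum_single_lookup)
qed

end

section \<open>The extension of the substitution to a completion, and its rivals\<close>

locale canonical_level = canonical_root \<theta> r N V + central_level \<theta> r N d
  for \<theta> :: "'k::field \<Rightarrow> 'k" and r and N :: "int \<Rightarrow>\<^sub>0 'k" and V and d
begin

definition \<phi> where "\<phi> f = proj (\<Phi> f)"

lemma \<Phi>_in_level: "f \<in> lattice_supp d \<Longrightarrow> \<Phi> f \<in> fps_over (lattice_supp d)"
  by (rule \<Phi>_in_lattice_supp[OF _ d_dvd])

lemma \<phi>_hom: "\<phi> \<in> ring_hom (L d) PS"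
proof (rule ring_hom_memI)
  fix f g assume f: "f \<in> carrier (L d)" and g: "g \<in> carrier (L d)"
  then have mem: "\<Phi> f \<in> fps_over (lattice_supp d)" "\<Phi> g \<in> fps_over (lattice_supp d)"
    by (simp_all add: \<Phi>_in_level)
  then show "\<phi> f \<in> carrier PS" unfolding \<phi>_def by (intro proj_closed)
  show "\<phi> (f \<otimes>\<^bsub>L d\<^esub> g) = \<phi> f \<otimes>\<^bsub>PS\<^esub> \<phi> g"
    using mem by (simp add: \<phi>_def \<Phi>_mult proj_skew)
  show "\<phi> (f \<oplus>\<^bsub>L d\<^esub> g) = \<phi> f \<oplus>\<^bsub>PS\<^esub> \<phi> g"
    unfolding \<phi>_def proj_add[OF mem] by (simp add: \<Phi>_add)
qed (simp add: \<phi>_def \<Phi>_1 proj_1)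

lemma \<phi>_const: "\<phi> (single 0 a) = proj (fps_const (single 0 a))"
  by (simp add: \<phi>_def \<Phi>_single zpow_def)

sublocale lift: series_lift "L d" N \<phi>
proof (rule series_lift.intro[OF D.central_element_axioms], rule series_lift_axioms.intro)
  show "\<phi> \<in> ring_hom (L d) PS" by (rule \<phi>_hom)
  have "N \<in> lattice_supp d" using N_Z Z_subset by blast
  then have "\<phi> N = proj fps_X"
    unfolding \<phi>_def using \<Phi>_N fps_X_in_fps_over[OF is_subring_lattice_supp]
    by (subst proj_eq_iff) (auto intro: \<Phi>_in_level)
  then show "\<phi> N = series_T R" by (simp add: proj_X)
  show "\<phi> a 0 = cls a" for a by (simp add: \<phi>_def proj_nth \<Phi>_nth_0)
qed

lemma ext_normalized: "normalized_iso (L d) N lift.ext"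
proof -
  have "lift.ext \<in> extensional (carrier (completion (L d) N))" by (simp add: lift.ext_def)
  moreover have "lift.ext (completion_str (L d) N a) = series_str (L d) N a" for a
    using single_in_lattice_supp[of d 0 a]
    by (simp add: completion_str_def series_str_def quot_str_def lift.ext_to_completion \<phi>_const
        proj_const)
  moreover have "lift.ext (to_completion (L d) N N) = series_T R"
    using lift.ext_to_completion[OF D.N_closed] lift.\<phi>_N by simp
  ultimately show ?thesis
    using lift.ext_hom lift.ext_bij lift.ext_nth_0
    by (simp add: normalized_iso_def alg_iso_def alg_hom_def del: series_ring_simps)
qed

text \<open>Agreement at \<open>X\<^sup>d\<close> gives agreement on all of \<open>L d\<close>. In
  particular \<open>N\<close> goes to \<open>T\<close>, and this is what allows
  \<open>ext_unique\<close> to control the rest of the completion.\<close>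

lemma alg_hom_eq_ext:
  assumes d: "0 < d"
    and \<tau>: "\<tau> \<in> alg_hom (completion (L d) N) (completion_str (L d) N) PS (series_str (L d) N)"
    and X: "\<tau> (to_completion (L d) N (single (int d) 1)) = \<phi> (single (int d) 1)"
  shows "\<tau> = lift.ext"
proof (rule lift.ext_unique)
  show hom: "\<tau> \<in> ring_hom (completion (L d) N) PS" "\<tau> \<in> extensional (carrier (completion (L d) N))"
    using \<tau> by (simp_all add: alg_hom_def)
  have "(\<lambda>a. \<tau> (to_completion (L d) N a)) \<in> ring_hom (L d) PS"
    using ring_hom_trans[OF D.to_completion_hom hom(1)] by (simp add: comp_def)
  moreover have "\<tau> (to_completion (L d) N (single 0 a)) = \<phi> (single 0 a)" for a
    using \<tau> by (simp add: alg_hom_def completion_str_def series_str_def quot_str_def \<phi>_const proj_const)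
  ultimately show "\<tau> (to_completion (L d) N a) = \<phi> a" if "a \<in> carrier (L d)" for a
    using hom_eqI[OF D.ring_S d _ \<phi>_hom, of "\<lambda>a. \<tau> (to_completion (L d) N a)" a] X that by simp
qed

text \<open>Applying \<open>\<tau>\<close> to the polynomial identity for \<open>N Y\<^sup>M\<close>
  shows that \<open>W\<close> is a root of \<open>h\<close> modulo \<open>N\<close>. The
  coefficients of \<open>W\<close> lie in \<open>K[Y\<^sup>\<plusminus>\<^sup>1]\<close>, so its
  powers can be computed with the ordinary product. At level \<open>r\<close> this pins down
  \<open>tau_C\<close>; at level 1 it serves the uniqueness of \<open>tau_can\<close>.\<close>

lemma normalized_root_unique:
  assumes \<tau>: "normalized_iso (L d) N \<tau>"
    and W: "W \<in> fps_over (lattice_supp r)" "\<tau> (to_completion (L d) N Y) = proj W"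
  shows "vanishing N m (W - V)"
proof -
  define \<psi> where "\<psi> = (\<lambda>a. \<tau> (to_completion (L d) N a))"
  note Qd = is_subring_lattice_supp[where d = d and 'k = 'k]
  note QFr = is_subring_fps_over[OF is_subring_lattice_supp[where d = r and 'k = 'k]]
  note r_d = subsetD[OF fps_over_mono[OF lattice_supp_r_subset]]
  have \<tau>_hom: "\<tau> \<in> ring_hom (completion (L d) N) PS"
    using \<tau> by (simp add: normalized_iso_def alg_iso_def alg_hom_def)
  have hom: "\<psi> \<in> ring_hom (L d) PS"
    using ring_hom_trans[OF D.to_completion_hom \<tau>_hom] by (simp add: comp_def \<psi>_def)
  have const: "\<psi> (single 0 a) = proj (fps_const (single 0 a))" for a
    using \<tau> by (simp add: \<psi>_def normalized_iso_def alg_iso_def alg_hom_def completion_str_def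
        series_str_def quot_str_def proj_const)
  have \<psi>_N: "\<psi> N = proj fps_X"
    using \<tau> by (simp add: \<psi>_def normalized_iso_def proj_X)
  have \<psi>_0: "\<psi> a 0 = cls a" if "a \<in> lattice_supp d" for a
    using \<tau> that by (simp add: \<psi>_def normalized_iso_def D.to_completion_nth quot_class_def)
  have \<psi>_mult: "\<psi> (a * b) = \<psi> a \<otimes>\<^bsub>PS\<^esub> \<psi> b" if "a \<in> lattice_supp d" "b \<in> Z" for a b
    using ring_hom_mult[OF hom, of a b] that subsetD[OF Z_subset that(2)] by (simp add: skew_mult_eq_mult_right)
  have YZ: "Y ^ n \<in> Z" for n using Y_in_Z(1) is_subring_Z by (intro subring_power)
  have Yd: "Y ^ n \<in> lattice_supp d" for n using YZ Z_subset by blast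
  have Wn: "W ^ n \<in> fps_over (lattice_supp r)" for n using QFr W(1) by (rule subring_power)
  have \<psi>_Y: "\<psi> (Y ^ n) = proj (W ^ n)" for n
  proof (induction n)
    case 0
    show ?case using ring_hom_one[OF hom] by (simp add: proj_1)
  next
    case (Suc n)
    have "\<psi> (Y ^ n * Y) = proj (W ^ n) \<otimes>\<^bsub>PS\<^esub> proj W"
      using \<psi>_mult[OF Yd Y_in_Z(1)] Suc W(2) by (simp add: \<psi>_def)
    also have "\<dots> = proj (W ^ n * W)"
      using Wn W(1) r_d by (intro proj_mult_left)
    finally show ?case by (simp only: power_Suc2)
  qed
  have single_0: "single 0 a \<in> lattice_supp e" for a :: 'k and e by (simp add: single_in_lattice_supp)
  have cr: "fps_const (single 0 a) \<in> fps_over (lattice_supp r)" for a :: 'k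
    by (rule fps_const_in_fps_over[OF is_subring_lattice_supp single_0])
  have monomial: "\<psi> (single 0 a * Y ^ n) = proj (fps_const (single 0 a) * W ^ n)" for a n
    using \<psi>_mult[OF single_0 YZ] cr Wn r_d by (simp add: const \<psi>_Y proj_mult_left)
  have sum: "\<psi> (\<Sum>i\<in>I. single 0 (f i) * Y ^ k i) = proj (\<Sum>i\<in>I. fps_const (single 0 (f i)) * W ^ k i)"
    if "finite I" for I and f :: "int \<Rightarrow> 'k" and k
    using that
  proof (induction I rule: finite_induct)
    case empty
    show ?case
      using ring_hom_zero[OF hom ring_L D.ring_S] by (simp add: proj_def cls_hom)
  next
    case (insert i I)
    have 1: "single 0 (f i) * Y ^ k i \<in> lattice_supp d" "(\<Sum>i\<in>I. single 0 (f i) * Y ^ k i) \<in> lattice_supp d"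
      using single_0 Yd by (auto intro!: subring_mult[OF Qd] subring_sum[OF Qd])
    have 2: "fps_const (single 0 (f i)) * W ^ k i \<in> fps_over (lattice_supp d)"
      "(\<Sum>i\<in>I. fps_const (single 0 (f i)) * W ^ k i) \<in> fps_over (lattice_supp d)"
      using cr Wn by (auto intro!: r_d subring_mult[OF QFr] subring_sum[OF QFr])
    have "\<psi> (single 0 (f i) * Y ^ k i + (\<Sum>i\<in>I. single 0 (f i) * Y ^ k i)) =
        \<psi> (single 0 (f i) * Y ^ k i) \<oplus>\<^bsub>PS\<^esub> \<psi> (\<Sum>i\<in>I. single 0 (f i) * Y ^ k i)"
      using ring_hom_add[OF hom] 1 by simp
    also have "\<dots> = proj (fps_const (single 0 (f i)) * W ^ k i + (\<Sum>i\<in>I. fps_const (single 0 (f i)) * W ^ k i))"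
      unfolding monomial insert.IH using 2 by (rule proj_add)
    finally show ?case using insert.hyps by simp
  qed
  \<comment> \<open>The same value is computed as a sum of monomials in \<open>W\<close> and as the
    product of \<open>T\<close> with the power of \<open>W\<close>; the difference is
    \<open>poly h W\<close>.\<close>
  have "proj (\<Sum>i\<in>keys N. fps_const (single 0 (lookup N i)) * W ^ e i) = \<psi> (N * Y ^ M)"
    unfolding N_Y_power by (rule sum[symmetric]) simp
  also have "\<dots> = proj fps_X \<otimes>\<^bsub>PS\<^esub> proj (W ^ M)"
    using \<psi>_mult[of N "Y ^ M"] YZ N_Z Z_subset by (auto simp: \<psi>_N \<psi>_Y)
  also have "\<dots> = proj (fps_X * W ^ M)"
    by (rule proj_mult_left[OF fps_X_in_fps_over[OF is_subring_lattice_supp] r_d[OF Wn]])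
  finally have "vanishing N m (poly h W)" for m
    unfolding poly_h using fps_X_in_fps_over[OF is_subring_lattice_supp[where d = r]] Wn cr
    by (subst (asm) proj_eq_iff)
      (auto intro!: r_d subring_mult[OF QFr] subring_sum[OF QFr])
  moreover have "N dvd fps_nth W 0 - Y"
  proof -
    have "cls (fps_nth W 0) = cls Y"
      using \<psi>_0[of Y] Yd[of 1] W(2) by (simp add: \<psi>_def proj_nth)
    moreover have "fps_nth W 0 \<in> lattice_supp d" using r_d[OF W(1)] by (simp add: fps_over_def)
    ultimately show ?thesis using Yd[of 1] by (simp add: cls_eq_iff)
  qed
  ultimately show ?thesis by (rule root_unique)
qed

end

lemma (in canonical_root) \<Phi>_Y: "\<Phi> Y = V"
  using V_eq by (simp add: \<Phi>_single zpow_def)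

lemma (in canonical_root) \<Phi>_X: "\<Phi> (single 1 1) = S * fps_const (single 1 1)"
  by (simp add: \<Phi>_single zpow_def mult.commute)

section \<open>Cosets in subrings and in the full skew ring\<close>

context skew_laurent_setting
begin

lemma pow_ideal_eq:
  assumes "N \<in> Z"
  shows "pow_ideal (skew_laurent \<theta> \<lparr>carrier := Q\<rparr>) N 1 = (\<lambda>f. N * f) ` Q"
proof -
  have "N [^]\<^bsub>skew_laurent \<theta> \<lparr>carrier := Q\<rparr>\<^esub> (1::nat) = N"
    using assms by (simp add: nat_pow_def skew_laurent_def skew_mult_eq_mult_right)
  then show ?thesis
    using assms unfolding pow_ideal_def l_coset_def
    by (auto simp: skew_laurent_def skew_mult_eq_mult_left)
qed

lemma quot_class_eq:
  assumes "N \<in> Z"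
  shows "quot_class (skew_laurent \<theta> \<lparr>carrier := Q\<rparr>) N a = (\<lambda>f. N * f + a) ` Q"
  unfolding quot_class_def a_r_coset_def' pow_ideal_eq[OF assms] by (auto simp: skew_laurent_def)

text \<open>Adding all multiples of \<open>N\<close> absorbs the multiples with cofactor in
  \<open>Q\<close>, so the map induced by the inclusion keeps the representative. The set
  \<open>Q\<close> is arbitrary to cover both \<open>K[Y\<^sup>\<plusminus>\<^sup>1]\<close> and the
  centre.\<close>

lemma coset_map_quot_class:
  assumes "N \<in> Z" "0 \<in> Q"
  shows "coset_map (skew_laurent \<theta>) (pow_ideal (skew_laurent \<theta>) N 1)
      (quot_class (skew_laurent \<theta> \<lparr>carrier := Q\<rparr>) N a) = quot_class (skew_laurent \<theta>) N a"
proof -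
  have A: "skew_laurent \<theta> \<lparr>carrier := UNIV\<rparr> = skew_laurent \<theta>" by (simp add: skew_laurent_def)
  have "coset_map (skew_laurent \<theta>) (pow_ideal (skew_laurent \<theta>) N 1)
      (quot_class (skew_laurent \<theta> \<lparr>carrier := Q\<rparr>) N a) = {N * f + a + N * g | f g. f \<in> Q}"
    unfolding coset_map_def set_add_def' quot_class_eq[OF assms(1)]
      pow_ideal_eq[OF assms(1), of UNIV, unfolded A]
    by (auto simp: skew_laurent_def)
  also have "\<dots> = range (\<lambda>f. N * f + a)"
  proof (intro equalityI subsetI)
    fix y assume "y \<in> {N * f + a + N * g | f g. f \<in> Q}"
    then obtain f g where "y = N * f + a + N * g" by auto
    then have "y = N * (f + g) + a" by (simp add: algebra_simps)
    then show "y \<in> range (\<lambda>f. N * f + a)" by blast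
  next
    fix y assume "y \<in> range (\<lambda>f. N * f + a)"
    then obtain g where "y = N * 0 + a + N * g" by (auto simp: algebra_simps)
    then show "y \<in> {N * f + a + N * g | f g. f \<in> Q}" using assms(2) by blast
  qed
  also have "\<dots> = quot_class (skew_laurent \<theta>) N a"
    using quot_class_eq[OF assms(1), of UNIV a] by (simp add: A)
  finally show ?thesis .
qed

end

section \<open>Identification of the two canonical isomorphisms\<close>

context canonical_root
begin

interpretation A: canonical_level \<theta> r N V "Suc 0"
  by unfold_locales (use N(1) in auto)

interpretation C: canonical_level \<theta> r N V r
  by unfold_locales (use N(1) in auto)

lemmas A_eq = L_1[symmetric]

text \<open>At level \<open>r\<close> every series has coefficients in
  \<open>K[Y\<^sup>\<plusminus>\<^sup>1]\<close>, so the image of \<open>Y\<close> under any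
  competitor is a root and equals \<open>V\<close> modulo \<open>N\<close>. As \<open>Y\<close> is
  the generator at this level, the competitor is the extension.\<close>

lemma tau_C_eq: "tau_C \<theta> r N = C.lift.ext"
  unfolding tau_C_def L_r[symmetric]
proof (rule the_equality)
  show "normalized_iso (L r) N C.lift.ext" by (rule C.ext_normalized)
  fix \<tau> assume \<tau>: "normalized_iso (L r) N \<tau>"
  then have hom: "\<tau> \<in> alg_hom (completion (L r) N) (completion_str (L r) N) C.PS (series_str (L r) N)"
    by (simp add: normalized_iso_def alg_iso_def)
  have Y: "Y \<in> carrier (L r)" by (simp add: single_in_lattice_supp)
  have "\<tau> (to_completion (L r) N Y) \<in> carrier C.PS"
    using hom C.D.to_completion_closed[OF Y] by (auto simp: alg_hom_def ring_hom_def simp del: series_ring_simps)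
  then obtain W where W: "W \<in> fps_over (lattice_supp r)" "\<tau> (to_completion (L r) N Y) = C.proj W"
    by (rule C.proj_surj)
  have "vanishing N m (W - V)" for m
    using \<tau> W by (rule C.normalized_root_unique)
  then have "C.proj W = C.proj V"
    using W(1) V(1) fps_over_mono[OF C.Z_subset] by (subst C.proj_eq_iff) auto
  then have "\<tau> (to_completion (L r) N Y) = C.\<phi> Y"
    by (simp add: W(2) C.\<phi>_def \<Phi>_Y)
  then show "\<tau> = C.lift.ext"
    using C.alg_hom_eq_ext[OF r_pos hom] by simp
qed

lemma series_incl_proj:
  assumes "0 \<in> Q"
  shows "series_incl \<theta> N (\<lambda>n. quot_class (skew_laurent \<theta> \<lparr>carrier := Q\<rparr>) N (fps_nth s n)) = A.proj s"
  by (rule ext) (simp only: series_incl_def coset_map_quot_class[OF N(1) assms] A.proj_nth L_1)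

lemma tau_C_Y_over_Y_eq: "tau_C_Y_over_Y \<theta> r N = A.proj (V * fps_const Y')"
proof -
  have Y: "Y \<in> carrier (L r)" by (simp add: single_in_lattice_supp)
  have "tau_C \<theta> r N (to_completion (L r) N Y) = C.proj V"
    unfolding tau_C_eq C.lift.ext_to_completion[OF Y] by (simp add: C.\<phi>_def \<Phi>_Y)
  then have "series_incl \<theta> N (tau_C \<theta> r N (to_completion (C_ring \<theta> r) N Y)) = A.proj V"
    using series_incl_proj[of "lattice_supp r" V]
      subring_0[OF is_subring_lattice_supp[where d = r and 'k = 'k]]
    by (simp add: C.proj_def L_def flip: L_r)
  then show ?thesis
    unfolding tau_C_Y_over_Y_def A_eq A.proj_const[symmetric]
    by (simp add: A.proj_mult_right fps_const_in_Z Y_in_Z)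
qed

lemma X_image_eq: "X_image \<theta> r N = A.proj (S * fps_const (single 1 1))"
proof -
  have shift: "(\<lambda>n. A.proj (V * fps_const Y') (Suc n)) = A.proj x"
    by (rule ext) (simp add: A.proj_nth x_def mult.commute)
  have "series_root A.R (quot_str (L (Suc 0)) N) r (tau_C_Y_over_Y \<theta> r N) = A.proj S"
    unfolding tau_C_Y_over_Y_eq series_root_def shift
    using A.series_root_proj[OF x_in_Z c_in_Z[unfolded c_def]] by (simp add: S_def c_def)
  moreover have "S \<in> fps_over (lattice_supp r)"
    using S_in_Z fps_over_mono[OF C.Z_subset] by blast
  moreover have "fps_const (single 1 1) \<in> fps_over (lattice_supp (Suc 0) :: (int \<Rightarrow>\<^sub>0 'k) set)"
    by (simp add: fps_over_def)
  ultimately show ?thesis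
    unfolding X_image_def series_X_def A_eq A.proj_const[symmetric]
    by (simp only: A.proj_mult_left)
qed

lemma \<phi>_X: "A.\<phi> (single 1 1) = X_image \<theta> r N"
  by (simp only: X_image_eq A.\<phi>_def \<Phi>_X)

lemma is_hom_with_X_image_iff: "is_hom_with_X_image \<theta> r N \<tau> \<longleftrightarrow> \<tau> = A.lift.ext"
proof
  assume "is_hom_with_X_image \<theta> r N \<tau>"
  then show "\<tau> = A.lift.ext"
    unfolding is_hom_with_X_image_def A_eq
    by (intro A.alg_hom_eq_ext) (simp_all add: \<phi>_X)
next
  assume "\<tau> = A.lift.ext"
  moreover have "single 1 1 \<in> carrier (L (Suc 0))" by simp
  ultimately show "is_hom_with_X_image \<theta> r N \<tau>"
    using A.ext_normalized
    unfolding is_hom_with_X_image_def A_eq normalized_iso_def alg_iso_def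
    by (simp only: A.lift.ext_to_completion \<phi>_X) simp
qed

lemma tau_can_eq: "tau_can \<theta> r N = A.lift.ext"
  unfolding tau_can_def is_hom_with_X_image_iff by simp

lemma central_element_Z: "central_element (Z_ring \<theta> r) N"
proof (rule central_element.intro[OF ring_Z], unfold_locales)
  show "N \<in> carrier (Z_ring \<theta> r)" using N(1) by simp
qed (use N(1) in \<open>simp add: Z_simps mult.commute\<close>)

lemma Z_series_X_iff:
  "t \<in> Z_series_X \<theta> r N \<longleftrightarrow> (\<exists>s\<in>fps_over Z. t = A.proj (s * fps_const (single 1 1)))"
proof -
  interpret Zr: central_element "Z_ring \<theta> r" N by (rule central_element_Z)
  have 0: "0 \<in> Z" using is_subring_Z by (rule subring_0)
  have prod: "series_incl \<theta> N (\<lambda>n. quot_class (Z_ring \<theta> r) N (fps_nth s n))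
      \<otimes>\<^bsub>series_ring (quot (skew_laurent \<theta>) N)\<^esub> series_X \<theta> N = A.proj (s * fps_const (single 1 1))"
    if "s \<in> fps_over Z" for s
  proof -
    have "s \<in> fps_over (lattice_supp r)" using that fps_over_mono[OF C.Z_subset] by blast
    moreover have "fps_const (single 1 1) \<in> fps_over (lattice_supp (Suc 0) :: (int \<Rightarrow>\<^sub>0 'k) set)"
      by (simp add: fps_over_def)
    moreover have "series_incl \<theta> N (\<lambda>n. quot_class (Z_ring \<theta> r) N (fps_nth s n)) = A.proj s"
      unfolding Z_ring_eq by (rule series_incl_proj[OF 0])
    ultimately show ?thesis
      unfolding series_X_def A_eq A.proj_const[symmetric] by (simp only: A.proj_mult_left)
  qed
  show ?thesis
  proof
    assume "t \<in> Z_series_X \<theta> r N"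
    then obtain s where s: "s \<in> carrier (series_ring (quot (Z_ring \<theta> r) N))"
        "t = series_incl \<theta> N s \<otimes>\<^bsub>series_ring (quot (skew_laurent \<theta>) N)\<^esub> series_X \<theta> N"
      by (auto simp: Z_series_X_def)
    then have "\<forall>n. \<exists>z. z \<in> Z \<and> s n = quot_class (Z_ring \<theta> r) N z"
      using Zr.carrier_quot_iff by (auto simp: Bex_def)
    then obtain z where z: "\<And>n. z n \<in> Z" "\<And>n. s n = quot_class (Z_ring \<theta> r) N (z n)" by metis
    have "s = (\<lambda>n. quot_class (Z_ring \<theta> r) N (fps_nth (Abs_fps z) n))" using z by auto
    moreover have "Abs_fps z \<in> fps_over Z" using z by (simp add: fps_over_def)
    ultimately show "\<exists>s\<in>fps_over Z. t = A.proj (s * fps_const (single 1 1))"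
      using s(2) prod by metis
  next
    assume "\<exists>s\<in>fps_over Z. t = A.proj (s * fps_const (single 1 1))"
    then obtain s where s: "s \<in> fps_over Z" "t = A.proj (s * fps_const (single 1 1))" by blast
    then have "(\<lambda>n. quot_class (Z_ring \<theta> r) N (fps_nth s n)) \<in> carrier (series_ring (quot (Z_ring \<theta> r) N))"
      using Zr.carrier_quot_iff by (auto simp: fps_over_def)
    then show "t \<in> Z_series_X \<theta> r N"
      unfolding Z_series_X_def s(2) prod[OF s(1), symmetric] by blast
  qed
qed

text \<open>Newton uniqueness for the polynomial whose roots are the \<open>r\<close>-th roots of
  \<open>S\<^sup>r\<close>: its derivative at \<open>S\<close> has constant coefficient
  \<open>r\<close>, which is invertible in the field.\<close>

lemma root_of_unit_unique:
  assumes s: "\<And>m. vanishing N m (s ^ r - S ^ r)" "N dvd fps_nth s 0 - 1"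
  shows "vanishing N m (s - S)"
proof (rule newton_root_unique[where h = "monom 1 r - [:S ^ r:]" and u = "fps_const (single 0 (1 / of_nat r))"])
  have "fps_nth (poly (pderiv (monom 1 r - [:S ^ r:])) S) 0 = of_nat r"
    by (simp add: pderiv_diff pderiv_monom poly_monom S_nth_0 fps_power_zeroth_eq_one flip: fps_of_nat)
  moreover have "single (0::int) (1 / of_nat r :: 'k) * of_nat r = 1"
    using of_nat_r by (simp add: mult_single flip: single_of_nat)
  ultimately show "vanishing N 1 (fps_const (single 0 (1 / of_nat r)) *
      poly (pderiv (monom 1 r - [:S ^ r:])) S - 1)"
    by (simp add: vanishing_def)
qed (use s in \<open>simp_all add: poly_monom vanishing_def S_nth_0\<close>)

text \<open>If \<open>X\<close> goes to \<open>s X\<close> with \<open>s\<close> central, then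
  \<open>Y\<close> goes to \<open>s\<^sup>r Y\<close>. Uniqueness of the root forces
  \<open>s\<^sup>r\<close> to agree with \<open>S\<^sup>r\<close> modulo \<open>N\<close>, and the
  normalization modulo \<open>T\<close> selects \<open>S\<close> among the \<open>r\<close>-th
  roots.\<close>

lemma normalized_Z_series_X_iff:
  "normalized_iso (L (Suc 0)) N \<tau> \<and> \<tau> (to_completion (L (Suc 0)) N (single 1 1)) \<in> Z_series_X \<theta> r N
    \<longleftrightarrow> \<tau> = A.lift.ext"
proof
  assume "\<tau> = A.lift.ext"
  moreover have "single 1 1 \<in> carrier (L (Suc 0))" by simp
  ultimately show "normalized_iso (L (Suc 0)) N \<tau> \<and>
      \<tau> (to_completion (L (Suc 0)) N (single 1 1)) \<in> Z_series_X \<theta> r N"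
    using A.ext_normalized S_in_Z
    by (auto simp only: Z_series_X_iff A.lift.ext_to_completion \<phi>_X X_image_eq)
next
  assume *: "normalized_iso (L (Suc 0)) N \<tau> \<and> \<tau> (to_completion (L (Suc 0)) N (single 1 1)) \<in> Z_series_X \<theta> r N"
  define X where "X = (single 1 1 :: int \<Rightarrow>\<^sub>0 'k)"
  from * obtain s where \<tau>: "normalized_iso (L (Suc 0)) N \<tau>" and s: "s \<in> fps_over Z"
    and \<tau>X: "\<tau> (to_completion (L (Suc 0)) N X) = A.proj (s * fps_const X)"
    by (auto simp: Z_series_X_iff X_def)
  have hom: "\<tau> \<in> alg_hom (completion (L (Suc 0)) N) (completion_str (L (Suc 0)) N) A.PS (series_str (L (Suc 0)) N)"
    using \<tau> by (simp add: normalized_iso_def alg_iso_def)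
  have mem: "t \<in> fps_over (lattice_supp (Suc 0))" for t :: "(int \<Rightarrow>\<^sub>0 'k) fps"
    by (simp add: fps_over_def)
  have \<psi>: "(\<lambda>a. \<tau> (to_completion (L (Suc 0)) N a)) \<in> ring_hom (L (Suc 0)) A.PS"
  proof -
    have "\<tau> \<in> ring_hom (completion (L (Suc 0)) N) A.PS"
      using hom unfolding alg_hom_def by blast
    from ring_hom_trans[OF A.D.to_completion_hom this] show ?thesis by (simp only: comp_def)
  qed
  have sn: "s ^ n \<in> fps_over Z" for n using QZ s by (rule subring_power)
  \<comment> \<open>Centrality of \<open>s\<close> collects its powers on one side. For
    \<open>n = r\<close> the whole series is central, as \<open>normalized_root_unique\<close>
    requires of the image of \<open>Y\<close>.\<close>
  have X_pow: "\<tau> (to_completion (L (Suc 0)) N (single (int n) 1)) = A.proj (fps_const (single (int n) 1) * s ^ n)" for n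
  proof (induction n)
    case 0
    show ?case using ring_hom_one[OF \<psi>] by (simp add: A.proj_1)
  next
    case (Suc n)
    have "single (int (Suc n)) 1 = single (int n) 1 \<otimes>\<^bsub>L (Suc 0)\<^esub> X"
      by (simp add: X_def skew_mult_single aut_pow_hom add.commute)
    then have "\<tau> (to_completion (L (Suc 0)) N (single (int (Suc n)) 1)) =
        A.proj (fps_const (single (int n) 1) * s ^ n) \<otimes>\<^bsub>A.PS\<^esub> A.proj (fps_const X * s)"
      using ring_hom_mult[OF \<psi>, of "single (int n) 1" X] Suc \<tau>X by (simp add: mult.commute)
    also have "\<dots> = A.proj (fps_const (skew_mult \<theta> (single (int n) 1) X) * (s ^ n * s))"
      using A.proj_skew[OF mem mem] skew_fps_const[OF sn s] by simp
    also have "skew_mult \<theta> (single (int n) 1) X = single (int (Suc n)) 1"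
      by (simp add: X_def skew_mult_single aut_pow_hom add.commute)
    finally show ?case by (simp only: power_Suc2)
  qed
  have "vanishing N m (fps_const Y * s ^ r - V)" for m
    using \<tau> _ X_pow
  proof (rule A.normalized_root_unique)
    show "fps_const Y * s ^ r \<in> fps_over (lattice_supp r)"
      using subring_mult[OF QZ fps_const_in_Z[OF Y_in_Z(1)] sn] fps_over_mono[OF C.Z_subset] by blast
  qed
  then have "vanishing N m (fps_const Y' * (fps_const Y * s ^ r - V))" for m
    by (rule vanishing_mult_left)
  moreover have "fps_const Y' * (fps_const Y * s ^ r - V) = s ^ r - S ^ r"
    unfolding S_power right_diff_distrib
    by (simp only: mult.assoc[symmetric] fps_const_mult Y_inverse fps_const_1_eq_1 mult_1)
  ultimately have "vanishing N m (s ^ r - S ^ r)" for m by simp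
  moreover have "N dvd fps_nth s 0 - 1"
  proof -
    have "A.proj (s * fps_const X) 0 = A.cls X"
    proof -
      have "to_completion (L (Suc 0)) N X \<in> carrier A.D.Dhat"
        by (rule A.D.to_completion_closed) simp
      then have "A.proj (s * fps_const X) 0 = to_completion (L (Suc 0)) N X 1"
        using \<tau> \<tau>X unfolding normalized_iso_def by metis
      then show ?thesis by (simp add: A.D.to_completion_nth quot_class_def)
    qed
    then have "N dvd fps_nth s 0 * X - X"
      by (simp add: A.proj_nth A.cls_eq_iff)
    \<comment> \<open>Since \<open>X\<close> is a unit, it can be cancelled from the congruence
      between \<open>s X\<close> and \<open>X\<close> modulo \<open>T\<close>.\<close>
    then have "N dvd (fps_nth s 0 * X - X) * single (- 1) 1" by (rule dvd_mult2)
    moreover have "X * single (- 1) 1 = 1" by (simp add: X_def mult_single)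
    then have "(fps_nth s 0 * X - X) * single (- 1) 1 = fps_nth s 0 - 1"
      by (simp only: left_diff_distrib mult.assoc mult_1_right)
    ultimately show ?thesis by simp
  qed
  ultimately have "vanishing N m (s - S)" for m by (rule root_of_unit_unique)
  then have "vanishing N m (s * fps_const X - S * fps_const X)" for m
    by (simp only: vanishing_mult_right flip: left_diff_distrib)
  then have "A.proj (s * fps_const X) = A.proj (S * fps_const X)"
    using mem by (simp add: A.proj_eq_iff)
  then have "\<tau> (to_completion (L (Suc 0)) N X) = A.\<phi> X"
    unfolding \<tau>X by (simp only: X_def \<phi>_X X_image_eq)
  then show "\<tau> = A.lift.ext"
    using A.alg_hom_eq_ext[OF _ hom] by (simp add: X_def)
qed

lemma canonical_iso:
  "((\<exists>!\<tau>. is_hom_with_X_image \<theta> r N \<tau>) \<and>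
      is_hom_with_X_image \<theta> r N (tau_can \<theta> r N) \<and>
      normalized_iso (skew_laurent \<theta>) N (tau_can \<theta> r N)) \<and>
    (\<forall>\<tau>. (normalized_iso (skew_laurent \<theta>) N \<tau> \<and>
         \<tau> (to_completion (skew_laurent \<theta>) N (X_pow 1)) \<in> Z_series_X \<theta> r N)
       \<longleftrightarrow> \<tau> = tau_can \<theta> r N)"
  unfolding is_hom_with_X_image_iff tau_can_eq A_eq normalized_Z_series_X_iff
  using A.ext_normalized by simp

end

theorem theorem2p2p5:
  fixes \<theta> :: "'k::field \<Rightarrow> 'k" and r :: nat and N :: "int \<Rightarrow>\<^sub>0 'k"
  assumes "field_automorphism \<theta>"
    and "has_finite_order \<theta> r"
    and "\<not> CHAR('k) dvd r"
    and "N \<in> carrier (Z_ring \<theta> r)"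
    and "separable_Y \<theta> r N"
  shows "((\<exists>!\<tau>. is_hom_with_X_image \<theta> r N \<tau>) \<and>
          is_hom_with_X_image \<theta> r N (tau_can \<theta> r N) \<and>
          normalized_iso (skew_laurent \<theta>) N (tau_can \<theta> r N)) \<and>
         (\<forall>\<tau>. (normalized_iso (skew_laurent \<theta>) N \<tau> \<and>
                 \<tau> (to_completion (skew_laurent \<theta>) N (X_pow 1)) \<in> Z_series_X \<theta> r N)
               \<longleftrightarrow> \<tau> = tau_can \<theta> r N)"
proof -
  interpret skew_laurent_setting \<theta> r
    using assms(1,2) by unfold_locales
  interpret separable_setting \<theta> r N
    using assms(3-5) by unfold_locales simp_all
  \<comment> \<open>Any representative of the root will do: the maps in the conclusion are
    characterised without reference to \<open>V\<close>.\<close>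
  obtain V where "V \<in> fps_over Z" "fps_nth V 0 = Y" "\<And>m. vanishing N m (poly h V)"
    using root_exists by blast
  then interpret canonical_root \<theta> r N V
    by unfold_locales
  show ?thesis by (rule canonical_iso)
qed

end
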